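(* Let $k$ be a field, let $N$ and $T$ be cocommutative Hopf algebras over $k$, let $(N,T,\mu,\nu)$ be an abelian matched pair of Hopf algebras, and let $A$ be a commutative $k$-algebra. Then there is an isomorphism of abelian groups $P_{\mu,\nu}(N,T,A)\simeq\mathcal{H}^1(N,T,A)$ between the group of skew bimeasurings $N\otimes T\to A$ (under convolution) and the first cohomology group of the matched pair with coefficients in $A$. In particular, the abelian group $P(N,T,A)$ of all bimeasurings from $N\otimes T$ to $A$ is isomorphic to the cohomology group $\mathcal{H}^1(N,T,A)$ of the trivial matched pair $(N,T,1\otimes\varepsilon,\varepsilon\otimes 1)$.
   Context: Sweedler notation $\Delta(c)=c_1\otimes c_2$ is used. Abelian matched pair: $N,T$ cocommutative Hopf algebras with coalgebra maps $\mu\colon N\otimes T\to N$, $\mu(n\otimes t)=n^t$, and $\nu\colon N\otimes T\to T$, $\nu(n\otimes t)=n(t)$, such that $\mu$ is a right $T$-module structure on $N$, $\nu$ is a left $N$-module structure on $T$, and $n(ts)=n_1(t_1)\,\bigl(n_2^{t_2}\bigr)(s)$, $n(1)=\varepsilon(n)1$, $(nm)^t=n^{m_1(t_1)}\,m_2^{t_2}$, $1^t=\varepsilon(t)1$ for $n,m\in N$, $t,s\in T$. The trivial matched pair has $n^t=\varepsilon(t)n$ and $n(t)=\varepsilon(n)t$. Skew bimeasuring: a linear map $\psi\colon N\otimes T\to A$ with $\psi(nm,t)=\psi(n,m_1(t_1))\,\psi(m_2,t_2)$, $\psi(1,t)=\varepsilon(t)1_A$, $\psi(n,ts)=\psi(n_1^{t_1},s)\,\psi(n_2,t_2)$,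 $\psi(n,1)=\varepsilon(n)1_A$. The set $P_{\mu,\nu}(N,T,A)$ of all of these is an abelian group under convolution in $\mathrm{Hom}(N\otimes T,A)$. Bimeasuring: a linear map $\psi\colon N\otimes T\to A$ with $\psi(nm,t)=\psi(n,t_1)\psi(m,t_2)$, $\psi(1,t)=\varepsilon(t)1_A$, $\psi(n,ts)=\psi(n_1,t)\psi(n_2,s)$, $\psi(n,1)=\varepsilon(n)1_A$. $P(N,T,A)$ is the set of all of these, with convolution. Cohomology of the matched pair: it is the cohomology of the total complex of the double complex of abelian groups $\mathrm{Reg}_+(N^{\otimes p}\otimes T^{\otimes q},A)$, $p,q\ge 1$, placed in total degree $p+q-1$, where $\mathrm{Reg}_+$ denotes convolution-invertible linear maps that are normalized (value $\varepsilon$ whenever one tensor factor is $1$), $A$ having trivial actions. As there are no cochains in degree $0$, $\mathcal{H}^1(N,T,A)$ is the group of 1-cocycles: the subgroup of those $f\in\mathrm{Reg}_+(N\otimes T,A)$ (with convolution inverse $f^{-1}$) satisfying both $f(n_1,m_1(t_1))\,f^{-1}(n_2m_2,t_2)\,f(m_3,t_3)=\varepsilon(n)\varepsilon(m)\varepsilon(t)1_A$ and $f(n_1^{t_1},s_1)\,f^{-1}(n_2,t_2s_2)\,f(n_3,t_3)=\varepsilon(n)\varepsilon(t)\varepsilon(s)1_A$ for all $n,m\in N$, $t,s\in T$. *)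

theory Defs
  imports "HOL-Library.Multiset" "HOL-Algebra.Module"
begin

section \<open>Linear maps and tensor products over a field\<close>

text \<open>A vector space over the field \<open>K\<close> is a \<^locale>\<open>module\<close> \<open>V\<close> over \<open>K\<close>; the
  multiplicative fields of the record \<open>V\<close> matter only when \<open>V\<close> is an algebra.\<close>

definition linear_map ::
    "('k, 'e) ring_scheme \<Rightarrow> ('k, 'v, 'f) module_scheme \<Rightarrow> ('k, 'w, 'g) module_scheme
      \<Rightarrow> ('v \<Rightarrow> 'w) \<Rightarrow> bool" where
  "linear_map K V W f \<longleftrightarrow>
     f \<in> carrier V \<rightarrow> carrier W \<and>
     (\<forall>x \<in> carrier V. \<forall>y \<in> carrier V. f (x \<oplus>\<^bsub>V\<^esub> y) = f x \<oplus>\<^bsub>W\<^esub> f y) \<and>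
     (\<forall>a \<in> carrier K. \<forall>x \<in> carrier V. f (a \<odot>\<^bsub>V\<^esub> x) = a \<odot>\<^bsub>W\<^esub> f x)"

definition bilinear_map ::
    "('k, 'e) ring_scheme \<Rightarrow> ('k, 'm, 'f) module_scheme \<Rightarrow> ('k, 'n, 'g) module_scheme
      \<Rightarrow> ('k, 'p, 'h) module_scheme \<Rightarrow> ('m \<Rightarrow> 'n \<Rightarrow> 'p) \<Rightarrow> bool" where
  "bilinear_map K M N P B \<longleftrightarrow>
     (\<forall>x \<in> carrier M. linear_map K N P (B x)) \<and>
     (\<forall>y \<in> carrier N. linear_map K M P (\<lambda>x. B x y))"

text \<open>Linear maps are made \<^const>\<open>extensional\<close> here, so that equality of elements of
  \<open>Hom K V W\<close> is equality of linear maps on the carrier of \<open>V\<close>.\<close>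

definition Hom ::
    "('k, 'e) ring_scheme \<Rightarrow> ('k, 'v, 'f) module_scheme \<Rightarrow> ('k, 'w, 'g) module_scheme
      \<Rightarrow> ('v \<Rightarrow> 'w) set" where
  "Hom K V W = {f. linear_map K V W f \<and> f \<in> extensional (carrier V)}"

definition scalars :: "('k, 'e) ring_scheme \<Rightarrow> ('k, 'k) module" where
  "scalars K = \<lparr>carrier = carrier K, monoid.mult = monoid.mult K, one = one K, zero = zero K, add = add K,
     smult = monoid.mult K\<rparr>"

text \<open>The multiset \<open>{#(x\<^sub>1, y\<^sub>1), \<dots>, (x\<^sub>r, y\<^sub>r)#}\<close> stands for the formal sum of the
  symbols \<open>x\<^sub>i \<otimes> y\<^sub>i\<close>. The tensor product is the quotient of the free commutative monoid
  of these formal sums by the congruence generated by the bilinearity relations; the inverse of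
  the class of \<open>x \<otimes> y\<close> is the class of \<open>(- x) \<otimes> y\<close>, so this is the usual group.\<close>

inductive tensor_cong ::
    "('k, 'e) ring_scheme \<Rightarrow> ('k, 'm, 'f) module_scheme \<Rightarrow> ('k, 'n, 'g) module_scheme
      \<Rightarrow> ('m \<times> 'n) multiset \<Rightarrow> ('m \<times> 'n) multiset \<Rightarrow> bool"
  for K M N where
  refl: "tensor_cong K M N p p"
| sym: "tensor_cong K M N p q \<Longrightarrow> tensor_cong K M N q p"
| trans: "tensor_cong K M N p q \<Longrightarrow> tensor_cong K M N q r \<Longrightarrow> tensor_cong K M N p r"
| plus: "tensor_cong K M N p q \<Longrightarrow> tensor_cong K M N (p + r) (q + r)"
| add_left: "x \<in> carrier M \<Longrightarrow> x' \<in> carrier M \<Longrightarrow> y \<in> carrier N \<Longrightarrow>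
    tensor_cong K M N {#(x \<oplus>\<^bsub>M\<^esub> x', y)#} {#(x, y), (x', y)#}"
| add_right: "x \<in> carrier M \<Longrightarrow> y \<in> carrier N \<Longrightarrow> y' \<in> carrier N \<Longrightarrow>
    tensor_cong K M N {#(x, y \<oplus>\<^bsub>N\<^esub> y')#} {#(x, y), (x, y')#}"
| smult: "a \<in> carrier K \<Longrightarrow> x \<in> carrier M \<Longrightarrow> y \<in> carrier N \<Longrightarrow>
    tensor_cong K M N {#(a \<odot>\<^bsub>M\<^esub> x, y)#} {#(x, a \<odot>\<^bsub>N\<^esub> y)#}"
| zero: "y \<in> carrier N \<Longrightarrow> tensor_cong K M N {#(\<zero>\<^bsub>M\<^esub>, y)#} {#}"

definition formal_sums ::
    "('k, 'm, 'f) module_scheme \<Rightarrow> ('k, 'n, 'g) module_scheme \<Rightarrow> ('m \<times> 'n) multiset set" where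
  "formal_sums M N = {p. set_mset p \<subseteq> carrier M \<times> carrier N}"

definition tensor_rel ::
    "('k, 'e) ring_scheme \<Rightarrow> ('k, 'm, 'f) module_scheme \<Rightarrow> ('k, 'n, 'g) module_scheme
      \<Rightarrow> (('m \<times> 'n) multiset \<times> ('m \<times> 'n) multiset) set" where
  "tensor_rel K M N =
     {(p, q). p \<in> formal_sums M N \<and> q \<in> formal_sums M N \<and> tensor_cong K M N p q}"

text \<open>Only the module structure of the tensor product is used, hence the two \<open>undefined\<close>
  fields. In \<open>add\<close> and \<open>smult\<close>, the image under the relation is a single class.\<close>

definition tensor ::
    "('k, 'e) ring_scheme \<Rightarrow> ('k, 'm, 'f) module_scheme \<Rightarrow> ('k, 'n, 'g) module_scheme
      \<Rightarrow> ('k, ('m \<times> 'n) multiset set) module" where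
  "tensor K M N =
     \<lparr>carrier = formal_sums M N // tensor_rel K M N,
      monoid.mult = undefined, one = undefined,
      zero = tensor_rel K M N `` {{#}},
      add = (\<lambda>X Y. tensor_rel K M N `` {p + q | p q. p \<in> X \<and> q \<in> Y}),
      smult = (\<lambda>a X. tensor_rel K M N ``
        {image_mset (\<lambda>(x, y). (a \<odot>\<^bsub>M\<^esub> x, y)) p | p. p \<in> X})\<rparr>"

definition pure_tensor ::
    "('k, 'e) ring_scheme \<Rightarrow> ('k, 'm, 'f) module_scheme \<Rightarrow> ('k, 'n, 'g) module_scheme
      \<Rightarrow> 'm \<Rightarrow> 'n \<Rightarrow> ('m \<times> 'n) multiset set" where
  "pure_tensor K M N x y = tensor_rel K M N `` {{#(x, y)#}}"

text \<open>The linear map on the tensor product induced by a bilinear map \<open>B\<close>. It exists and is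
  unique by the universal property, proved as \<open>tensor_universal\<close> below.\<close>

definition tensor_lift ::
    "('k, 'e) ring_scheme \<Rightarrow> ('k, 'm, 'f) module_scheme \<Rightarrow> ('k, 'n, 'g) module_scheme
      \<Rightarrow> ('k, 'p, 'h) module_scheme \<Rightarrow> ('m \<Rightarrow> 'n \<Rightarrow> 'p) \<Rightarrow> ('m \<times> 'n) multiset set \<Rightarrow> 'p" where
  "tensor_lift K M N P B =
     (THE h. h \<in> Hom K (tensor K M N) P \<and>
       (\<forall>x \<in> carrier M. \<forall>y \<in> carrier N. h (pure_tensor K M N x y) = B x y))"


subsection \<open>The universal property\<close>

lemma tensor_cong_plus:
  assumes "tensor_cong K M N p p'" "tensor_cong K M N q q'"
  shows "tensor_cong K M N (p + q) (p' + q')"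
  by (metis assms tensor_cong.plus tensor_cong.trans union_commute)

lemma formal_sums_plus [simp]:
  "p + q \<in> formal_sums M N \<longleftrightarrow> p \<in> formal_sums M N \<and> q \<in> formal_sums M N"
  by (auto simp: formal_sums_def)

lemma formal_sums_empty [simp]: "{#} \<in> formal_sums M N"
  by (auto simp: formal_sums_def)

lemma formal_sums_add_mset [simp]:
  "add_mset (x, y) p \<in> formal_sums M N \<longleftrightarrow>
     x \<in> carrier M \<and> y \<in> carrier N \<and> p \<in> formal_sums M N"
  by (auto simp: formal_sums_def)

locale two_modules = M: module K M + N: module K N for K (structure) and M and N
begin

abbreviation cls where "cls p \<equiv> tensor_rel K M N `` {p}"

lemma equiv_tensor_rel: "equiv (formal_sums M N) (tensor_rel K M N)"
  by (intro equivI refl_onI symI transI)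
    (auto simp: tensor_rel_def intro: tensor_cong.intros)

lemma cls_eq_iff:
  assumes "p \<in> formal_sums M N" "q \<in> formal_sums M N"
  shows "cls p = cls q \<longleftrightarrow> tensor_cong K M N p q"
  using eq_equiv_class_iff[OF equiv_tensor_rel assms] assms by (auto simp: tensor_rel_def)

lemma carrier_tensorE:
  assumes "X \<in> carrier (tensor K M N)"
  obtains p where "p \<in> formal_sums M N" "X = cls p"
  using assms by (auto simp: tensor_def quotient_def)

lemma cls_closed [simp]: "p \<in> formal_sums M N \<Longrightarrow> cls p \<in> carrier (tensor K M N)"
  by (auto simp: tensor_def quotient_def)

lemma zero_tensor: "\<zero>\<^bsub>tensor K M N\<^esub> = cls {#}"
  by (simp add: tensor_def)

lemma Image_eq_cls:
  assumes "r \<in> S" "r \<in> formal_sums M N"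
    and "\<And>s. s \<in> S \<Longrightarrow> s \<in> formal_sums M N \<and> tensor_cong K M N r s"
  shows "tensor_rel K M N `` S = cls r"
  using assms unfolding tensor_rel_def
  by (auto intro: tensor_cong.trans)

lemma add_tensor:
  assumes "p \<in> formal_sums M N" "q \<in> formal_sums M N"
  shows "cls p \<oplus>\<^bsub>tensor K M N\<^esub> cls q = cls (p + q)"
proof -
  have "tensor_rel K M N `` {p' + q' | p' q'. p' \<in> cls p \<and> q' \<in> cls q} = cls (p + q)"
  proof (rule Image_eq_cls)
    show "p + q \<in> {p' + q' | p' q'. p' \<in> cls p \<and> q' \<in> cls q}"
      using assms by (auto simp: tensor_rel_def intro: tensor_cong.refl)
  qed (use assms in \<open>auto simp: tensor_rel_def intro: tensor_cong_plus\<close>)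
  then show ?thesis by (simp add: tensor_def)
qed

abbreviation sc where "sc a p \<equiv> image_mset (\<lambda>(x, y). (a \<odot>\<^bsub>M\<^esub> x, y)) p"

lemma sc_formal: "a \<in> carrier K \<Longrightarrow> p \<in> formal_sums M N \<Longrightarrow> sc a p \<in> formal_sums M N"
  by (auto simp: formal_sums_def)

lemma sc_cong:
  assumes "tensor_cong K M N p q" "a \<in> carrier K"
  shows "tensor_cong K M N (sc a p) (sc a q)"
  using assms(1)
proof induction
  case (add_left x x' y)
  then show ?case using assms(2)
    by (auto simp: M.smult_r_distr intro: tensor_cong.add_left)
next
  case (add_right x y y')
  then show ?case using assms(2) by (auto intro: tensor_cong.add_right)
next
  case (smult b x y)
  then have "a \<odot>\<^bsub>M\<^esub> (b \<odot>\<^bsub>M\<^esub> x) = b \<odot>\<^bsub>M\<^esub> (a \<odot>\<^bsub>M\<^esub> x)"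
    using assms(2) by (metis M.smult_assoc1 M.R.m_comm)
  then show ?case using assms(2) smult by (auto intro: tensor_cong.smult)
next
  case (zero y)
  then show ?case using assms(2) by (auto intro: tensor_cong.zero)
qed (auto intro: tensor_cong.intros)

lemma smult_tensor:
  assumes "a \<in> carrier K" "p \<in> formal_sums M N"
  shows "a \<odot>\<^bsub>tensor K M N\<^esub> cls p = cls (sc a p)"
proof -
  have "tensor_rel K M N `` {sc a p' | p'. p' \<in> cls p} = cls (sc a p)"
  proof (rule Image_eq_cls)
    show "sc a p \<in> {sc a p' | p'. p' \<in> cls p}"
      using assms by (auto simp: tensor_rel_def intro: tensor_cong.refl)
  qed (use assms in \<open>auto simp: tensor_rel_def sc_formal intro: sc_cong\<close>)
  then show ?thesis by (simp add: tensor_def)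
qed

lemma tensor_cong_sum:
  assumes "p \<in> formal_sums M N"
    and "\<And>x y. x \<in> carrier M \<Longrightarrow> y \<in> carrier N \<Longrightarrow>
      tensor_cong K M N (f (x, y)) (g (x, y))"
  shows "tensor_cong K M N (\<Sum>z\<in>#p. f z) (\<Sum>z\<in>#p. g z)"
  using assms(1)
proof (induction p)
  case (add z p)
  then show ?case using assms(2) by (cases z) (auto intro: tensor_cong_plus)
qed (auto intro: tensor_cong.refl)

lemma sum_mset_singles: "(\<Sum>z\<in>#p. {#f z#}) = image_mset f p"
  by (induction p) auto

lemma module_tensor: "module K (tensor K M N)"
proof (rule moduleI)
  show "cring K" by (rule M.R.is_cring)
  let ?T = "tensor K M N"
  show "abelian_group ?T"
  proof (rule abelian_groupI)
    show "\<exists>Y \<in> carrier ?T. Y \<oplus>\<^bsub>?T\<^esub> X = \<zero>\<^bsub>?T\<^esub>" if "X \<in> carrier ?T" for X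
    proof -
      from that obtain p where p: "p \<in> formal_sums M N" "X = cls p" by (rule carrier_tensorE)
      let ?q = "image_mset (\<lambda>(x, y). (\<ominus>\<^bsub>M\<^esub> x, y)) p"
      have q: "?q \<in> formal_sums M N" using p by (auto simp: formal_sums_def)
      have "tensor_cong K M N (\<Sum>z\<in>#p. {#(\<ominus>\<^bsub>M\<^esub> fst z, snd z), z#}) (\<Sum>z\<in>#p. {#})"
      proof (rule tensor_cong_sum[OF p(1)])
        fix x y assume xy: "x \<in> carrier M" "y \<in> carrier N"
        then have "tensor_cong K M N {#(\<zero>\<^bsub>M\<^esub>, y)#} {#(\<ominus>\<^bsub>M\<^esub> x, y), (x, y)#}"
          using tensor_cong.add_left[of "\<ominus>\<^bsub>M\<^esub> x" M x y N K] by (simp add: M.l_neg)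
        then show "tensor_cong K M N {#(\<ominus>\<^bsub>M\<^esub> fst (x, y), snd (x, y)), (x, y)#} {#}"
          using tensor_cong.trans[OF tensor_cong.sym tensor_cong.zero] xy by simp
      qed
      moreover have "(\<Sum>z\<in>#p. {#(\<ominus>\<^bsub>M\<^esub> fst z, snd z), z#}) = ?q + p"
        by (induction p) (auto simp: case_prod_unfold)
      ultimately have "tensor_cong K M N (?q + p) {#}" by simp
      then have "cls ?q \<oplus>\<^bsub>?T\<^esub> X = \<zero>\<^bsub>?T\<^esub>"
        using p q by (simp add: add_tensor zero_tensor cls_eq_iff)
      then show ?thesis using cls_closed[OF q] by blast
    qed
  next
    show "X \<oplus>\<^bsub>?T\<^esub> Y \<in> carrier ?T" if "X \<in> carrier ?T" "Y \<in> carrier ?T" for X Y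
      using that by (elim carrier_tensorE) (simp add: add_tensor)
    show "\<zero>\<^bsub>?T\<^esub> \<in> carrier ?T" by (simp add: zero_tensor)
    show "X \<oplus>\<^bsub>?T\<^esub> Y \<oplus>\<^bsub>?T\<^esub> Z = X \<oplus>\<^bsub>?T\<^esub> (Y \<oplus>\<^bsub>?T\<^esub> Z)"
      if "X \<in> carrier ?T" "Y \<in> carrier ?T" "Z \<in> carrier ?T" for X Y Z
      using that by (elim carrier_tensorE) (simp add: add_tensor add.assoc)
    show "X \<oplus>\<^bsub>?T\<^esub> Y = Y \<oplus>\<^bsub>?T\<^esub> X" if "X \<in> carrier ?T" "Y \<in> carrier ?T" for X Y
      using that by (elim carrier_tensorE) (simp add: add_tensor add.commute)
    show "\<zero>\<^bsub>?T\<^esub> \<oplus>\<^bsub>?T\<^esub> X = X" if "X \<in> carrier ?T" for X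
      using that by (elim carrier_tensorE) (simp add: zero_tensor add_tensor)
  qed
  show "a \<odot>\<^bsub>?T\<^esub> X \<in> carrier ?T" if "a \<in> carrier K" "X \<in> carrier ?T" for a X
    using that by (elim carrier_tensorE) (simp add: smult_tensor sc_formal)
  show "(a \<oplus>\<^bsub>K\<^esub> b) \<odot>\<^bsub>?T\<^esub> X = a \<odot>\<^bsub>?T\<^esub> X \<oplus>\<^bsub>?T\<^esub> b \<odot>\<^bsub>?T\<^esub> X"
    if ab: "a \<in> carrier K" "b \<in> carrier K" and X: "X \<in> carrier ?T" for a b X
  proof -
    from X obtain p where p: "p \<in> formal_sums M N" "X = cls p" by (rule carrier_tensorE)
    have "tensor_cong K M N (\<Sum>z\<in>#p. {#((a \<oplus>\<^bsub>K\<^esub> b) \<odot>\<^bsub>M\<^esub> fst z, snd z)#})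
        (\<Sum>z\<in>#p. {#(a \<odot>\<^bsub>M\<^esub> fst z, snd z), (b \<odot>\<^bsub>M\<^esub> fst z, snd z)#})"
      using ab by (intro tensor_cong_sum[OF p(1)])
        (auto simp: M.smult_l_distr intro: tensor_cong.add_left)
    moreover have "(\<Sum>z\<in>#p. {#((a \<oplus>\<^bsub>K\<^esub> b) \<odot>\<^bsub>M\<^esub> fst z, snd z)#}) = sc (a \<oplus>\<^bsub>K\<^esub> b) p"
      by (simp add: sum_mset_singles case_prod_unfold)
    moreover have "(\<Sum>z\<in>#p. {#(a \<odot>\<^bsub>M\<^esub> fst z, snd z), (b \<odot>\<^bsub>M\<^esub> fst z, snd z)#})
        = sc a p + sc b p"
      by (induction p) (auto simp: case_prod_unfold)
    ultimately show ?thesis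
      using p ab by (simp add: smult_tensor add_tensor sc_formal cls_eq_iff)
  qed
  show "a \<odot>\<^bsub>?T\<^esub> (X \<oplus>\<^bsub>?T\<^esub> Y) = a \<odot>\<^bsub>?T\<^esub> X \<oplus>\<^bsub>?T\<^esub> a \<odot>\<^bsub>?T\<^esub> Y"
    if "a \<in> carrier K" "X \<in> carrier ?T" "Y \<in> carrier ?T" for a X Y
    using that by (elim carrier_tensorE) (simp add: smult_tensor add_tensor sc_formal)
  show "(a \<otimes>\<^bsub>K\<^esub> b) \<odot>\<^bsub>?T\<^esub> X = a \<odot>\<^bsub>?T\<^esub> (b \<odot>\<^bsub>?T\<^esub> X)"
    if ab: "a \<in> carrier K" "b \<in> carrier K" and X: "X \<in> carrier ?T" for a b X
  proof -
    from X obtain p where p: "p \<in> formal_sums M N" "X = cls p" by (rule carrier_tensorE)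
    have "sc (a \<otimes>\<^bsub>K\<^esub> b) p = sc a (sc b p)"
      using ab p(1) by (induction p) (auto simp: M.smult_assoc1)
    then show ?thesis using p ab by (simp add: smult_tensor sc_formal)
  qed
  show "\<one>\<^bsub>K\<^esub> \<odot>\<^bsub>?T\<^esub> X = X" if X: "X \<in> carrier ?T" for X
  proof -
    from X obtain p where p: "p \<in> formal_sums M N" "X = cls p" by (rule carrier_tensorE)
    have "sc \<one>\<^bsub>K\<^esub> p = p" using p(1) by (induction p) auto
    then show ?thesis using p by (simp add: smult_tensor)
  qed
qed

lemma pure_closed [simp]:
  "x \<in> carrier M \<Longrightarrow> y \<in> carrier N \<Longrightarrow> pure_tensor K M N x y \<in> carrier (tensor K M N)"
  by (simp add: pure_tensor_def)

lemma bilinear_pure: "bilinear_map K M N (tensor K M N) (pure_tensor K M N)"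
  unfolding bilinear_map_def linear_map_def
proof (intro conjI ballI funcsetI)
  fix x x' y assume xy: "x \<in> carrier M" "x' \<in> carrier M" "y \<in> carrier N"
  then show "pure_tensor K M N (x \<oplus>\<^bsub>M\<^esub> x') y =
      pure_tensor K M N x y \<oplus>\<^bsub>tensor K M N\<^esub> pure_tensor K M N x' y"
    using tensor_cong.add_left[OF xy, of K]
    by (simp add: pure_tensor_def add_tensor cls_eq_iff add_mset_commute)
next
  fix x y y' assume xy: "x \<in> carrier M" "y \<in> carrier N" "y' \<in> carrier N"
  then show "pure_tensor K M N x (y \<oplus>\<^bsub>N\<^esub> y') =
      pure_tensor K M N x y \<oplus>\<^bsub>tensor K M N\<^esub> pure_tensor K M N x y'"
    using tensor_cong.add_right[OF xy, of K]
    by (simp add: pure_tensor_def add_tensor cls_eq_iff add_mset_commute)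
next
  fix x a y assume xy: "x \<in> carrier M" "a \<in> carrier K" "y \<in> carrier N"
  then show "pure_tensor K M N x (a \<odot>\<^bsub>N\<^esub> y) = a \<odot>\<^bsub>tensor K M N\<^esub> pure_tensor K M N x y"
    using tensor_cong.sym[OF tensor_cong.smult[OF xy(2,1,3)]]
    by (simp add: pure_tensor_def smult_tensor cls_eq_iff)
next
  fix x a y assume "y \<in> carrier N" "a \<in> carrier K" "x \<in> carrier M"
  then show "pure_tensor K M N (a \<odot>\<^bsub>M\<^esub> x) y = a \<odot>\<^bsub>tensor K M N\<^esub> pure_tensor K M N x y"
    by (simp add: pure_tensor_def smult_tensor)
qed auto

lemma tensor_universal:
  assumes P: "module K P" and B: "bilinear_map K M N P B"
  shows "\<exists>!h. h \<in> Hom K (tensor K M N) P \<and>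
      (\<forall>x \<in> carrier M. \<forall>y \<in> carrier N. h (pure_tensor K M N x y) = B x y)"
proof -
  interpret P: module K P by fact
  interpret T: module K "tensor K M N" by (rule module_tensor)
  have BC: "B x y \<in> carrier P" if "x \<in> carrier M" "y \<in> carrier N" for x y
    using B that by (auto simp: bilinear_map_def linear_map_def)
  define B' where "B' = (\<lambda>(x, y). if x \<in> carrier M \<and> y \<in> carrier N then B x y else \<zero>\<^bsub>P\<^esub>)"
  define g where "g = (\<lambda>z s. if s \<in> carrier P then B' z \<oplus>\<^bsub>P\<^esub> s else s)"
  define ev where "ev = fold_mset g \<zero>\<^bsub>P\<^esub>"
  have B'C: "B' z \<in> carrier P" for z by (cases z) (auto simp: B'_def BC)
  interpret g: comp_fun_commute g
    by standard (auto simp: g_def fun_eq_iff B'C P.a_ac)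
  have ev_g: "ev (add_mset z p) = g z (ev p)" for p z by (simp add: ev_def)
  have evC: "ev p \<in> carrier P" for p
  proof (induction p)
    case empty
    then show ?case by (simp add: ev_def)
  next
    case (add z p)
    then show ?case by (simp add: ev_g g_def B'C)
  qed
  have ev_add: "ev (add_mset z p) = B' z \<oplus>\<^bsub>P\<^esub> ev p" for p z
    by (simp add: ev_g g_def evC)
  have ev0: "ev {#} = \<zero>\<^bsub>P\<^esub>" by (simp add: ev_def)
  have ev_plus: "ev (p + q) = ev p \<oplus>\<^bsub>P\<^esub> ev q" for p q
    by (induction p) (simp_all add: ev0 ev_add evC B'C P.a_assoc)
  have Bl: "B (x \<oplus>\<^bsub>M\<^esub> x') y = B x y \<oplus>\<^bsub>P\<^esub> B x' y" "B (a \<odot>\<^bsub>M\<^esub> x) y = a \<odot>\<^bsub>P\<^esub> B x y"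
    "B x (a \<odot>\<^bsub>N\<^esub> y) = a \<odot>\<^bsub>P\<^esub> B x y" "B x (y \<oplus>\<^bsub>N\<^esub> y') = B x y \<oplus>\<^bsub>P\<^esub> B x y'"
    if "x \<in> carrier M" "x' \<in> carrier M" "y \<in> carrier N" "y' \<in> carrier N" "a \<in> carrier K"
    for x x' y y' a
    using B that by (auto simp: bilinear_map_def linear_map_def)
  have B0: "B \<zero>\<^bsub>M\<^esub> y = \<zero>\<^bsub>P\<^esub>" if "y \<in> carrier N" for y
    using Bl(2)[of "\<zero>\<^bsub>M\<^esub>" "\<zero>\<^bsub>M\<^esub>" y y "\<zero>\<^bsub>K\<^esub>"] that BC[of "\<zero>\<^bsub>M\<^esub>" y] by simp
  have ev_cong: "ev p = ev q" if "tensor_cong K M N p q" for p q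
    using that
  proof induction
    case (smult a x y)
    then show ?case by (simp add: ev_add ev0 B'_def Bl[of _ x])
  next
    case (add_left x x' y)
    then show ?case using Bl(1)[of x x' y y "\<zero>\<^bsub>K\<^esub>"] by (simp add: ev_add ev0 B'_def BC P.a_assoc)
  next
    case (add_right x y y')
    then show ?case using Bl(4)[of x x y y' "\<zero>\<^bsub>K\<^esub>"] by (simp add: ev_add ev0 B'_def BC P.a_assoc)
  qed (simp_all add: ev_plus ev_add ev0 B'_def B0)
  have ev_sc: "ev (sc a p) = a \<odot>\<^bsub>P\<^esub> ev p" if "a \<in> carrier K" "p \<in> formal_sums M N" for a p
    using that(2)
  proof (induction p)
    case (add z p)
    then show ?case using that(1)
      by (cases z) (use Bl(2)[of "fst z" "fst z" "snd z" "snd z" a] in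
        \<open>simp add: ev_add B'_def BC evC P.smult_r_distr\<close>)
  qed (use that(1) in \<open>simp add: ev0\<close>)
  define h where "h = restrict (\<lambda>X. ev (SOME p. p \<in> X)) (carrier (tensor K M N))"
  have h_cls: "h (cls p) = ev p" if p: "p \<in> formal_sums M N" for p
  proof -
    have "p \<in> cls p" using p by (auto simp: tensor_rel_def intro: tensor_cong.refl)
    then have "(SOME q. q \<in> cls p) \<in> cls p" by (rule someI)
    then have "tensor_cong K M N p (SOME q. q \<in> cls p)" by (auto simp: tensor_rel_def)
    then have "ev p = ev (SOME q. q \<in> cls p)" by (rule ev_cong)
    then show ?thesis using p by (simp add: h_def)
  qed
  have hH: "h \<in> Hom K (tensor K M N) P"
    unfolding Hom_def linear_map_def
    by (auto elim!: carrier_tensorE simp: h_cls add_tensor smult_tensor sc_formal ev_plus ev_sc evC)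
      (auto simp: h_def)
  have hB: "h (pure_tensor K M N x y) = B x y" if "x \<in> carrier M" "y \<in> carrier N" for x y
    using that by (simp add: pure_tensor_def h_cls ev_add ev0 B'_def BC)
  show ?thesis
  proof (intro ex1I[of _ h] conjI ballI)
    show "h \<in> Hom K (tensor K M N) P" by (rule hH)
    show "h (pure_tensor K M N x y) = B x y" if "x \<in> carrier M" "y \<in> carrier N" for x y
      using that by (rule hB)
    fix f
    assume f: "f \<in> Hom K (tensor K M N) P \<and>
      (\<forall>x \<in> carrier M. \<forall>y \<in> carrier N. f (pure_tensor K M N x y) = B x y)"
    then have fl: "linear_map K (tensor K M N) P f" and fe: "f \<in> extensional (carrier (tensor K M N))"
      by (auto simp: Hom_def)
    have f0: "f \<zero>\<^bsub>tensor K M N\<^esub> = \<zero>\<^bsub>P\<^esub>"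
    proof -
      have "f (\<zero>\<^bsub>K\<^esub> \<odot>\<^bsub>tensor K M N\<^esub> \<zero>\<^bsub>tensor K M N\<^esub>) = \<zero>\<^bsub>K\<^esub> \<odot>\<^bsub>P\<^esub> f \<zero>\<^bsub>tensor K M N\<^esub>"
        using fl unfolding linear_map_def by blast
      moreover have "f \<zero>\<^bsub>tensor K M N\<^esub> \<in> carrier P" using fl by (auto simp: linear_map_def)
      ultimately show ?thesis by (simp del: P.smult_r_null)
    qed
    have "f (cls p) = ev p" if "p \<in> formal_sums M N" for p
      using that
    proof (induction p)
      case empty
      then show ?case using f0 by (simp add: zero_tensor ev0)
    next
      case (add z p)
      obtain x y where z: "z = (x, y)" by (cases z)
      have xy: "x \<in> carrier M" "y \<in> carrier N" "p \<in> formal_sums M N" using add z by auto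
      have "f (cls {#(x, y)#} \<oplus>\<^bsub>tensor K M N\<^esub> cls p) = f (cls {#(x, y)#}) \<oplus>\<^bsub>P\<^esub> f (cls p)"
        using fl xy unfolding linear_map_def by (auto simp del: Image_singleton_iff)
      moreover have "f (cls {#(x, y)#}) = B x y" using f xy by (simp add: pure_tensor_def)
      ultimately show ?case
        using add xy z by (simp add: add_tensor ev_add B'_def)
    qed
    then show "f = h"
      using fe hH unfolding Hom_def
      by (intro extensionalityI[of _ "carrier (tensor K M N)"])
        (auto elim!: carrier_tensorE simp: h_cls)
  qed
qed

corollary tensor_lift:
  assumes "module K P" "bilinear_map K M N P B"
  shows "tensor_lift K M N P B \<in> Hom K (tensor K M N) P"
    and "x \<in> carrier M \<Longrightarrow> y \<in> carrier N \<Longrightarrow>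
      tensor_lift K M N P B (pure_tensor K M N x y) = B x y"
  using theI'[OF tensor_universal[OF assms]] unfolding tensor_lift_def by auto

end


section \<open>Coalgebras and Hopf algebras\<close>

record ('k, 'c) coalg = "('k, 'c) module" +
  comult :: "'c \<Rightarrow> ('c \<times> 'c) multiset set"
  counit :: "'c \<Rightarrow> 'k"

text \<open>\<open>sweedler K C P (\<lambda>c\<^sub>1 c\<^sub>2. B c\<^sub>1 c\<^sub>2) c\<close> is the element of \<open>P\<close> written
  \<open>B(c\<^sub>1, c\<^sub>2)\<close> in Sweedler notation, and \<open>sweedler3\<close> the one written
  \<open>B(c\<^sub>1, c\<^sub>2, c\<^sub>3)\<close>.\<close>

definition sweedler ::
    "('k, 'e) ring_scheme \<Rightarrow> ('k, 'c, 'f) coalg_scheme \<Rightarrow> ('k, 'p, 'g) module_scheme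
      \<Rightarrow> ('c \<Rightarrow> 'c \<Rightarrow> 'p) \<Rightarrow> 'c \<Rightarrow> 'p" where
  "sweedler K C P B c = tensor_lift K C C P B (comult C c)"

definition sweedler3 ::
    "('k, 'e) ring_scheme \<Rightarrow> ('k, 'c, 'f) coalg_scheme \<Rightarrow> ('k, 'p, 'g) module_scheme
      \<Rightarrow> ('c \<Rightarrow> 'c \<Rightarrow> 'c \<Rightarrow> 'p) \<Rightarrow> 'c \<Rightarrow> 'p" where
  "sweedler3 K C P B c = sweedler K C P (\<lambda>x c\<^sub>3. sweedler K C P (\<lambda>c\<^sub>1 c\<^sub>2. B c\<^sub>1 c\<^sub>2 c\<^sub>3) x) c"

locale coalgebra = module K C for K (structure) and C (structure) +
  assumes comult_linear: "linear_map K C (tensor K C C) (comult C)"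
    and counit_linear: "linear_map K C (scalars K) (counit C)"
    and coassoc: "c \<in> carrier C \<Longrightarrow>
      sweedler K C (tensor K C (tensor K C C))
        (\<lambda>x c\<^sub>3. sweedler K C (tensor K C (tensor K C C))
          (\<lambda>c\<^sub>1 c\<^sub>2. pure_tensor K C (tensor K C C) c\<^sub>1 (pure_tensor K C C c\<^sub>2 c\<^sub>3)) x) c
      = sweedler K C (tensor K C (tensor K C C))
        (\<lambda>c\<^sub>1 x. pure_tensor K C (tensor K C C) c\<^sub>1 (comult C x)) c"
    and counit_left: "c \<in> carrier C \<Longrightarrow> sweedler K C C (\<lambda>c\<^sub>1 c\<^sub>2. counit C c\<^sub>1 \<odot>\<^bsub>C\<^esub> c\<^sub>2) c = c"
    and counit_right: "c \<in> carrier C \<Longrightarrow> sweedler K C C (\<lambda>c\<^sub>1 c\<^sub>2. counit C c\<^sub>2 \<odot>\<^bsub>C\<^esub> c\<^sub>1) c = c"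

locale cocommutative_coalgebra = coalgebra +
  assumes cocomm: "c \<in> carrier C \<Longrightarrow>
    sweedler K C (tensor K C C) (\<lambda>c\<^sub>1 c\<^sub>2. pure_tensor K C C c\<^sub>2 c\<^sub>1) c = comult C c"

definition coalgebra_map ::
    "('k, 'e) ring_scheme \<Rightarrow> ('k, 'c, 'f) coalg_scheme \<Rightarrow> ('k, 'd, 'g) coalg_scheme
      \<Rightarrow> ('c \<Rightarrow> 'd) \<Rightarrow> bool" where
  "coalgebra_map K C D \<phi> \<longleftrightarrow> linear_map K C D \<phi> \<and>
     (\<forall>c \<in> carrier C. comult D (\<phi> c) =
       sweedler K C (tensor K D D) (\<lambda>c\<^sub>1 c\<^sub>2. pure_tensor K D D (\<phi> c\<^sub>1) (\<phi> c\<^sub>2)) c) \<and>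
     (\<forall>c \<in> carrier C. counit D (\<phi> c) = counit C c)"

text \<open>Unlike the library's \<^locale>\<open>algebra\<close>, this does not require commutativity.\<close>

locale assoc_algebra = module K N + ring N for K (structure) and N (structure) +
  assumes smult_mult_left: "a \<in> carrier K \<Longrightarrow> x \<in> carrier N \<Longrightarrow> y \<in> carrier N \<Longrightarrow>
      (a \<odot>\<^bsub>N\<^esub> x) \<otimes>\<^bsub>N\<^esub> y = a \<odot>\<^bsub>N\<^esub> (x \<otimes>\<^bsub>N\<^esub> y)"
    and smult_mult_right: "a \<in> carrier K \<Longrightarrow> x \<in> carrier N \<Longrightarrow> y \<in> carrier N \<Longrightarrow>
      x \<otimes>\<^bsub>N\<^esub> (a \<odot>\<^bsub>N\<^esub> y) = a \<odot>\<^bsub>N\<^esub> (x \<otimes>\<^bsub>N\<^esub> y)"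

locale bialgebra = assoc_algebra K H + coalgebra K H for K (structure) and H (structure) +
  assumes comult_mult: "x \<in> carrier H \<Longrightarrow> y \<in> carrier H \<Longrightarrow> comult H (x \<otimes>\<^bsub>H\<^esub> y) =
      sweedler K H (tensor K H H) (\<lambda>x\<^sub>1 x\<^sub>2. sweedler K H (tensor K H H)
        (\<lambda>y\<^sub>1 y\<^sub>2. pure_tensor K H H (x\<^sub>1 \<otimes>\<^bsub>H\<^esub> y\<^sub>1) (x\<^sub>2 \<otimes>\<^bsub>H\<^esub> y\<^sub>2)) y) x"
    and comult_one: "comult H \<one>\<^bsub>H\<^esub> = pure_tensor K H H \<one>\<^bsub>H\<^esub> \<one>\<^bsub>H\<^esub>"
    and counit_mult: "x \<in> carrier H \<Longrightarrow> y \<in> carrier H \<Longrightarrow>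
      counit H (x \<otimes>\<^bsub>H\<^esub> y) = counit H x \<otimes>\<^bsub>K\<^esub> counit H y"
    and counit_one: "counit H \<one>\<^bsub>H\<^esub> = \<one>\<^bsub>K\<^esub>"

locale hopf_algebra = bialgebra +
  assumes antipode: "\<exists>S. linear_map K H H S \<and> (\<forall>x \<in> carrier H.
      sweedler K H H (\<lambda>x\<^sub>1 x\<^sub>2. S x\<^sub>1 \<otimes>\<^bsub>H\<^esub> x\<^sub>2) x = counit H x \<odot>\<^bsub>H\<^esub> \<one>\<^bsub>H\<^esub> \<and>
      sweedler K H H (\<lambda>x\<^sub>1 x\<^sub>2. x\<^sub>1 \<otimes>\<^bsub>H\<^esub> S x\<^sub>2) x = counit H x \<odot>\<^bsub>H\<^esub> \<one>\<^bsub>H\<^esub>)"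

locale cocommutative_hopf_algebra =
  hopf_algebra K H + cocommutative_coalgebra K H for K (structure) and H (structure)

definition tensor_coalg ::
    "('k, 'e) ring_scheme \<Rightarrow> ('k, 'c, 'f) coalg_scheme \<Rightarrow> ('k, 'd, 'g) coalg_scheme
      \<Rightarrow> ('k, ('c \<times> 'd) multiset set) coalg" where
  "tensor_coalg K C D = module.extend (tensor K C D)
     (let CD = tensor K C D in
      coalg.fields
        (tensor_lift K C D (tensor K CD CD) (\<lambda>c d.
          sweedler K C (tensor K CD CD) (\<lambda>c\<^sub>1 c\<^sub>2. sweedler K D (tensor K CD CD) (\<lambda>d\<^sub>1 d\<^sub>2.
            pure_tensor K CD CD (pure_tensor K C D c\<^sub>1 d\<^sub>1) (pure_tensor K C D c\<^sub>2 d\<^sub>2)) d) c))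
        (tensor_lift K C D (scalars K) (\<lambda>c d. counit C c \<otimes>\<^bsub>K\<^esub> counit D d)))"


section \<open>Abelian matched pairs\<close>

text \<open>\<open>\<mu> (n \<otimes> t)\<close> is written \<open>n\<^sup>t\<close> and \<open>\<nu> (n \<otimes> t)\<close> is written \<open>n(t)\<close> on
  paper; here they become \<open>n \<triangleleft> t\<close> and \<open>n \<triangleright> t\<close>.\<close>

locale abelian_matched_pair =
  N: cocommutative_hopf_algebra K N + T: cocommutative_hopf_algebra K T
  for K (structure) and N and T and \<mu> and \<nu> +
  fixes act_N (infixl \<open>\<triangleleft>\<close> 75) and act_T (infixl \<open>\<triangleright>\<close> 75)
  defines "n \<triangleleft> t \<equiv> \<mu> (pure_tensor K N T n t)"
    and "n \<triangleright> t \<equiv> \<nu> (pure_tensor K N T n t)"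
  assumes \<mu>_coalgebra_map: "coalgebra_map K (tensor_coalg K N T) N \<mu>"
    and \<nu>_coalgebra_map: "coalgebra_map K (tensor_coalg K N T) T \<nu>"
    and \<mu>_module:
      "n \<in> carrier N \<Longrightarrow> t \<in> carrier T \<Longrightarrow> s \<in> carrier T \<Longrightarrow> n \<triangleleft> (t \<otimes>\<^bsub>T\<^esub> s) = n \<triangleleft> t \<triangleleft> s"
      "n \<in> carrier N \<Longrightarrow> n \<triangleleft> \<one>\<^bsub>T\<^esub> = n"
    and \<nu>_module:
      "n \<in> carrier N \<Longrightarrow> m \<in> carrier N \<Longrightarrow> t \<in> carrier T \<Longrightarrow>
        (n \<otimes>\<^bsub>N\<^esub> m) \<triangleright> t = n \<triangleright> (m \<triangleright> t)"
      "t \<in> carrier T \<Longrightarrow> \<one>\<^bsub>N\<^esub> \<triangleright> t = t"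
    and \<nu>_mult: "n \<in> carrier N \<Longrightarrow> t \<in> carrier T \<Longrightarrow> s \<in> carrier T \<Longrightarrow>
      n \<triangleright> (t \<otimes>\<^bsub>T\<^esub> s) =
      sweedler K N T (\<lambda>n\<^sub>1 n\<^sub>2. sweedler K T T
        (\<lambda>t\<^sub>1 t\<^sub>2. (n\<^sub>1 \<triangleright> t\<^sub>1) \<otimes>\<^bsub>T\<^esub> ((n\<^sub>2 \<triangleleft> t\<^sub>2) \<triangleright> s)) t) n"
    and \<nu>_one: "n \<in> carrier N \<Longrightarrow> n \<triangleright> \<one>\<^bsub>T\<^esub> = counit N n \<odot>\<^bsub>T\<^esub> \<one>\<^bsub>T\<^esub>"
    and \<mu>_mult: "n \<in> carrier N \<Longrightarrow> m \<in> carrier N \<Longrightarrow> t \<in> carrier T \<Longrightarrow>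
      (n \<otimes>\<^bsub>N\<^esub> m) \<triangleleft> t =
      sweedler K N N (\<lambda>m\<^sub>1 m\<^sub>2. sweedler K T N
        (\<lambda>t\<^sub>1 t\<^sub>2. (n \<triangleleft> (m\<^sub>1 \<triangleright> t\<^sub>1)) \<otimes>\<^bsub>N\<^esub> (m\<^sub>2 \<triangleleft> t\<^sub>2)) t) m"
    and \<mu>_one: "t \<in> carrier T \<Longrightarrow> \<one>\<^bsub>N\<^esub> \<triangleleft> t = counit T t \<odot>\<^bsub>N\<^esub> \<one>\<^bsub>N\<^esub>"

definition trivial_\<mu> ::
    "('k, 'e) ring_scheme \<Rightarrow> ('k, 'n, 'f) coalg_scheme \<Rightarrow> ('k, 't, 'g) coalg_scheme
      \<Rightarrow> ('n \<times> 't) multiset set \<Rightarrow> 'n" where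
  "trivial_\<mu> K N T = tensor_lift K N T N (\<lambda>n t. counit T t \<odot>\<^bsub>N\<^esub> n)"

definition trivial_\<nu> ::
    "('k, 'e) ring_scheme \<Rightarrow> ('k, 'n, 'f) coalg_scheme \<Rightarrow> ('k, 't, 'g) coalg_scheme
      \<Rightarrow> ('n \<times> 't) multiset set \<Rightarrow> 't" where
  "trivial_\<nu> K N T = tensor_lift K N T T (\<lambda>n t. counit N n \<odot>\<^bsub>T\<^esub> t)"


section \<open>Convolution, bimeasurings and cocycles\<close>

definition convolution_monoid ::
    "('k, 'e) ring_scheme \<Rightarrow> ('k, 'c, 'f) coalg_scheme \<Rightarrow> ('k, 'a, 'g) module_scheme
      \<Rightarrow> ('c \<Rightarrow> 'a) monoid" where
  "convolution_monoid K C A =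
     \<lparr>carrier = Hom K C A,
      monoid.mult = (\<lambda>f g. \<lambda>c \<in> carrier C. sweedler K C A (\<lambda>c\<^sub>1 c\<^sub>2. f c\<^sub>1 \<otimes>\<^bsub>A\<^esub> g c\<^sub>2) c),
      one = (\<lambda>c \<in> carrier C. counit C c \<odot>\<^bsub>A\<^esub> \<one>\<^bsub>A\<^esub>)\<rparr>"

definition normalized ::
    "('k, 'e) ring_scheme \<Rightarrow> ('k, 'n, 'f) coalg_scheme \<Rightarrow> ('k, 't, 'g) coalg_scheme
      \<Rightarrow> ('k, 'a, 'h) module_scheme \<Rightarrow> (('n \<times> 't) multiset set \<Rightarrow> 'a) \<Rightarrow> bool" where
  "normalized K N T A \<psi> \<longleftrightarrow>
     (\<forall>t \<in> carrier T. \<psi> (pure_tensor K N T \<one>\<^bsub>N\<^esub> t) = counit T t \<odot>\<^bsub>A\<^esub> \<one>\<^bsub>A\<^esub>) \<and>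
     (\<forall>n \<in> carrier N. \<psi> (pure_tensor K N T n \<one>\<^bsub>T\<^esub>) = counit N n \<odot>\<^bsub>A\<^esub> \<one>\<^bsub>A\<^esub>)"

definition skew_bimeasurings ::
    "('k, 'e) ring_scheme \<Rightarrow> ('k, 'n, 'f) coalg_scheme \<Rightarrow> ('k, 't, 'g) coalg_scheme
      \<Rightarrow> (('n \<times> 't) multiset set \<Rightarrow> 'n) \<Rightarrow> (('n \<times> 't) multiset set \<Rightarrow> 't)
      \<Rightarrow> ('k, 'a, 'h) module_scheme \<Rightarrow> (('n \<times> 't) multiset set \<Rightarrow> 'a) set" where
  "skew_bimeasurings K N T \<mu> \<nu> A =
     {\<psi> \<in> Hom K (tensor K N T) A.
       let tens = pure_tensor K N T in
       normalized K N T A \<psi> \<and>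
       (\<forall>n \<in> carrier N. \<forall>m \<in> carrier N. \<forall>t \<in> carrier T.
         \<psi> (tens (n \<otimes>\<^bsub>N\<^esub> m) t) =
         sweedler K N A (\<lambda>m\<^sub>1 m\<^sub>2. sweedler K T A
           (\<lambda>t\<^sub>1 t\<^sub>2. \<psi> (tens n (\<nu> (tens m\<^sub>1 t\<^sub>1))) \<otimes>\<^bsub>A\<^esub> \<psi> (tens m\<^sub>2 t\<^sub>2)) t) m) \<and>
       (\<forall>n \<in> carrier N. \<forall>t \<in> carrier T. \<forall>s \<in> carrier T.
         \<psi> (tens n (t \<otimes>\<^bsub>T\<^esub> s)) =
         sweedler K N A (\<lambda>n\<^sub>1 n\<^sub>2. sweedler K T A
           (\<lambda>t\<^sub>1 t\<^sub>2. \<psi> (tens (\<mu> (tens n\<^sub>1 t\<^sub>1)) s) \<otimes>\<^bsub>A\<^esub> \<psi> (tens n\<^sub>2 t\<^sub>2)) t) n)}"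

definition bimeasurings ::
    "('k, 'e) ring_scheme \<Rightarrow> ('k, 'n, 'f) coalg_scheme \<Rightarrow> ('k, 't, 'g) coalg_scheme
      \<Rightarrow> ('k, 'a, 'h) module_scheme \<Rightarrow> (('n \<times> 't) multiset set \<Rightarrow> 'a) set" where
  "bimeasurings K N T A =
     {\<psi> \<in> Hom K (tensor K N T) A.
       let tens = pure_tensor K N T in
       normalized K N T A \<psi> \<and>
       (\<forall>n \<in> carrier N. \<forall>m \<in> carrier N. \<forall>t \<in> carrier T.
         \<psi> (tens (n \<otimes>\<^bsub>N\<^esub> m) t) =
         sweedler K T A (\<lambda>t\<^sub>1 t\<^sub>2. \<psi> (tens n t\<^sub>1) \<otimes>\<^bsub>A\<^esub> \<psi> (tens m t\<^sub>2)) t) \<and>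
       (\<forall>n \<in> carrier N. \<forall>t \<in> carrier T. \<forall>s \<in> carrier T.
         \<psi> (tens n (t \<otimes>\<^bsub>T\<^esub> s)) =
         sweedler K N A (\<lambda>n\<^sub>1 n\<^sub>2. \<psi> (tens n\<^sub>1 t) \<otimes>\<^bsub>A\<^esub> \<psi> (tens n\<^sub>2 s)) n)}"

text \<open>The convolution-invertible normalized maps, i.e. the 1-cochains.\<close>

definition Reg_plus ::
    "('k, 'e) ring_scheme \<Rightarrow> ('k, 'n, 'f) coalg_scheme \<Rightarrow> ('k, 't, 'g) coalg_scheme
      \<Rightarrow> ('k, 'a, 'h) module_scheme \<Rightarrow> (('n \<times> 't) multiset set \<Rightarrow> 'a) set" where
  "Reg_plus K N T A =
     {f \<in> Units (convolution_monoid K (tensor_coalg K N T) A). normalized K N T A f}"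

text \<open>There are no cochains in degree 0, so \<open>H\<^sup>1\<close> is the group of 1-cocycles.\<close>

definition one_cocycles ::
    "('k, 'e) ring_scheme \<Rightarrow> ('k, 'n, 'f) coalg_scheme \<Rightarrow> ('k, 't, 'g) coalg_scheme
      \<Rightarrow> (('n \<times> 't) multiset set \<Rightarrow> 'n) \<Rightarrow> (('n \<times> 't) multiset set \<Rightarrow> 't)
      \<Rightarrow> ('k, 'a, 'h) module_scheme \<Rightarrow> (('n \<times> 't) multiset set \<Rightarrow> 'a) set" where
  "one_cocycles K N T \<mu> \<nu> A =
     {f \<in> Reg_plus K N T A.
       let tens = pure_tensor K N T;
           f' = inv\<^bsub>convolution_monoid K (tensor_coalg K N T) A\<^esub> f in
       (\<forall>n \<in> carrier N. \<forall>m \<in> carrier N. \<forall>t \<in> carrier T.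
         sweedler K N A (\<lambda>n\<^sub>1 n\<^sub>2. sweedler3 K N A (\<lambda>m\<^sub>1 m\<^sub>2 m\<^sub>3. sweedler3 K T A (\<lambda>t\<^sub>1 t\<^sub>2 t\<^sub>3.
           f (tens n\<^sub>1 (\<nu> (tens m\<^sub>1 t\<^sub>1))) \<otimes>\<^bsub>A\<^esub> f' (tens (n\<^sub>2 \<otimes>\<^bsub>N\<^esub> m\<^sub>2) t\<^sub>2) \<otimes>\<^bsub>A\<^esub>
             f (tens m\<^sub>3 t\<^sub>3)) t) m) n
         = (counit N n \<otimes>\<^bsub>K\<^esub> counit N m \<otimes>\<^bsub>K\<^esub> counit T t) \<odot>\<^bsub>A\<^esub> \<one>\<^bsub>A\<^esub>) \<and>
       (\<forall>n \<in> carrier N. \<forall>t \<in> carrier T. \<forall>s \<in> carrier T.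
         sweedler3 K N A (\<lambda>n\<^sub>1 n\<^sub>2 n\<^sub>3. sweedler3 K T A (\<lambda>t\<^sub>1 t\<^sub>2 t\<^sub>3. sweedler K T A (\<lambda>s\<^sub>1 s\<^sub>2.
           f (tens (\<mu> (tens n\<^sub>1 t\<^sub>1)) s\<^sub>1) \<otimes>\<^bsub>A\<^esub> f' (tens n\<^sub>2 (t\<^sub>2 \<otimes>\<^bsub>T\<^esub> s\<^sub>2)) \<otimes>\<^bsub>A\<^esub>
             f (tens n\<^sub>3 t\<^sub>3)) s) t) n
         = (counit N n \<otimes>\<^bsub>K\<^esub> counit T t \<otimes>\<^bsub>K\<^esub> counit T s) \<odot>\<^bsub>A\<^esub> \<one>\<^bsub>A\<^esub>)}"

abbreviation skew_bimeasuring_group where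
  "skew_bimeasuring_group K N T \<mu> \<nu> A \<equiv>
     (convolution_monoid K (tensor_coalg K N T) A)\<lparr>carrier := skew_bimeasurings K N T \<mu> \<nu> A\<rparr>"

abbreviation bimeasuring_group where
  "bimeasuring_group K N T A \<equiv>
     (convolution_monoid K (tensor_coalg K N T) A)\<lparr>carrier := bimeasurings K N T A\<rparr>"

abbreviation H1 where
  "H1 K N T \<mu> \<nu> A \<equiv>
     (convolution_monoid K (tensor_coalg K N T) A)\<lparr>carrier := one_cocycles K N T \<mu> \<nu> A\<rparr>"

end

theory Submission
  imports Defs
begin

text \<open>The skew bimeasurings and the one-cocycles turn out to be the same subset of the convolution
  monoid of \<open>N \<otimes> T\<close>, so the isomorphism is the identity map.

  For \<open>f\<close> in \<open>Hom(N \<otimes> T, A)\<close> consider the functions \<open>f(n, m(t))\<close>, \<open>f(nm, t)\<close> and \<open>\<epsilon>(n) f(m, t)\<close> of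
  three variables \<open>n\<close>, \<open>m\<close>, \<open>t\<close>. Each arises from \<open>f\<close> by composition with a coalgebra map
  \<open>N \<otimes> N \<otimes> T \<rightarrow> N \<otimes> T\<close>, so each depends on \<open>f\<close> through a homomorphism of convolution monoids; call
  these \<open>d\<^sub>0\<close>, \<open>d\<^sub>1\<close> and \<open>d\<^sub>2\<close>. The first cocycle condition is \<open>d\<^sub>0 f * (d\<^sub>1 f)\<^sup>-\<^sup>1 * d\<^sub>2 f = 1\<close>. Since
  convolution is commutative (\<open>N\<close>, \<open>T\<close> are cocommutative and \<open>A\<close> is commutative), it says
  \<open>d\<^sub>0 f * d\<^sub>2 f = d\<^sub>1 f\<close>, which is the first equation of a skew bimeasuring. The second condition is
  treated in the same way with \<open>f(n\<^sup>t, s)\<close>, \<open>f(n, ts)\<close> and \<open>f(n, t) \<epsilon>(s)\<close>. This is the content of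
  \<open>skew_bimeasurings_eq\<close> and \<open>one_cocycles_eq\<close>. What remains is that a skew bimeasuring is
  convolution invertible (\<open>skew_bimeasuring_invertible\<close>): its inverse is
  \<open>n \<otimes> t \<mapsto> f(S(n\<^sub>1), n\<^sub>2(t))\<close>, where \<open>S\<close> is the antipode of \<open>N\<close>. The cocycles form a group because
  all the conditions on \<open>f\<close> equate two homomorphisms out of a commutative monoid.

  To calculate with functions of several variables, everything is curried. Maps from a
  cocommutative coalgebra \<open>C\<close> to a commutative algebra \<open>A\<close> form a commutative algebra again
  (\<open>algebra_conv\<close>), so that functions of three variables live in an iterated convolution algebra
  such as \<open>Hom(N, Hom(N, Hom(T, A)))\<close>, whose product is the nested Sweedler sum of the
  definitions. Currying embeds the convolution monoid of \<open>N \<otimes> T\<close> into \<open>Hom(N, Hom(T, A))\<close>, which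
  is how it is seen to be a commutative monoid.

  For the trivial matched pair, the counit axioms reduce the equations of a skew bimeasuring to
  those of a bimeasuring; in the second equation, cocommutativity of \<open>N\<close> exchanges the two factors
  (\<open>bimeasurings_eq_trivial_skew\<close>).\<close>

section \<open>Linear and bilinear maps\<close>

lemma linear_map_closed: "linear_map K V W f \<Longrightarrow> x \<in> carrier V \<Longrightarrow> f x \<in> carrier W"
  by (auto simp: linear_map_def)

lemma linear_map_add: "linear_map K V W f \<Longrightarrow> x \<in> carrier V \<Longrightarrow> y \<in> carrier V \<Longrightarrow>
    f (x \<oplus>\<^bsub>V\<^esub> y) = f x \<oplus>\<^bsub>W\<^esub> f y"
  by (auto simp: linear_map_def)

lemma linear_map_smult: "linear_map K V W f \<Longrightarrow> a \<in> carrier K \<Longrightarrow> x \<in> carrier V \<Longrightarrow>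
    f (a \<odot>\<^bsub>V\<^esub> x) = a \<odot>\<^bsub>W\<^esub> f x"
  by (auto simp: linear_map_def)

lemma linear_map_id: "linear_map K V V (\<lambda>x. x)"
  by (simp add: linear_map_def)

lemma linear_map_compose:
  "linear_map K V W f \<Longrightarrow> linear_map K U V g \<Longrightarrow> linear_map K U W (\<lambda>x. f (g x))"
  unfolding linear_map_def by (auto simp: Pi_iff)

lemma linear_map_cong:
  assumes "module K V" "\<And>x. x \<in> carrier V \<Longrightarrow> f x = g x"
  shows "linear_map K V W f \<longleftrightarrow> linear_map K V W g"
proof -
  interpret V: module K V by fact
  show ?thesis using assms(2) by (auto simp: linear_map_def Pi_iff)
qed

lemma bilinear_mapI:
  "(\<And>x. x \<in> carrier M \<Longrightarrow> linear_map K N P (\<lambda>y. B x y)) \<Longrightarrow>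
   (\<And>y. y \<in> carrier N \<Longrightarrow> linear_map K M P (\<lambda>x. B x y)) \<Longrightarrow> bilinear_map K M N P B"
  by (auto simp: bilinear_map_def)

lemma bilinear_map_linear:
  assumes "bilinear_map K M N P B"
  shows "x \<in> carrier M \<Longrightarrow> linear_map K N P (\<lambda>y. B x y)"
    and "y \<in> carrier N \<Longrightarrow> linear_map K M P (\<lambda>x. B x y)"
  using assms by (auto simp: bilinear_map_def)

lemma bilinear_map_closed:
  "bilinear_map K M N P B \<Longrightarrow> x \<in> carrier M \<Longrightarrow> y \<in> carrier N \<Longrightarrow> B x y \<in> carrier P"
  by (auto simp: bilinear_map_def linear_map_def)

lemma linear_map_comp_bilinear:
  "linear_map K P Q h \<Longrightarrow> bilinear_map K M N P B \<Longrightarrow> bilinear_map K M N Q (\<lambda>x y. h (B x y))"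
  by (auto simp: bilinear_map_def intro: linear_map_compose)

lemma bilinear_map_pullback:
  assumes "bilinear_map K M N P B" "linear_map K M' M f" "linear_map K N' N g"
  shows "bilinear_map K M' N' P (\<lambda>x y. B (f x) (g y))"
  using assms(2,3)
  by (intro bilinear_mapI linear_map_compose[OF bilinear_map_linear(1)[OF assms(1)]]
      linear_map_compose[OF bilinear_map_linear(2)[OF assms(1)]]) (auto dest: linear_map_closed)

lemma bilinear_map_flip: "bilinear_map K M N P B \<Longrightarrow> bilinear_map K N M P (\<lambda>y x. B x y)"
  by (auto simp: bilinear_map_def)

lemma linear_map_plus:
  assumes "module K W" "linear_map K V W f" "linear_map K V W g"
  shows "linear_map K V W (\<lambda>x. f x \<oplus>\<^bsub>W\<^esub> g x)"
proof -
  interpret W: module K W by fact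
  show ?thesis using assms(2,3)
    by (auto simp: linear_map_def Pi_iff W.smult_r_distr W.a_ac)
qed

lemma linear_map_scale:
  assumes "module K W" "linear_map K V W f" "a \<in> carrier K"
  shows "linear_map K V W (\<lambda>x. a \<odot>\<^bsub>W\<^esub> f x)"
proof -
  interpret W: module K W by fact
  have "a \<odot>\<^bsub>W\<^esub> (b \<odot>\<^bsub>W\<^esub> w) = b \<odot>\<^bsub>W\<^esub> (a \<odot>\<^bsub>W\<^esub> w)" if "b \<in> carrier K" "w \<in> carrier W" for b w
    using that assms(3) by (metis W.smult_assoc1 W.R.m_comm)
  then show ?thesis using assms(2,3)
    by (auto simp: linear_map_def Pi_iff W.smult_r_distr)
qed

lemma module_scalars: assumes "cring K" shows "module K (scalars K)"
proof -
  interpret cring K by fact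
  show ?thesis
    by (intro moduleI abelian_groupI assms)
      (auto simp: scalars_def a_ac m_assoc l_distr r_distr intro: exI[of _ "\<ominus>\<^bsub>K\<^esub> _"] l_neg
        intro!: bexI[of _ "\<ominus>\<^bsub>K\<^esub> _"])
qed

lemma carrier_scalars [simp]: "carrier (scalars K) = carrier K"
  and smult_scalars [simp]: "a \<odot>\<^bsub>scalars K\<^esub> b = a \<otimes>\<^bsub>K\<^esub> b"
  by (simp_all add: scalars_def)

lemma linear_map_smult_left:
  assumes "module K V" "x \<in> carrier V"
  shows "linear_map K (scalars K) V (\<lambda>a. a \<odot>\<^bsub>V\<^esub> x)"
proof -
  interpret V: module K V by fact
  show ?thesis using assms(2) unfolding linear_map_def
    by (auto simp: scalars_def V.smult_l_distr V.smult_assoc1)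
qed

lemma bilinear_functional_smult:
  assumes "module K V" "linear_map K C (scalars K) e" "linear_map K D V h"
  shows "bilinear_map K C D V (\<lambda>c d. e c \<odot>\<^bsub>V\<^esub> h d)"
proof (rule bilinear_mapI)
  fix c assume "c \<in> carrier C"
  then show "linear_map K D V (\<lambda>d. e c \<odot>\<^bsub>V\<^esub> h d)"
    using linear_map_closed[OF assms(2)] by (intro linear_map_scale assms) auto
next
  fix d assume "d \<in> carrier D"
  then show "linear_map K C V (\<lambda>c. e c \<odot>\<^bsub>V\<^esub> h d)"
    by (intro linear_map_compose[OF linear_map_smult_left assms(2)] assms linear_map_closed[OF
        assms(3)])
qed

lemma bilinear_map_mult:
  assumes "assoc_algebra K A" shows "bilinear_map K A A A (\<lambda>a b. a \<otimes>\<^bsub>A\<^esub> b)"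
proof -
  interpret A: assoc_algebra K A by fact
  show ?thesis unfolding bilinear_map_def linear_map_def
    by (auto simp: A.smult_mult_left A.smult_mult_right A.l_distr A.r_distr)
qed

lemma assoc_algebra_of_algebra:
  assumes "algebra K A" shows "assoc_algebra K A"
proof -
  interpret A: algebra K A by fact
  show ?thesis
    by unfold_locales (simp_all add: A.smult_assoc2 A.m_comm[of _ "_ \<odot>\<^bsub>A\<^esub> _"], metis A.m_comm
        A.smult_assoc2 A.smult_closed)
qed

lemma Hom_linear: "f \<in> Hom K V W \<Longrightarrow> linear_map K V W f"
  by (simp add: Hom_def)

lemma Hom_eqI: "f \<in> Hom K V W \<Longrightarrow> g \<in> Hom K V W \<Longrightarrow> (\<And>x. x \<in> carrier V \<Longrightarrow> f x = g x) \<Longrightarrow> f = g"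
  unfolding Hom_def by (auto intro: extensionalityI)

lemma restrict_Hom_iff:
  assumes "module K V" shows "restrict f (carrier V) \<in> Hom K V W \<longleftrightarrow> linear_map K V W f"
  using linear_map_cong[OF assms, of "restrict f (carrier V)" f] by (simp add: Hom_def)

context two_modules begin

lemma linear_map_pure:
  "y \<in> carrier N \<Longrightarrow> linear_map K M (tensor K M N) (\<lambda>x. pure_tensor K M N x y)"
  "x \<in> carrier M \<Longrightarrow> linear_map K N (tensor K M N) (\<lambda>y. pure_tensor K M N x y)"
  using bilinear_pure by (auto simp: bilinear_map_def)

lemma linear_map_tensor_lift:
  assumes "module K P" "bilinear_map K M N P B"
  shows "linear_map K (tensor K M N) P (tensor_lift K M N P B)"
  using tensor_lift(1)[OF assms] by (rule Hom_linear)

text \<open>Pure tensors span, so a linear map is determined by its values on them. Every evaluation of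
  a Sweedler sum below ends here: it suffices to exhibit some linear map with the right values.\<close>

lemma tensor_lift_unique:
  assumes P: "module K P" and h: "linear_map K (tensor K M N) P h"
    and B: "\<And>x y. x \<in> carrier M \<Longrightarrow> y \<in> carrier N \<Longrightarrow> h (pure_tensor K M N x y) = B x y"
    and X: "X \<in> carrier (tensor K M N)"
  shows "tensor_lift K M N P B X = h X"
proof -
  have bil: "bilinear_map K M N P (\<lambda>x y. h (pure_tensor K M N x y))"
    by (rule linear_map_comp_bilinear[OF h bilinear_pure])
  have eq: "tensor_lift K M N P B = tensor_lift K M N P (\<lambda>x y. h (pure_tensor K M N x y))"
    using B by (simp add: tensor_lift_def)
  let ?h = "restrict h (carrier (tensor K M N))"
  have "?h \<in> Hom K (tensor K M N) P"
    by (simp add: restrict_Hom_iff[OF module_tensor] h)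
  then have "?h = tensor_lift K M N P (\<lambda>x y. h (pure_tensor K M N x y))"
    using tensor_universal[OF P bil] tensor_lift[OF P bil] by (metis (no_types, lifting) pure_closed
        restrict_apply')
  then show ?thesis using X eq by (metis restrict_apply')
qed

lemma linear_map_tensor_eqI:
  assumes "module K P" "linear_map K (tensor K M N) P g" "linear_map K (tensor K M N) P h"
    and "\<And>x y. x \<in> carrier M \<Longrightarrow> y \<in> carrier N \<Longrightarrow> g (pure_tensor K M N x y) = h (pure_tensor K M N x
        y)"
    and "X \<in> carrier (tensor K M N)"
  shows "g X = h X"
  using tensor_lift_unique[OF assms(1,2) assms(4) assms(5)]
    tensor_lift_unique[OF assms(1,3) _ assms(5), of "\<lambda>x y. h (pure_tensor K M N x y)"]
  by simp

text \<open>If the bilinear map depends linearly on a parameter, so does the linear map that it induces,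
  by comparison on pure tensors. This is what makes a nested Sweedler sum linear in the variables
  that occur inside it.\<close>

lemma linear_map_tensor_lift_param:
  assumes P: "module K P"
    and B: "\<And>v. v \<in> carrier V \<Longrightarrow> bilinear_map K M N P (B v)"
    and lin: "\<And>x y. x \<in> carrier M \<Longrightarrow> y \<in> carrier N \<Longrightarrow> linear_map K V P (\<lambda>v. B v x y)"
    and V: "module K V"
    and X: "X \<in> carrier (tensor K M N)"
  shows "linear_map K V P (\<lambda>v. tensor_lift K M N P (B v) X)"
proof -
  interpret V: module K V by fact
  note L = linear_map_tensor_lift[OF P B] and TL = tensor_lift(2)[OF P B]
  show ?thesis unfolding linear_map_def
  proof (intro conjI ballI funcsetI)
    fix v assume v: "v \<in> carrier V"
    show "tensor_lift K M N P (B v) X \<in> carrier P" by (rule linear_map_closed[OF L[OF v] X])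
    fix w assume w: "w \<in> carrier V"
    show "tensor_lift K M N P (B (v \<oplus>\<^bsub>V\<^esub> w)) X
        = tensor_lift K M N P (B v) X \<oplus>\<^bsub>P\<^esub> tensor_lift K M N P (B w) X"
      by (rule tensor_lift_unique[OF P linear_map_plus[OF P L[OF v] L[OF w]] _ X])
        (simp add: TL v w linear_map_add[OF lin])
  next
    fix a v assume av: "a \<in> carrier K" "v \<in> carrier V"
    show "tensor_lift K M N P (B (a \<odot>\<^bsub>V\<^esub> v)) X = a \<odot>\<^bsub>P\<^esub> tensor_lift K M N P (B v) X"
      by (rule tensor_lift_unique[OF P linear_map_scale[OF P L[OF av(2)] av(1)] _ X])
        (simp add: TL av linear_map_smult[OF lin])
  qed
qed

end

section \<open>Calculating in Sweedler notation\<close>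

lemma sweedler_cong:
  assumes "\<And>x y. x \<in> carrier C \<Longrightarrow> y \<in> carrier C \<Longrightarrow> B x y = B' x y"
  shows "sweedler K C P B c = sweedler K C P B' c"
  using assms by (simp add: sweedler_def tensor_lift_def)

context coalgebra begin

interpretation CC: two_modules K C C ..

lemma module_C: "module K C" ..

lemma comult_closed: "c \<in> carrier C \<Longrightarrow> comult C c \<in> carrier (tensor K C C)"
  by (rule linear_map_closed[OF comult_linear])

lemma counit_closed [simp]: "c \<in> carrier C \<Longrightarrow> counit C c \<in> carrier K"
  using linear_map_closed[OF counit_linear] by simp

lemma sweedler_linear:
  assumes "module K P" "bilinear_map K C C P B"
  shows "linear_map K C P (\<lambda>c. sweedler K C P B c)"
  unfolding sweedler_def
  by (rule linear_map_compose[OF CC.linear_map_tensor_lift[OF assms] comult_linear])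

lemma sweedler_closed:
  "module K P \<Longrightarrow> bilinear_map K C C P B \<Longrightarrow> c \<in> carrier C \<Longrightarrow> sweedler K C P B c \<in> carrier P"
  by (rule linear_map_closed[OF sweedler_linear])

text \<open>A Sweedler sum is the value of a linear map at \<open>\<Delta>(c)\<close>, so linear maps can be moved under it.
  Nested sums and values of function-valued sums are treated in this way.\<close>

lemma linear_map_sweedler:
  assumes P: "module K P" and Q: "module K Q" and h: "linear_map K P Q h"
    and B: "bilinear_map K C C P B" and c: "c \<in> carrier C"
  shows "h (sweedler K C P B c) = sweedler K C Q (\<lambda>x y. h (B x y)) c"
  unfolding sweedler_def
  by (rule CC.tensor_lift_unique[OF Q linear_map_compose[OF h CC.linear_map_tensor_lift[OF P B]]
        _ comult_closed[OF c], symmetric])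
    (simp add: CC.tensor_lift(2)[OF P B])

lemma sweedler_linear_param:
  assumes "module K P" "module K V"
    and "\<And>v. v \<in> carrier V \<Longrightarrow> bilinear_map K C C P (B v)"
    and "\<And>x y. x \<in> carrier C \<Longrightarrow> y \<in> carrier C \<Longrightarrow> linear_map K V P (\<lambda>v. B v x y)"
    and "c \<in> carrier C"
  shows "linear_map K V P (\<lambda>v. sweedler K C P (B v) c)"
  unfolding sweedler_def
  by (rule CC.linear_map_tensor_lift_param) (use assms comult_closed in auto)

lemma linear_map_comult:
  assumes P: "module K P" and h: "linear_map K (tensor K C C) P h" and c: "c \<in> carrier C"
  shows "h (comult C c) = sweedler K C P (\<lambda>x y. h (pure_tensor K C C x y)) c"
  unfolding sweedler_def
  by (rule CC.tensor_lift_unique[OF P h _ comult_closed[OF c], symmetric]) simp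

lemma counit_left_linear:
  assumes P: "module K P" and h: "linear_map K C P h" and c: "c \<in> carrier C"
  shows "sweedler K C P (\<lambda>x y. counit C x \<odot>\<^bsub>P\<^esub> h y) c = h c"
proof -
  have "h (sweedler K C C (\<lambda>x y. counit C x \<odot>\<^bsub>C\<^esub> y) c)
      = sweedler K C P (\<lambda>x y. h (counit C x \<odot>\<^bsub>C\<^esub> y)) c"
    by (rule linear_map_sweedler[OF module_C P h bilinear_functional_smult[OF module_C counit_linear
        linear_map_id] c])
  also have "\<dots> = sweedler K C P (\<lambda>x y. counit C x \<odot>\<^bsub>P\<^esub> h y) c"
    by (rule sweedler_cong) (simp add: linear_map_smult[OF h])
  finally show ?thesis by (simp add: counit_left[OF c])
qed

lemma counit_right_linear:
  assumes P: "module K P" and h: "linear_map K C P h" and c: "c \<in> carrier C"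
  shows "sweedler K C P (\<lambda>x y. counit C y \<odot>\<^bsub>P\<^esub> h x) c = h c"
proof -
  have "h (sweedler K C C (\<lambda>x y. counit C y \<odot>\<^bsub>C\<^esub> x) c)
      = sweedler K C P (\<lambda>x y. h (counit C y \<odot>\<^bsub>C\<^esub> x)) c"
    by (rule linear_map_sweedler[OF module_C P h bilinear_map_flip[OF
      bilinear_functional_smult[OF module_C counit_linear linear_map_id]] c])
  also have "\<dots> = sweedler K C P (\<lambda>x y. counit C y \<odot>\<^bsub>P\<^esub> h x) c"
    by (rule sweedler_cong) (simp add: linear_map_smult[OF h])
  finally show ?thesis by (simp add: counit_right[OF c])
qed

text \<open>Both sides are values of the linear map \<open>x \<otimes> (y \<otimes> z) \<mapsto> B x y z\<close> on \<open>C \<otimes> (C \<otimes> C)\<close>, at the two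
  elements that the coassociativity axiom identifies.\<close>

lemma sweedler3_coassoc:
  assumes P: "module K P" 
    and B1: "\<And>y z. y \<in> carrier C \<Longrightarrow> z \<in> carrier C \<Longrightarrow> linear_map K C P (\<lambda>x. B x y z)"
    and B2: "\<And>x z. x \<in> carrier C \<Longrightarrow> z \<in> carrier C \<Longrightarrow> linear_map K C P (\<lambda>y. B x y z)"
    and B3: "\<And>x y. x \<in> carrier C \<Longrightarrow> y \<in> carrier C \<Longrightarrow> linear_map K C P (\<lambda>z. B x y z)"
    and c: "c \<in> carrier C"
  shows "sweedler3 K C P B c = sweedler K C P (\<lambda>x w. sweedler K C P (\<lambda>y z. B x y z) w) c"
proof -
  let ?CC = "tensor K C C"
  interpret C3: two_modules K C ?CC
    by (intro two_modules.intro CC.module_tensor module_C)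
  have B: "bilinear_map K C C P (B x)" if "x \<in> carrier C" for x
    using that by (intro bilinear_mapI B2 B3)
  define b where "b = (\<lambda>x. tensor_lift K C C P (B x))"
  have b_bil: "bilinear_map K C ?CC P b"
    unfolding b_def
    by (rule bilinear_mapI)
      (auto intro!: CC.linear_map_tensor_lift CC.linear_map_tensor_lift_param P B B1 module_C)
  define t where "t = tensor_lift K C ?CC P b"
  have t: "linear_map K (tensor K C ?CC) P t"
    unfolding t_def by (rule C3.linear_map_tensor_lift[OF P b_bil])
  have t_pure: "t (pure_tensor K C ?CC x w) = b x w" if "x \<in> carrier C" "w \<in> carrier ?CC" for x w
    unfolding t_def using that by (rule C3.tensor_lift(2)[OF P b_bil])
  have b_pure: "b x (pure_tensor K C C y z) = B x y z"
    if "x \<in> carrier C" "y \<in> carrier C" "z \<in> carrier C" for x y z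
    unfolding b_def using that by (intro CC.tensor_lift(2)[OF P B])
  note M3 = C3.module_tensor
  let ?pure = "\<lambda>x y z. pure_tensor K C ?CC x (pure_tensor K C C y z)"
  have p12: "bilinear_map K C C (tensor K C ?CC) (\<lambda>x y. ?pure x y z)" if "z \<in> carrier C" for z
    using that by (intro bilinear_map_pullback[OF C3.bilinear_pure linear_map_id]
        CC.linear_map_pure)
  have p3: "linear_map K C (tensor K C ?CC) (\<lambda>z. ?pure x y z)" if "x \<in> carrier C" "y \<in> carrier C"
      for x y
    using that by (intro linear_map_compose[OF C3.linear_map_pure(2)] CC.linear_map_pure)
  have p: "bilinear_map K C C (tensor K C ?CC) (\<lambda>x z. sweedler K C (tensor K C ?CC) (\<lambda>x y. ?pure x y
      z) x)"
    by (intro bilinear_mapI sweedler_linear sweedler_linear_param M3 p12 p3 module_C)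
  have q: "bilinear_map K C C (tensor K C ?CC) (\<lambda>x w. pure_tensor K C ?CC x (comult C w))"
    by (rule bilinear_map_pullback[OF C3.bilinear_pure linear_map_id comult_linear])
  have "sweedler3 K C P B c = t (sweedler K C (tensor K C ?CC)
          (\<lambda>w z. sweedler K C (tensor K C ?CC) (\<lambda>x y. ?pure x y z) w) c)"
    unfolding linear_map_sweedler[OF M3 P t p c] sweedler3_def
    by (intro sweedler_cong, subst linear_map_sweedler[OF M3 P t p12])
      (auto intro!: sweedler_cong simp: t_pure b_pure)
  also have "\<dots> = t (sweedler K C (tensor K C ?CC) (\<lambda>x w. pure_tensor K C ?CC x (comult C w)) c)"
    by (simp only: coassoc[OF c])
  also have "\<dots> = sweedler K C P (\<lambda>x w. sweedler K C P (\<lambda>y z. B x y z) w) c"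
    unfolding linear_map_sweedler[OF M3 P t q c]
    by (rule sweedler_cong) (simp add: t_pure comult_closed b_def sweedler_def)
  finally show ?thesis .
qed

end

lemma (in cocommutative_coalgebra) sweedler_flip:
  assumes P: "module K P" and B: "bilinear_map K C C P B" and c: "c \<in> carrier C"
  shows "sweedler K C P (\<lambda>x y. B y x) c = sweedler K C P B c"
proof -
  interpret CC: two_modules K C C ..
  let ?t = "tensor_lift K C C P B"
  have t: "linear_map K (tensor K C C) P ?t" by (rule CC.linear_map_tensor_lift[OF P B])
  have "sweedler K C P B c = ?t (sweedler K C (tensor K C C) (\<lambda>x y. pure_tensor K C C y x) c)"
    unfolding cocomm[OF c] by (simp add: sweedler_def)
  also have "\<dots> = sweedler K C P (\<lambda>x y. ?t (pure_tensor K C C y x)) c"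
    by (rule linear_map_sweedler[OF CC.module_tensor P t bilinear_map_flip[OF CC.bilinear_pure] c])
  also have "\<dots> = sweedler K C P (\<lambda>x y. B y x) c"
    by (rule sweedler_cong) (simp add: CC.tensor_lift(2)[OF P B])
  finally show ?thesis by simp
qed

section \<open>The convolution algebra\<close>

text \<open>The convolution monoid together with the pointwise module structure. Its elements are the
  maps \<open>C \<rightarrow> A\<close>, and it can itself serve as the algebra of values for another coalgebra.\<close>

definition convolution_algebra ::
    "('k, 'e) ring_scheme \<Rightarrow> ('k, 'c, 'f) coalg_scheme \<Rightarrow> ('k, 'a, 'g) module_scheme
      \<Rightarrow> ('k, 'c \<Rightarrow> 'a) module" where
  "convolution_algebra K C A =
     \<lparr>carrier = Hom K C A,
      monoid.mult = monoid.mult (convolution_monoid K C A),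
      one = one (convolution_monoid K C A),
      zero = (\<lambda>c \<in> carrier C. \<zero>\<^bsub>A\<^esub>),
      add = (\<lambda>f g. \<lambda>c \<in> carrier C. f c \<oplus>\<^bsub>A\<^esub> g c),
      smult = (\<lambda>a f. \<lambda>c \<in> carrier C. a \<odot>\<^bsub>A\<^esub> f c)\<rparr>"

text \<open>The structure map of the convolution algebra as an algebra over \<open>A\<close>: the map \<open>a \<mapsto> \<epsilon>(-) a\<close>.\<close>

definition convolution_const ::
    "('k, 'c, 'f) coalg_scheme \<Rightarrow> ('k, 'a, 'g) module_scheme \<Rightarrow> 'a \<Rightarrow> 'c \<Rightarrow> 'a" where
  "convolution_const C A a = (\<lambda>c \<in> carrier C. counit C c \<odot>\<^bsub>A\<^esub> a)"

locale convolution = C: cocommutative_coalgebra K C + A: algebra K A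
  for K (structure) and C and A
begin

abbreviation conv where "conv \<equiv> convolution_algebra K C A"

lemma carrier_conv: "carrier conv = Hom K C A"
  by (simp add: convolution_algebra_def)

lemma assoc_algebra_A: "assoc_algebra K A"
  by (rule assoc_algebra_of_algebra) unfold_locales

lemma bilinear_mult: "bilinear_map K A A A (\<lambda>a b. a \<otimes>\<^bsub>A\<^esub> b)"
  by (rule bilinear_map_mult[OF assoc_algebra_A])

lemma bilinear_mult_maps:
  "linear_map K V A f \<Longrightarrow> linear_map K W A g \<Longrightarrow> bilinear_map K V W A (\<lambda>x y. f x \<otimes>\<^bsub>A\<^esub> g y)"
  by (rule bilinear_map_pullback[OF bilinear_mult])

lemma linear_mult_left:
  "linear_map K V A f \<Longrightarrow> a \<in> carrier A \<Longrightarrow> linear_map K V A (\<lambda>x. f x \<otimes>\<^bsub>A\<^esub> a)"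
  using linear_map_compose[OF bilinear_map_linear(2)[OF bilinear_mult]] by blast

lemma linear_mult_right:
  "linear_map K V A f \<Longrightarrow> a \<in> carrier A \<Longrightarrow> linear_map K V A (\<lambda>x. a \<otimes>\<^bsub>A\<^esub> f x)"
  using linear_map_compose[OF bilinear_map_linear(1)[OF bilinear_mult]] by blast

lemma conv_closed: "f \<in> carrier conv \<Longrightarrow> c \<in> carrier C \<Longrightarrow> f c \<in> carrier A"
  using linear_map_closed[OF Hom_linear] by (auto simp: carrier_conv)

lemma conv_linear: "f \<in> carrier conv \<Longrightarrow> linear_map K C A f"
  by (simp add: carrier_conv Hom_linear)

lemma conv_eqI:
  "f \<in> carrier conv \<Longrightarrow> g \<in> carrier conv \<Longrightarrow> (\<And>c. c \<in> carrier C \<Longrightarrow> f c = g c) \<Longrightarrow> f = g"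
  unfolding carrier_conv by (rule Hom_eqI)

lemma restrict_conv_iff: "restrict f (carrier C) \<in> carrier conv \<longleftrightarrow> linear_map K C A f"
  unfolding carrier_conv by (rule restrict_Hom_iff[OF C.module_C])

lemma conv_apply:
  assumes "c \<in> carrier C"
  shows "\<zero>\<^bsub>conv\<^esub> c = \<zero>\<^bsub>A\<^esub>"
    and "(f \<oplus>\<^bsub>conv\<^esub> g) c = f c \<oplus>\<^bsub>A\<^esub> g c"
    and "(a \<odot>\<^bsub>conv\<^esub> f) c = a \<odot>\<^bsub>A\<^esub> f c"
    and "(f \<otimes>\<^bsub>conv\<^esub> g) c = sweedler K C A (\<lambda>x y. f x \<otimes>\<^bsub>A\<^esub> g y) c"
    and "\<one>\<^bsub>conv\<^esub> c = counit C c \<odot>\<^bsub>A\<^esub> \<one>\<^bsub>A\<^esub>"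
  using assms by (simp_all add: convolution_algebra_def convolution_monoid_def)

lemma conv_restrict:
  "\<zero>\<^bsub>conv\<^esub> = (\<lambda>c \<in> carrier C. \<zero>\<^bsub>A\<^esub>)"
  "f \<oplus>\<^bsub>conv\<^esub> g = (\<lambda>c \<in> carrier C. f c \<oplus>\<^bsub>A\<^esub> g c)"
  "a \<odot>\<^bsub>conv\<^esub> f = (\<lambda>c \<in> carrier C. a \<odot>\<^bsub>A\<^esub> f c)"
  "f \<otimes>\<^bsub>conv\<^esub> g = (\<lambda>c \<in> carrier C. sweedler K C A (\<lambda>x y. f x \<otimes>\<^bsub>A\<^esub> g y) c)"
  "\<one>\<^bsub>conv\<^esub> = convolution_const C A \<one>\<^bsub>A\<^esub>"
  by (simp_all add: convolution_algebra_def convolution_monoid_def convolution_const_def)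

lemma conv_const_closed: "a \<in> carrier A \<Longrightarrow> convolution_const C A a \<in> carrier conv"
  unfolding convolution_const_def restrict_conv_iff
  by (rule linear_map_compose[OF linear_map_smult_left C.counit_linear]) (auto intro: A.module)

lemma conv_closures:
  shows "\<zero>\<^bsub>conv\<^esub> \<in> carrier conv"
    and "f \<in> carrier conv \<Longrightarrow> g \<in> carrier conv \<Longrightarrow> f \<oplus>\<^bsub>conv\<^esub> g \<in> carrier conv"
    and "a \<in> carrier K \<Longrightarrow> f \<in> carrier conv \<Longrightarrow> a \<odot>\<^bsub>conv\<^esub> f \<in> carrier conv"
    and "f \<in> carrier conv \<Longrightarrow> g \<in> carrier conv \<Longrightarrow> f \<otimes>\<^bsub>conv\<^esub> g \<in> carrier conv"
    and "\<one>\<^bsub>conv\<^esub> \<in> carrier conv"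
proof -
  show "\<zero>\<^bsub>conv\<^esub> \<in> carrier conv"
    unfolding conv_restrict restrict_conv_iff by (simp add: linear_map_def)
  show "f \<in> carrier conv \<Longrightarrow> g \<in> carrier conv \<Longrightarrow> f \<oplus>\<^bsub>conv\<^esub> g \<in> carrier conv"
    unfolding conv_restrict restrict_conv_iff by (intro linear_map_plus A.module conv_linear)
  show "a \<in> carrier K \<Longrightarrow> f \<in> carrier conv \<Longrightarrow> a \<odot>\<^bsub>conv\<^esub> f \<in> carrier conv"
    unfolding conv_restrict restrict_conv_iff by (intro linear_map_scale A.module conv_linear)
  show "f \<in> carrier conv \<Longrightarrow> g \<in> carrier conv \<Longrightarrow> f \<otimes>\<^bsub>conv\<^esub> g \<in> carrier conv"
    unfolding conv_restrict restrict_conv_iff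
    by (intro C.sweedler_linear A.module bilinear_mult_maps conv_linear)
  show "\<one>\<^bsub>conv\<^esub> \<in> carrier conv"
    by (simp add: conv_restrict conv_const_closed)
qed

lemma conv_mult3_apply:
  assumes f: "f \<in> carrier conv" and g: "g \<in> carrier conv" and h: "h \<in> carrier conv"
    and c: "c \<in> carrier C"
  shows "(f \<otimes>\<^bsub>conv\<^esub> g \<otimes>\<^bsub>conv\<^esub> h) c
    = sweedler3 K C A (\<lambda>x y z. f x \<otimes>\<^bsub>A\<^esub> g y \<otimes>\<^bsub>A\<^esub> h z) c"
  unfolding conv_apply(4)[OF c] sweedler3_def
proof (rule sweedler_cong)
  fix w z assume w: "w \<in> carrier C" and z: "z \<in> carrier C"
  show "(f \<otimes>\<^bsub>conv\<^esub> g) w \<otimes>\<^bsub>A\<^esub> h z = sweedler K C A (\<lambda>x y. f x \<otimes>\<^bsub>A\<^esub> g y \<otimes>\<^bsub>A\<^esub> h z) w"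
    unfolding conv_apply(4)[OF w]
    by (rule C.linear_map_sweedler[OF A.module A.module
        linear_mult_left[OF linear_map_id conv_closed[OF h z]] _ w])
      (intro bilinear_mult_maps conv_linear f g)
qed

lemma conv_assoc:
  assumes f: "f \<in> carrier conv" and g: "g \<in> carrier conv" and h: "h \<in> carrier conv"
  shows "f \<otimes>\<^bsub>conv\<^esub> g \<otimes>\<^bsub>conv\<^esub> h = f \<otimes>\<^bsub>conv\<^esub> (g \<otimes>\<^bsub>conv\<^esub> h)"
proof (rule conv_eqI)
  fix c assume c: "c \<in> carrier C"
  note lin = conv_linear[OF f] conv_linear[OF g] conv_linear[OF h]
  have "(f \<otimes>\<^bsub>conv\<^esub> g \<otimes>\<^bsub>conv\<^esub> h) c
      = sweedler K C A (\<lambda>x w. sweedler K C A (\<lambda>y z. f x \<otimes>\<^bsub>A\<^esub> g y \<otimes>\<^bsub>A\<^esub> h z) w) c"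
    unfolding conv_mult3_apply[OF f g h c]
    by (rule C.sweedler3_coassoc[OF A.module _ _ _ c])
      (intro linear_mult_left linear_mult_right lin; simp add: conv_closed f g h)+
  also have "\<dots> = (f \<otimes>\<^bsub>conv\<^esub> (g \<otimes>\<^bsub>conv\<^esub> h)) c"
    unfolding conv_apply(4)[OF c]
  proof (rule sweedler_cong)
    fix x w assume x: "x \<in> carrier C" and w: "w \<in> carrier C"
    have "f x \<otimes>\<^bsub>A\<^esub> (g \<otimes>\<^bsub>conv\<^esub> h) w = sweedler K C A (\<lambda>y z. f x \<otimes>\<^bsub>A\<^esub> (g y \<otimes>\<^bsub>A\<^esub> h z)) w"
      unfolding conv_apply(4)[OF w]
      by (rule C.linear_map_sweedler[OF A.module A.module
          linear_mult_right[OF linear_map_id conv_closed[OF f x]] _ w])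
        (intro bilinear_mult_maps lin)
    also have "\<dots> = sweedler K C A (\<lambda>y z. f x \<otimes>\<^bsub>A\<^esub> g y \<otimes>\<^bsub>A\<^esub> h z) w"
      using x by (intro sweedler_cong) (simp add: A.m_assoc conv_closed f g h)
    finally show "sweedler K C A (\<lambda>y z. f x \<otimes>\<^bsub>A\<^esub> g y \<otimes>\<^bsub>A\<^esub> h z) w
        = f x \<otimes>\<^bsub>A\<^esub> (g \<otimes>\<^bsub>conv\<^esub> h) w" by simp
  qed
  finally show "(f \<otimes>\<^bsub>conv\<^esub> g \<otimes>\<^bsub>conv\<^esub> h) c = (f \<otimes>\<^bsub>conv\<^esub> (g \<otimes>\<^bsub>conv\<^esub> h)) c" .
qed (auto intro!: conv_closures f g h)

lemma conv_comm:
  assumes f: "f \<in> carrier conv" and g: "g \<in> carrier conv"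
  shows "f \<otimes>\<^bsub>conv\<^esub> g = g \<otimes>\<^bsub>conv\<^esub> f"
proof (rule conv_eqI)
  fix c assume c: "c \<in> carrier C"
  have "(f \<otimes>\<^bsub>conv\<^esub> g) c = sweedler K C A (\<lambda>x y. f y \<otimes>\<^bsub>A\<^esub> g x) c"
    unfolding conv_apply(4)[OF c]
    by (rule C.sweedler_flip[OF A.module _ c, symmetric])
      (intro bilinear_mult_maps conv_linear f g)
  also have "\<dots> = (g \<otimes>\<^bsub>conv\<^esub> f) c"
    unfolding conv_apply(4)[OF c]
    by (rule sweedler_cong) (simp add: A.m_comm conv_closed f g)
  finally show "(f \<otimes>\<^bsub>conv\<^esub> g) c = (g \<otimes>\<^bsub>conv\<^esub> f) c" .
qed (auto intro!: conv_closures f g)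

text \<open>The counit \<open>\<epsilon>(c\<^sub>2)\<close> contained in the second factor absorbs the comultiplication.\<close>

lemma conv_mult_const:
  assumes f: "f \<in> carrier conv" and a: "a \<in> carrier A" and c: "c \<in> carrier C"
  shows "(f \<otimes>\<^bsub>conv\<^esub> convolution_const C A a) c = f c \<otimes>\<^bsub>A\<^esub> a"
proof -
  have "(f \<otimes>\<^bsub>conv\<^esub> convolution_const C A a) c
      = sweedler K C A (\<lambda>x y. counit C y \<odot>\<^bsub>A\<^esub> (f x \<otimes>\<^bsub>A\<^esub> a)) c"
    unfolding conv_apply(4)[OF c]
    by (rule sweedler_cong)
      (simp add: convolution_const_def conv_closed[OF f] a
        assoc_algebra.smult_mult_right[OF assoc_algebra_A])
  also have "\<dots> = f c \<otimes>\<^bsub>A\<^esub> a"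
    by (rule C.counit_right_linear[OF A.module linear_mult_left[OF conv_linear[OF f] a] c])
  finally show ?thesis .
qed

lemma conv_r_one: "f \<in> carrier conv \<Longrightarrow> f \<otimes>\<^bsub>conv\<^esub> \<one>\<^bsub>conv\<^esub> = f"
  by (rule conv_eqI) (simp_all add: conv_closures conv_restrict(5) conv_mult_const conv_const_closed
      conv_closed
    del: conv_restrict(4))

lemma conv_distrib:
  assumes f: "f \<in> carrier conv" and g: "g \<in> carrier conv" and h: "h \<in> carrier conv"
  shows "(f \<oplus>\<^bsub>conv\<^esub> g) \<otimes>\<^bsub>conv\<^esub> h = f \<otimes>\<^bsub>conv\<^esub> h \<oplus>\<^bsub>conv\<^esub> g \<otimes>\<^bsub>conv\<^esub> h"
proof (rule conv_eqI)
  fix c assume c: "c \<in> carrier C"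
  interpret CC: two_modules K C C ..
  have fh: "bilinear_map K C C A (\<lambda>x y. f x \<otimes>\<^bsub>A\<^esub> h y)"
    and gh: "bilinear_map K C C A (\<lambda>x y. g x \<otimes>\<^bsub>A\<^esub> h y)"
    by (intro bilinear_mult_maps conv_linear f g h)+
  show "((f \<oplus>\<^bsub>conv\<^esub> g) \<otimes>\<^bsub>conv\<^esub> h) c = (f \<otimes>\<^bsub>conv\<^esub> h \<oplus>\<^bsub>conv\<^esub> g \<otimes>\<^bsub>conv\<^esub> h) c"
    unfolding conv_apply(2,4)[OF c] unfolding sweedler_def
    by (rule CC.tensor_lift_unique[OF A.module _ _ C.comult_closed[OF c]])
      (simp_all add: linear_map_plus[OF A.module] CC.linear_map_tensor_lift A.module fh gh
        CC.tensor_lift(2) conv_apply conv_closed f g h A.l_distr)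
qed (auto intro!: conv_closures f g h)

lemma conv_smult_assoc:
  assumes a: "a \<in> carrier K" and f: "f \<in> carrier conv" and g: "g \<in> carrier conv"
  shows "(a \<odot>\<^bsub>conv\<^esub> f) \<otimes>\<^bsub>conv\<^esub> g = a \<odot>\<^bsub>conv\<^esub> (f \<otimes>\<^bsub>conv\<^esub> g)"
proof (rule conv_eqI)
  fix c assume c: "c \<in> carrier C"
  have "a \<odot>\<^bsub>A\<^esub> sweedler K C A (\<lambda>x y. f x \<otimes>\<^bsub>A\<^esub> g y) c
      = sweedler K C A (\<lambda>x y. a \<odot>\<^bsub>A\<^esub> (f x \<otimes>\<^bsub>A\<^esub> g y)) c"
    by (rule C.linear_map_sweedler[OF A.module A.module linear_map_scale[OF A.module linear_map_id
        a] _ c])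
      (intro bilinear_mult_maps conv_linear f g)
  also have "\<dots> = sweedler K C A (\<lambda>x y. (a \<odot>\<^bsub>conv\<^esub> f) x \<otimes>\<^bsub>A\<^esub> g y) c"
    by (rule sweedler_cong) (simp add: conv_apply A.smult_assoc2 conv_closed f g a)
  finally show "((a \<odot>\<^bsub>conv\<^esub> f) \<otimes>\<^bsub>conv\<^esub> g) c = (a \<odot>\<^bsub>conv\<^esub> (f \<otimes>\<^bsub>conv\<^esub> g)) c"
    by (simp add: conv_apply(3,4)[OF c])
qed (auto intro!: conv_closures a f g)

text \<open>Convolution inherits associativity from coassociativity, commutativity from cocommutativity
  and its unit from the counit. Because the result is again a commutative algebra, the
  construction can be iterated.\<close>

lemma algebra_conv: "algebra K conv"
proof (rule algebraI)
  show "cring K" by (rule C.R.is_cring)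
  have comm_group: "abelian_group conv"
  proof (rule abelian_groupI)
    fix f assume f: "f \<in> carrier conv"
    have neg: "(\<ominus>\<^bsub>K\<^esub> \<one>\<^bsub>K\<^esub>) \<odot>\<^bsub>conv\<^esub> f \<in> carrier conv" by (intro conv_closures f) simp
    have "(\<ominus>\<^bsub>K\<^esub> \<one>\<^bsub>K\<^esub>) \<odot>\<^bsub>conv\<^esub> f \<oplus>\<^bsub>conv\<^esub> f = \<zero>\<^bsub>conv\<^esub>"
      by (rule conv_eqI)
        (auto intro!: conv_closures neg f simp: conv_apply conv_closed f A.smult_l_minus A.l_neg)
    then show "\<exists>g \<in> carrier conv. g \<oplus>\<^bsub>conv\<^esub> f = \<zero>\<^bsub>conv\<^esub>" using neg by blast
  qed (auto intro!: conv_eqI simp: conv_closures conv_apply conv_closed A.a_ac)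
  show "cring conv"
  proof (rule cringI[OF comm_group])
    show "comm_monoid conv"
    proof (rule comm_monoidI)
      fix f assume f: "f \<in> carrier conv"
      show "\<one>\<^bsub>conv\<^esub> \<otimes>\<^bsub>conv\<^esub> f = f"
        using conv_comm[OF conv_closures(5) f] conv_r_one[OF f] by simp
    qed (fact conv_closures conv_assoc conv_comm)+
  qed (rule conv_distrib)
qed (auto intro!: conv_eqI simp: conv_closures conv_apply conv_closed A.smult_l_distr
    A.smult_r_distr
      A.smult_assoc1 conv_smult_assoc)

lemma module_conv: "module K conv"
  using algebra_conv by (rule algebra.module)

lemma linear_map_eval: "c \<in> carrier C \<Longrightarrow> linear_map K conv A (\<lambda>f. f c)"
  unfolding linear_map_def by (auto simp: conv_apply conv_closed)

text \<open>Applied with \<open>h\<close> an evaluation map, this reduces threefold products in an iterated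
  convolution algebra to products in \<open>A\<close>, one variable at a time.\<close>

lemma linear_conv_mult3:
  assumes P: "module K P" and h: "linear_map K A P h"
    and F: "f \<in> carrier conv" and G: "g \<in> carrier conv" and H: "k \<in> carrier conv"
    and c: "c \<in> carrier C"
  shows "h ((f \<otimes>\<^bsub>conv\<^esub> g \<otimes>\<^bsub>conv\<^esub> k) c)
    = sweedler3 K C P (\<lambda>x y z. h (f x \<otimes>\<^bsub>A\<^esub> g y \<otimes>\<^bsub>A\<^esub> k z)) c"
proof -
  let ?fgk = "\<lambda>x y z. f x \<otimes>\<^bsub>A\<^esub> g y \<otimes>\<^bsub>A\<^esub> k z"
  have inner: "bilinear_map K C C A (\<lambda>x y. ?fgk x y z)" if "z \<in> carrier C" for z
    using that by (intro linear_map_comp_bilinear[OF linear_mult_left[OF linear_map_id]]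
      bilinear_mult_maps conv_linear conv_closed F G H)
  have outer: "bilinear_map K C C A (\<lambda>w z. sweedler K C A (\<lambda>x y. ?fgk x y z) w)"
    by (intro bilinear_mapI C.sweedler_linear C.sweedler_linear_param A.module C.module_C inner
        linear_mult_right conv_linear A.m_closed conv_closed F G H)
  show ?thesis
    unfolding conv_mult3_apply[OF F G H c] sweedler3_def
    by (subst C.linear_map_sweedler[OF A.module P h outer c],
        intro sweedler_cong, rule C.linear_map_sweedler[OF A.module P h inner])
qed

text \<open>Currying, by which elements of iterated convolution algebras are obtained from multilinear
  maps.\<close>

lemma linear_map_into_conv:
  assumes B: "bilinear_map K V C A B"
  shows "linear_map K V conv (\<lambda>v. \<lambda>c \<in> carrier C. B v c)"
proof -
  have cl: "(\<lambda>c \<in> carrier C. B v c) \<in> carrier conv" if "v \<in> carrier V" for v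
    unfolding restrict_conv_iff by (rule bilinear_map_linear(1)[OF B that])
  show ?thesis
    unfolding linear_map_def
  proof (intro conjI ballI funcsetI)
    fix v w assume v: "v \<in> carrier V" and w: "w \<in> carrier V"
    show "(\<lambda>c \<in> carrier C. B (v \<oplus>\<^bsub>V\<^esub> w) c)
        = (\<lambda>c \<in> carrier C. B v c) \<oplus>\<^bsub>conv\<^esub> (\<lambda>c \<in> carrier C. B w c)"
      unfolding conv_restrict
      by (rule restrict_ext) (simp add: linear_map_add[OF bilinear_map_linear(2)[OF B]] v w)
  next
    fix a v assume a: "a \<in> carrier K" and v: "v \<in> carrier V"
    show "(\<lambda>c \<in> carrier C. B (a \<odot>\<^bsub>V\<^esub> v) c) = a \<odot>\<^bsub>conv\<^esub> (\<lambda>c \<in> carrier C. B v c)"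
      unfolding conv_restrict
      by (rule restrict_ext) (simp add: linear_map_smult[OF bilinear_map_linear(2)[OF B]] a v)
  qed (rule cl)
qed

lemma bilinear_of_linear_into_conv:
  assumes "linear_map K V conv F"
  shows "bilinear_map K V C A (\<lambda>v c. F v c)"
  by (intro bilinear_mapI linear_map_compose[OF linear_map_eval assms] conv_linear
     linear_map_closed[OF assms])

lemma linear_map_const: "linear_map K A conv (convolution_const C A)"
  unfolding convolution_const_def
  by (rule linear_map_into_conv[OF bilinear_map_flip[OF bilinear_functional_smult[OF
    A.module C.counit_linear linear_map_id]]])

end

section \<open>The coalgebra structure on a tensor product\<close>

locale two_coalgebras = C: coalgebra K C + D: coalgebra K D for K (structure) and C and D
begin

sublocale two_modules K C D ..

text \<open>The hypotheses \<open>E1\<close> and \<open>E2\<close> express that \<open>E\<close> is linear in each of its four arguments, which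
  are grouped as they appear in a nested sum over \<open>\<Delta>(c)\<close> and \<open>\<Delta>(d)\<close>.\<close>

lemma bilinear_sweedler_inner:
  assumes P: "module K P"
    and E1: "\<And>c c'. c \<in> carrier C \<Longrightarrow> c' \<in> carrier C \<Longrightarrow> bilinear_map K D D P (E c c')"
    and E2: "\<And>d d'. d \<in> carrier D \<Longrightarrow> d' \<in> carrier D \<Longrightarrow> bilinear_map K C C P (\<lambda>c c'. E c c' d d')"
    and d: "d \<in> carrier D"
  shows "bilinear_map K C C P (\<lambda>c c'. sweedler K D P (E c c') d)"
  by (intro bilinear_mapI D.sweedler_linear_param P C.module_C E1 d
      bilinear_map_linear(1)[OF E2] bilinear_map_linear(2)[OF E2])

lemma bilinear_sweedler_nested:
  assumes P: "module K P"
    and E1: "\<And>c c'. c \<in> carrier C \<Longrightarrow> c' \<in> carrier C \<Longrightarrow> bilinear_map K D D P (E c c')"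
    and E2: "\<And>d d'. d \<in> carrier D \<Longrightarrow> d' \<in> carrier D \<Longrightarrow> bilinear_map K C C P (\<lambda>c c'. E c c' d d')"
  shows "bilinear_map K C D P (\<lambda>c d. sweedler K C P (\<lambda>c c'. sweedler K D P (E c c') d) c)"
  by (intro bilinear_mapI C.sweedler_linear C.sweedler_linear_param P D.module_C
      bilinear_sweedler_inner D.sweedler_linear E1 E2)

lemma linear_map_sweedler_nested:
  assumes P: "module K P" and Q: "module K Q" and h: "linear_map K P Q h"
    and E1: "\<And>c c'. c \<in> carrier C \<Longrightarrow> c' \<in> carrier C \<Longrightarrow> bilinear_map K D D P (E c c')"
    and E2: "\<And>d d'. d \<in> carrier D \<Longrightarrow> d' \<in> carrier D \<Longrightarrow> bilinear_map K C C P (\<lambda>c c'. E c c' d d')"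
    and c: "c \<in> carrier C" and d: "d \<in> carrier D"
  shows "h (sweedler K C P (\<lambda>c c'. sweedler K D P (E c c') d) c)
    = sweedler K C Q (\<lambda>c c'. sweedler K D Q (\<lambda>d d'. h (E c c' d d')) d) c"
proof -
  have "h (sweedler K C P (\<lambda>c c'. sweedler K D P (E c c') d) c)
      = sweedler K C Q (\<lambda>c c'. h (sweedler K D P (E c c') d)) c"
    by (rule C.linear_map_sweedler[OF P Q h bilinear_sweedler_inner[OF P E1 E2 d] c])
  also have "\<dots> = sweedler K C Q (\<lambda>c c'. sweedler K D Q (\<lambda>d d'. h (E c c' d d')) d) c"
    by (rule sweedler_cong) (rule D.linear_map_sweedler[OF P Q h E1 d])
  finally show ?thesis .
qed

end

lemma tensor_coalg_simps [simp]:
  "carrier (tensor_coalg K C D) = carrier (tensor K C D)"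
  "add (tensor_coalg K C D) = add (tensor K C D)"
  "zero (tensor_coalg K C D) = zero (tensor K C D)"
  "smult (tensor_coalg K C D) = smult (tensor K C D)"
  by (simp_all add: tensor_coalg_def module.defs coalg.defs Let_def)

lemma comult_tensor_coalg:
  "comult (tensor_coalg K C D) = tensor_lift K C D (tensor K (tensor K C D) (tensor K C D))
    (\<lambda>c d. sweedler K C (tensor K (tensor K C D) (tensor K C D)) (\<lambda>c\<^sub>1 c\<^sub>2.
      sweedler K D (tensor K (tensor K C D) (tensor K C D)) (\<lambda>d\<^sub>1 d\<^sub>2.
        pure_tensor K (tensor K C D) (tensor K C D) (pure_tensor K C D c\<^sub>1 d\<^sub>1)
          (pure_tensor K C D c\<^sub>2 d\<^sub>2)) d) c)"
  by (simp add: tensor_coalg_def module.defs coalg.defs Let_def)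

lemma counit_tensor_coalg:
  "counit (tensor_coalg K C D) = tensor_lift K C D (scalars K) (\<lambda>c d. counit C c \<otimes>\<^bsub>K\<^esub> counit D d)"
  by (simp add: tensor_coalg_def module.defs coalg.defs Let_def)

text \<open>A Sweedler sum over \<open>tensor_coalg K C D\<close> refers to the tensor square of that record, while
  its comultiplication takes values in the tensor square of the plain module \<open>tensor K C D\<close>. The
  two agree, since a tensor product sees only the module structure of its factors.\<close>

lemma tensor_cong_module_structure:
  assumes "tensor_cong K M N p q"
    and "carrier M' = carrier M" "add M' = add M" "zero M' = zero M" "smult M' = smult M"
    and "carrier N' = carrier N" "add N' = add N" "smult N' = smult N"
  shows "tensor_cong K M' N' p q"
  using assms(1)
proof induction
  case (sym p q)
  show ?case using sym.IH by (rule tensor_cong.sym)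
next
  case (trans p q r)
  show ?case using trans.IH by (rule tensor_cong.trans)
next
  case (add_left x x' y)
  then show ?case using tensor_cong.add_left[of x M' x' y N' K] assms by simp
next
  case (add_right x y y')
  then show ?case using tensor_cong.add_right[of x M' y N' y' K] assms by simp
next
  case (smult a x y)
  then show ?case using tensor_cong.smult[of a K x M' y N'] assms by simp
next
  case (zero y)
  then show ?case using tensor_cong.zero[of y N' K M'] assms by simp
qed (simp_all add: tensor_cong.refl tensor_cong.plus)

lemma tensor_of_tensor_coalg:
  "tensor K (tensor_coalg K C D) (tensor_coalg K C D) = tensor K (tensor K C D) (tensor K C D)"
  "pure_tensor K (tensor_coalg K C D) (tensor_coalg K C D) = pure_tensor K (tensor K C D) (tensor K
      C D)"
  "tensor_lift K (tensor_coalg K C D) (tensor_coalg K C D) P = tensor_lift K (tensor K C D) (tensor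
      K C D) P"
proof -
  have cong: "tensor_cong K (tensor_coalg K C D) (tensor_coalg K C D)
      = tensor_cong K (tensor K C D) (tensor K C D)"
    by (intro ext iffI; erule tensor_cong_module_structure) simp_all
  have sums: "formal_sums (tensor_coalg K C D) (tensor_coalg K C D)
      = formal_sums (tensor K C D) (tensor K C D)"
    by (simp add: formal_sums_def)
  show t: "tensor K (tensor_coalg K C D) (tensor_coalg K C D) = tensor K (tensor K C D) (tensor K C
      D)"
    and p: "pure_tensor K (tensor_coalg K C D) (tensor_coalg K C D) = pure_tensor K (tensor K C D)
        (tensor K C D)"
    by (simp_all add: tensor_def pure_tensor_def tensor_rel_def cong sums fun_eq_iff)
  show "tensor_lift K (tensor_coalg K C D) (tensor_coalg K C D) P = tensor_lift K (tensor K C D)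
      (tensor K C D) P"
    by (simp add: tensor_lift_def t p fun_eq_iff)
qed

lemma linear_map_tensor_coalg:
  "linear_map K (tensor_coalg K C D) P h \<longleftrightarrow> linear_map K (tensor K C D) P h"
  by (simp add: linear_map_def)

lemma Hom_tensor_coalg: "Hom K (tensor_coalg K C D) P = Hom K (tensor K C D) P"
  by (simp add: Hom_def linear_map_tensor_coalg)

context two_coalgebras begin

abbreviation CD where "CD \<equiv> tensor K C D"

interpretation T2: two_modules K CD CD
  by (intro two_modules.intro module_tensor)

lemma bilinear_pull_pure:
  assumes B: "bilinear_map K CD CD P B"
  shows "c \<in> carrier C \<Longrightarrow> c' \<in> carrier C \<Longrightarrow>
      bilinear_map K D D P (\<lambda>d d'. B (pure_tensor K C D c d) (pure_tensor K C D c' d'))"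
    and "d \<in> carrier D \<Longrightarrow> d' \<in> carrier D \<Longrightarrow>
      bilinear_map K C C P (\<lambda>c c'. B (pure_tensor K C D c d) (pure_tensor K C D c' d'))"
  by (intro bilinear_map_pullback[OF B] linear_map_pure; assumption)+

lemma bilinear_comult_pure:
  "bilinear_map K C D (tensor K CD CD) (\<lambda>c d. sweedler K C (tensor K CD CD) (\<lambda>c\<^sub>1 c\<^sub>2.
      sweedler K D (tensor K CD CD) (\<lambda>d\<^sub>1 d\<^sub>2.
        pure_tensor K CD CD (pure_tensor K C D c\<^sub>1 d\<^sub>1) (pure_tensor K C D c\<^sub>2 d\<^sub>2)) d) c)"
  by (intro bilinear_sweedler_nested T2.module_tensor bilinear_pull_pure[OF T2.bilinear_pure])

lemma linear_comult_tensor: "linear_map K CD (tensor K CD CD) (comult (tensor_coalg K C D))"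
  unfolding comult_tensor_coalg
  by (rule linear_map_tensor_lift[OF T2.module_tensor bilinear_comult_pure])

lemma sweedler_tensor_linear:
  assumes P: "module K P" and B: "bilinear_map K CD CD P B"
  shows "linear_map K CD P (\<lambda>X. sweedler K (tensor_coalg K C D) P B X)"
  unfolding sweedler_def tensor_of_tensor_coalg
  by (rule linear_map_compose[OF T2.linear_map_tensor_lift[OF P B] linear_comult_tensor])

text \<open>The comultiplication \<open>(c \<otimes> d) \<mapsto> (c\<^sub>1 \<otimes> d\<^sub>1) \<otimes> (c\<^sub>2 \<otimes> d\<^sub>2)\<close>, in the form in which it is used.\<close>

lemma sweedler_tensor_pure:
  assumes P: "module K P" and B: "bilinear_map K CD CD P B"
    and c: "c \<in> carrier C" and d: "d \<in> carrier D"
  shows "sweedler K (tensor_coalg K C D) P B (pure_tensor K C D c d)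
    = sweedler K C P (\<lambda>c c'. sweedler K D P (\<lambda>d d'.
        B (pure_tensor K C D c d) (pure_tensor K C D c' d')) d) c"
proof -
  have "sweedler K (tensor_coalg K C D) P B (pure_tensor K C D c d)
      = tensor_lift K CD CD P B (sweedler K C (tensor K CD CD) (\<lambda>c\<^sub>1 c\<^sub>2.
      sweedler K D (tensor K CD CD) (\<lambda>d\<^sub>1 d\<^sub>2.
        pure_tensor K CD CD (pure_tensor K C D c\<^sub>1 d\<^sub>1) (pure_tensor K C D c\<^sub>2 d\<^sub>2)) d) c)"
    unfolding sweedler_def[of K "tensor_coalg K C D"] tensor_of_tensor_coalg comult_tensor_coalg
    by (subst tensor_lift(2)[OF T2.module_tensor bilinear_comult_pure c d]) (rule HOL.refl)
  also have "\<dots> = sweedler K C P (\<lambda>c\<^sub>1 c\<^sub>2. sweedler K D P (\<lambda>d\<^sub>1 d\<^sub>2.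
      tensor_lift K CD CD P B (pure_tensor K CD CD (pure_tensor K C D c\<^sub>1 d\<^sub>1)
        (pure_tensor K C D c\<^sub>2 d\<^sub>2))) d) c"
    by (rule linear_map_sweedler_nested[OF T2.module_tensor P T2.linear_map_tensor_lift[OF P B]
      bilinear_pull_pure(1)[OF T2.bilinear_pure] bilinear_pull_pure(2)[OF T2.bilinear_pure] c d])
  also have "\<dots> = sweedler K C P (\<lambda>c c'. sweedler K D P (\<lambda>d d'.
        B (pure_tensor K C D c d) (pure_tensor K C D c' d')) d) c"
    by (intro sweedler_cong) (simp add: T2.tensor_lift(2)[OF P B])
  finally show ?thesis .
qed

lemma bilinear_counit: "bilinear_map K C D (scalars K) (\<lambda>c d. counit C c \<otimes>\<^bsub>K\<^esub> counit D d)"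
  using bilinear_functional_smult[OF module_scalars[OF C.R.is_cring] C.counit_linear
      D.counit_linear]
  by simp

lemma counit_tensor_linear: "linear_map K CD (scalars K) (counit (tensor_coalg K C D))"
  unfolding counit_tensor_coalg
  by (rule linear_map_tensor_lift[OF module_scalars[OF C.R.is_cring] bilinear_counit])

lemma counit_tensor_pure:
  "c \<in> carrier C \<Longrightarrow> d \<in> carrier D \<Longrightarrow>
    counit (tensor_coalg K C D) (pure_tensor K C D c d) = counit C c \<otimes>\<^bsub>K\<^esub> counit D d"
  unfolding counit_tensor_coalg
  by (rule tensor_lift(2)[OF module_scalars[OF C.R.is_cring] bilinear_counit])

end

section \<open>Iterated convolution algebras\<close>

text \<open>The algebra \<open>Hom(C, Hom(D, A))\<close>: bilinear maps \<open>C \<times> D \<rightarrow> A\<close>, with convolution in both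
  variables.\<close>

locale double_convolution = C: cocommutative_coalgebra K C + DA: convolution K D A
  for K (structure) and C and D and A
begin

sublocale CDA: convolution K C "convolution_algebra K D A"
  by (intro convolution.intro DA.algebra_conv) unfold_locales

lemma linear_eval2:
  "d \<in> carrier D \<Longrightarrow> c \<in> carrier C \<Longrightarrow> linear_map K CDA.conv A (\<lambda>F. F c d)"
  by (rule linear_map_compose[OF DA.linear_map_eval CDA.linear_map_eval])

lemma conv2_mult_apply:
  assumes F: "F \<in> carrier CDA.conv" and G: "G \<in> carrier CDA.conv"
    and c: "c \<in> carrier C" and d: "d \<in> carrier D"
  shows "(F \<otimes>\<^bsub>CDA.conv\<^esub> G) c d
    = sweedler K C A (\<lambda>c\<^sub>1 c\<^sub>2. sweedler K D A (\<lambda>d\<^sub>1 d\<^sub>2. F c\<^sub>1 d\<^sub>1 \<otimes>\<^bsub>A\<^esub> G c\<^sub>2 d\<^sub>2) d) c"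
proof -
  have "(F \<otimes>\<^bsub>CDA.conv\<^esub> G) c d
      = sweedler K C A (\<lambda>c\<^sub>1 c\<^sub>2. (F c\<^sub>1 \<otimes>\<^bsub>DA.conv\<^esub> G c\<^sub>2) d) c"
    unfolding CDA.conv_apply(4)[OF c]
    by (rule C.linear_map_sweedler[OF DA.module_conv DA.A.module DA.linear_map_eval[OF d] _ c])
      (intro CDA.bilinear_mult_maps CDA.conv_linear F G)
  also have "\<dots> = sweedler K C A (\<lambda>c\<^sub>1 c\<^sub>2. sweedler K D A (\<lambda>d\<^sub>1 d\<^sub>2. F c\<^sub>1 d\<^sub>1 \<otimes>\<^bsub>A\<^esub> G c\<^sub>2 d\<^sub>2) d) c"
    by (simp add: DA.conv_apply(4)[OF d])
  finally show ?thesis .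
qed

lemma conv2_mult3_apply:
  assumes F: "F \<in> carrier CDA.conv" and G: "G \<in> carrier CDA.conv" and H: "H \<in> carrier CDA.conv"
    and c: "c \<in> carrier C" and d: "d \<in> carrier D"
  shows "(F \<otimes>\<^bsub>CDA.conv\<^esub> G \<otimes>\<^bsub>CDA.conv\<^esub> H) c d
    = sweedler3 K C A (\<lambda>c\<^sub>1 c\<^sub>2 c\<^sub>3. sweedler3 K D A (\<lambda>d\<^sub>1 d\<^sub>2 d\<^sub>3.
        F c\<^sub>1 d\<^sub>1 \<otimes>\<^bsub>A\<^esub> G c\<^sub>2 d\<^sub>2 \<otimes>\<^bsub>A\<^esub> H c\<^sub>3 d\<^sub>3) d) c"
  unfolding CDA.linear_conv_mult3[OF DA.A.module DA.linear_map_eval[OF d] F G H c]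
  unfolding sweedler3_def[of K C]
  by (intro sweedler_cong DA.conv_mult3_apply CDA.conv_closed F G H d)

lemma conv2_one_apply:
  "c \<in> carrier C \<Longrightarrow> d \<in> carrier D \<Longrightarrow>
    \<one>\<^bsub>CDA.conv\<^esub> c d = (counit C c \<otimes>\<^bsub>K\<^esub> counit D d) \<odot>\<^bsub>A\<^esub> \<one>\<^bsub>A\<^esub>"
  by (simp add: CDA.conv_apply DA.conv_apply DA.A.smult_assoc1)

lemma conv2_eqI:
  assumes "F \<in> carrier CDA.conv" "G \<in> carrier CDA.conv"
    and "\<And>c d. c \<in> carrier C \<Longrightarrow> d \<in> carrier D \<Longrightarrow> F c d = G c d"
  shows "F = G"
  using assms by (auto intro!: CDA.conv_eqI DA.conv_eqI CDA.conv_closed)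

lemma conv2_restrict_closed:
  assumes "bilinear_map K C D A B"
  shows "(\<lambda>c \<in> carrier C. \<lambda>d \<in> carrier D. B c d) \<in> carrier CDA.conv"
  unfolding CDA.restrict_conv_iff by (rule DA.linear_map_into_conv[OF assms])

end

locale triple_convolution =
  B: cocommutative_coalgebra K B + CDA: double_convolution K C D A
  for K (structure) and B and C and D and A
begin

sublocale BCDA: convolution K B "convolution_algebra K C (convolution_algebra K D A)"
  by (intro convolution.intro CDA.CDA.algebra_conv) unfold_locales

lemma conv3_mult_apply:
  assumes F: "F \<in> carrier BCDA.conv" and G: "G \<in> carrier BCDA.conv"
    and b: "b \<in> carrier B" and c: "c \<in> carrier C" and d: "d \<in> carrier D"
  shows "(F \<otimes>\<^bsub>BCDA.conv\<^esub> G) b c d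
    = sweedler K B A (\<lambda>b\<^sub>1 b\<^sub>2. sweedler K C A (\<lambda>c\<^sub>1 c\<^sub>2. sweedler K D A (\<lambda>d\<^sub>1 d\<^sub>2.
        F b\<^sub>1 c\<^sub>1 d\<^sub>1 \<otimes>\<^bsub>A\<^esub> G b\<^sub>2 c\<^sub>2 d\<^sub>2) d) c) b"
proof -
  have "(F \<otimes>\<^bsub>BCDA.conv\<^esub> G) b c d
      = sweedler K B A (\<lambda>b\<^sub>1 b\<^sub>2. (F b\<^sub>1 \<otimes>\<^bsub>CDA.CDA.conv\<^esub> G b\<^sub>2) c d) b"
    unfolding BCDA.conv_apply(4)[OF b]
    by (rule B.linear_map_sweedler[OF CDA.CDA.module_conv CDA.DA.A.module CDA.linear_eval2[OF d c] _
        b])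
      (intro BCDA.bilinear_mult_maps BCDA.conv_linear F G)
  also have "\<dots> = sweedler K B A (\<lambda>b\<^sub>1 b\<^sub>2. sweedler K C A (\<lambda>c\<^sub>1 c\<^sub>2. sweedler K D A (\<lambda>d\<^sub>1 d\<^sub>2.
        F b\<^sub>1 c\<^sub>1 d\<^sub>1 \<otimes>\<^bsub>A\<^esub> G b\<^sub>2 c\<^sub>2 d\<^sub>2) d) c) b"
    by (intro sweedler_cong CDA.conv2_mult_apply BCDA.conv_closed F G c d)
  finally show ?thesis .
qed

lemma conv3_mult3_apply:
  assumes F: "F \<in> carrier BCDA.conv" and G: "G \<in> carrier BCDA.conv" and H: "H \<in> carrier BCDA.conv"
    and b: "b \<in> carrier B" and c: "c \<in> carrier C" and d: "d \<in> carrier D"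
  shows "(F \<otimes>\<^bsub>BCDA.conv\<^esub> G \<otimes>\<^bsub>BCDA.conv\<^esub> H) b c d
    = sweedler3 K B A (\<lambda>b\<^sub>1 b\<^sub>2 b\<^sub>3. sweedler3 K C A (\<lambda>c\<^sub>1 c\<^sub>2 c\<^sub>3. sweedler3 K D A (\<lambda>d\<^sub>1 d\<^sub>2 d\<^sub>3.
        F b\<^sub>1 c\<^sub>1 d\<^sub>1 \<otimes>\<^bsub>A\<^esub> G b\<^sub>2 c\<^sub>2 d\<^sub>2 \<otimes>\<^bsub>A\<^esub> H b\<^sub>3 c\<^sub>3 d\<^sub>3) d) c) b"
  unfolding BCDA.linear_conv_mult3[OF CDA.DA.A.module CDA.linear_eval2[OF d c] F G H b]
  unfolding sweedler3_def[of K B]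
  by (intro sweedler_cong CDA.conv2_mult3_apply BCDA.conv_closed F G H c d)

lemma conv3_one_apply:
  "b \<in> carrier B \<Longrightarrow> c \<in> carrier C \<Longrightarrow> d \<in> carrier D \<Longrightarrow>
    \<one>\<^bsub>BCDA.conv\<^esub> b c d = (counit B b \<otimes>\<^bsub>K\<^esub> counit C c \<otimes>\<^bsub>K\<^esub> counit D d) \<odot>\<^bsub>A\<^esub> \<one>\<^bsub>A\<^esub>"
  by (simp add: BCDA.conv_apply CDA.CDA.conv_apply CDA.DA.conv_apply CDA.DA.A.smult_assoc1
      B.R.m_assoc)

lemma conv3_eqI:
  assumes "F \<in> carrier BCDA.conv" "G \<in> carrier BCDA.conv"
    and "\<And>b c d. b \<in> carrier B \<Longrightarrow> c \<in> carrier C \<Longrightarrow> d \<in> carrier D \<Longrightarrow> F b c d = G b c d"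
  shows "F = G"
  using assms by (auto intro!: BCDA.conv_eqI CDA.conv2_eqI BCDA.conv_closed)

lemma conv3_restrict_closed:
  assumes "\<And>c d. c \<in> carrier C \<Longrightarrow> d \<in> carrier D \<Longrightarrow> linear_map K B A (\<lambda>b. E b c d)"
    and "\<And>b d. b \<in> carrier B \<Longrightarrow> d \<in> carrier D \<Longrightarrow> linear_map K C A (\<lambda>c. E b c d)"
    and "\<And>b c. b \<in> carrier B \<Longrightarrow> c \<in> carrier C \<Longrightarrow> linear_map K D A (\<lambda>d. E b c d)"
  shows "(\<lambda>b \<in> carrier B. \<lambda>c \<in> carrier C. \<lambda>d \<in> carrier D. E b c d) \<in> carrier BCDA.conv"
  unfolding BCDA.restrict_conv_iff
proof (rule CDA.CDA.linear_map_into_conv)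
  show "bilinear_map K B C CDA.DA.conv (\<lambda>b c. \<lambda>d \<in> carrier D. E b c d)"
    by (intro bilinear_mapI CDA.DA.linear_map_into_conv assms)
qed

end

section \<open>Convolution on a tensor product\<close>

context double_convolution begin

sublocale CD: two_coalgebras K C D ..

abbreviation M where "M \<equiv> convolution_monoid K (tensor_coalg K C D) A"

definition curried :: "_ \<Rightarrow> _" where
  "curried f = (\<lambda>c \<in> carrier C. \<lambda>d \<in> carrier D. f (pure_tensor K C D c d))"

lemma curried_apply:
  "c \<in> carrier C \<Longrightarrow> d \<in> carrier D \<Longrightarrow> curried f c d = f (pure_tensor K C D c d)"
  by (simp add: curried_def)

lemma M_linear: "f \<in> carrier M \<Longrightarrow> linear_map K (tensor K C D) A f"
  by (simp add: convolution_monoid_def Hom_tensor_coalg Hom_linear)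

lemma M_closed: "f \<in> carrier M \<Longrightarrow> X \<in> carrier (tensor K C D) \<Longrightarrow> f X \<in> carrier A"
  by (rule linear_map_closed[OF M_linear])

lemma M_restrict_iff:
  "restrict f (carrier (tensor K C D)) \<in> carrier M \<longleftrightarrow> linear_map K (tensor K C D) A f"
  by (simp add: convolution_monoid_def Hom_tensor_coalg restrict_Hom_iff[OF CD.module_tensor])

lemma M_bilinear:
  "f \<in> carrier M \<Longrightarrow> g \<in> carrier M \<Longrightarrow>
    bilinear_map K (tensor K C D) (tensor K C D) A (\<lambda>x y. f x \<otimes>\<^bsub>A\<^esub> g y)"
  by (intro DA.bilinear_mult_maps M_linear)

lemma M_eqI:
  assumes f: "f \<in> carrier M" and g: "g \<in> carrier M"
    and eq: "\<And>c d. c \<in> carrier C \<Longrightarrow> d \<in> carrier D \<Longrightarrow> f (pure_tensor K C D c d) = g (pure_tensor K C D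
        c d)"
  shows "f = g"
proof (rule Hom_eqI)
  show "f \<in> Hom K (tensor K C D) A" "g \<in> Hom K (tensor K C D) A"
    using f g by (simp_all add: convolution_monoid_def Hom_tensor_coalg)
qed (rule CD.linear_map_tensor_eqI[OF DA.A.module M_linear[OF f] M_linear[OF g] eq])

lemma M_mult: "f \<otimes>\<^bsub>M\<^esub> g =
    (\<lambda>X \<in> carrier (tensor K C D). sweedler K (tensor_coalg K C D) A (\<lambda>x y. f x \<otimes>\<^bsub>A\<^esub> g y) X)"
  by (simp add: convolution_monoid_def)

lemma M_one: "\<one>\<^bsub>M\<^esub> = (\<lambda>X \<in> carrier (tensor K C D). counit (tensor_coalg K C D) X \<odot>\<^bsub>A\<^esub> \<one>\<^bsub>A\<^esub>)"
  by (simp add: convolution_monoid_def)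

lemma M_mult_closed: "f \<in> carrier M \<Longrightarrow> g \<in> carrier M \<Longrightarrow> f \<otimes>\<^bsub>M\<^esub> g \<in> carrier M"
  unfolding M_mult M_restrict_iff by (intro CD.sweedler_tensor_linear DA.A.module M_bilinear)

lemma M_one_closed: "\<one>\<^bsub>M\<^esub> \<in> carrier M"
  unfolding M_one M_restrict_iff
  by (rule linear_map_compose[OF linear_map_smult_left[OF DA.A.module] CD.counit_tensor_linear])
      simp

lemma curried_closed: "f \<in> carrier M \<Longrightarrow> curried f \<in> carrier CDA.conv"
  unfolding curried_def
  by (intro conv2_restrict_closed linear_map_comp_bilinear[OF M_linear CD.bilinear_pure])

lemma curried_eqD: "f \<in> carrier M \<Longrightarrow> g \<in> carrier M \<Longrightarrow> curried f = curried g \<Longrightarrow> f = g"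
  by (rule M_eqI) (auto simp: curried_apply[symmetric])

lemma M_mult_pure:
  assumes f: "f \<in> carrier M" and g: "g \<in> carrier M"
    and c: "c \<in> carrier C" and d: "d \<in> carrier D"
  shows "(f \<otimes>\<^bsub>M\<^esub> g) (pure_tensor K C D c d) = sweedler K C A (\<lambda>c\<^sub>1 c\<^sub>2. sweedler K D A (\<lambda>d\<^sub>1 d\<^sub>2.
      f (pure_tensor K C D c\<^sub>1 d\<^sub>1) \<otimes>\<^bsub>A\<^esub> g (pure_tensor K C D c\<^sub>2 d\<^sub>2)) d) c"
  unfolding M_mult using c d
  by (simp add: CD.sweedler_tensor_pure[OF DA.A.module M_bilinear[OF f g]])

lemma M_one_pure:
  "c \<in> carrier C \<Longrightarrow> d \<in> carrier D \<Longrightarrow>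
    \<one>\<^bsub>M\<^esub> (pure_tensor K C D c d) = (counit C c \<otimes>\<^bsub>K\<^esub> counit D d) \<odot>\<^bsub>A\<^esub> \<one>\<^bsub>A\<^esub>"
  by (simp add: M_one CD.counit_tensor_pure)

lemma curried_surj:
  assumes F: "F \<in> carrier CDA.conv"
  obtains f where "f \<in> carrier M" "curried f = F"
proof
  have bil: "bilinear_map K C D A (\<lambda>c d. F c d)"
    by (rule DA.bilinear_of_linear_into_conv[OF CDA.conv_linear[OF F]])
  let ?f = "tensor_lift K C D A (\<lambda>c d. F c d)"
  show f: "?f \<in> carrier M"
    using CD.tensor_lift(1)[OF DA.A.module bil] by (simp add: convolution_monoid_def
        Hom_tensor_coalg)
  show "curried ?f = F"
    by (rule conv2_eqI[OF curried_closed[OF f] F])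
      (simp add: curried_apply CD.tensor_lift(2)[OF DA.A.module bil])
qed

text \<open>Both products are given by the same nested Sweedler sum. Currying being injective, the laws
  of a commutative monoid carry over to \<open>Hom(C \<otimes> D, A)\<close> from the algebra \<open>Hom(C, Hom(D, A))\<close>.\<close>

lemma curried_mult:
  assumes f: "f \<in> carrier M" and g: "g \<in> carrier M"
  shows "curried (f \<otimes>\<^bsub>M\<^esub> g) = curried f \<otimes>\<^bsub>CDA.conv\<^esub> curried g"
proof (rule conv2_eqI)
  fix c d assume c: "c \<in> carrier C" and d: "d \<in> carrier D"
  show "curried (f \<otimes>\<^bsub>M\<^esub> g) c d = (curried f \<otimes>\<^bsub>CDA.conv\<^esub> curried g) c d"
    unfolding conv2_mult_apply[OF curried_closed[OF f] curried_closed[OF g] c d]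
      curried_apply[OF c d] M_mult_pure[OF f g c d]
    by (intro sweedler_cong) (simp add: curried_apply)
qed (auto intro!: curried_closed M_mult_closed CDA.conv_closures f g)

lemma curried_one: "curried \<one>\<^bsub>M\<^esub> = \<one>\<^bsub>CDA.conv\<^esub>"
  by (rule conv2_eqI)
    (auto intro!: curried_closed M_one_closed CDA.conv_closures simp: curried_apply M_one_pure
        conv2_one_apply)

lemma comm_monoid_M: "comm_monoid M"
proof (rule comm_monoidI)
  fix f g h assume f: "f \<in> carrier M" and g: "g \<in> carrier M" and h: "h \<in> carrier M"
  note cl = curried_closed[OF f] curried_closed[OF g] curried_closed[OF h]
  show "f \<otimes>\<^bsub>M\<^esub> g \<otimes>\<^bsub>M\<^esub> h = f \<otimes>\<^bsub>M\<^esub> (g \<otimes>\<^bsub>M\<^esub> h)"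
    by (rule curried_eqD)
      (simp_all add: M_mult_closed f g h curried_mult CDA.conv_assoc[OF cl])
  show "f \<otimes>\<^bsub>M\<^esub> g = g \<otimes>\<^bsub>M\<^esub> f"
    by (rule curried_eqD) (simp_all add: M_mult_closed f g curried_mult CDA.conv_comm[OF cl(1,2)])
  have "curried (\<one>\<^bsub>M\<^esub> \<otimes>\<^bsub>M\<^esub> f) = \<one>\<^bsub>CDA.conv\<^esub> \<otimes>\<^bsub>CDA.conv\<^esub> curried f"
    by (simp add: curried_mult M_one_closed f curried_one)
  also have "\<dots> = curried f"
    using CDA.conv_comm[OF CDA.conv_closures(5) cl(1)] CDA.conv_r_one[OF cl(1)] by simp
  finally show "\<one>\<^bsub>M\<^esub> \<otimes>\<^bsub>M\<^esub> f = f"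
    by (intro curried_eqD M_mult_closed M_one_closed f)
qed (fact M_mult_closed M_one_closed)+

end

section \<open>Equalizers of monoid homomorphisms\<close>

text \<open>Preservation of \<open>\<one>\<close> does not follow from membership in \<open>hom\<close>, since the monoids need not be
  groups.\<close>

definition unital_hom :: "('a, 'b) monoid_scheme \<Rightarrow> ('c, 'd) monoid_scheme \<Rightarrow> ('a \<Rightarrow> 'c) set" where
  "unital_hom G H = {h \<in> hom G H. h \<one>\<^bsub>G\<^esub> = \<one>\<^bsub>H\<^esub>}"

lemma unital_homI:
  assumes "\<And>x. x \<in> carrier G \<Longrightarrow> h x \<in> carrier H"
    and "\<And>x y. x \<in> carrier G \<Longrightarrow> y \<in> carrier G \<Longrightarrow> h (x \<otimes>\<^bsub>G\<^esub> y) = h x \<otimes>\<^bsub>H\<^esub> h y"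
    and "h \<one>\<^bsub>G\<^esub> = \<one>\<^bsub>H\<^esub>"
  shows "h \<in> unital_hom G H"
  using assms by (auto simp: unital_hom_def hom_def)

lemma unital_homD:
  assumes "h \<in> unital_hom G H"
  shows "x \<in> carrier G \<Longrightarrow> h x \<in> carrier H"
    and "x \<in> carrier G \<Longrightarrow> y \<in> carrier G \<Longrightarrow> h (x \<otimes>\<^bsub>G\<^esub> y) = h x \<otimes>\<^bsub>H\<^esub> h y"
    and "h \<one>\<^bsub>G\<^esub> = \<one>\<^bsub>H\<^esub>"
  using assms by (auto simp: unital_hom_def hom_def)

lemma unital_hom_one:
  assumes "monoid H"
  shows "(\<lambda>x. \<one>\<^bsub>H\<^esub>) \<in> unital_hom G H"
proof -
  interpret monoid H by fact
  show ?thesis by (rule unital_homI) simp_all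
qed

lemma unital_hom_compose:
  "h \<in> unital_hom G H \<Longrightarrow> k \<in> unital_hom H I \<Longrightarrow> (\<lambda>x. k (h x)) \<in> unital_hom G I"
  by (auto simp: unital_hom_def hom_def Pi_iff)

lemma unital_hom_mult:
  assumes "comm_monoid H" and h: "h \<in> unital_hom G H" and k: "k \<in> unital_hom G H"
  shows "(\<lambda>x. h x \<otimes>\<^bsub>H\<^esub> k x) \<in> unital_hom G H"
proof -
  interpret H: comm_monoid H by fact
  show ?thesis
    by (rule unital_homI) (simp_all add: unital_homD[OF h] unital_homD[OF k] H.m_ac)
qed

text \<open>Turns the alternating product of a cocycle condition into an equation between values of
  homomorphisms, free of inverses.\<close>

lemma (in comm_monoid) mult_inverse_middle_eq_one_iff:
  assumes "a \<in> carrier G" "b \<in> carrier G" "b' \<in> carrier G" "c \<in> carrier G" and b: "b \<otimes> b' = \<one>"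
  shows "a \<otimes> b' \<otimes> c = \<one> \<longleftrightarrow> a \<otimes> c = b"
proof
  assume "a \<otimes> b' \<otimes> c = \<one>"
  then have "b \<otimes> b' \<otimes> (a \<otimes> c) = b"
    using assms by (metis m_assoc m_comm m_closed r_one)
  then show "a \<otimes> c = b" using assms by simp
next
  assume "a \<otimes> c = b"
  then show "a \<otimes> b' \<otimes> c = \<one>" using assms by (metis m_assoc m_comm)
qed

text \<open>Every defining condition of the one-cocycles has the form \<open>h x = k x\<close>. The only point that
  needs an argument is closure under inverses:
  \<open>h(x\<^sup>-\<^sup>1) = h(x\<^sup>-\<^sup>1) k(x) k(x\<^sup>-\<^sup>1) = h(x\<^sup>-\<^sup>1) h(x) k(x\<^sup>-\<^sup>1) = k(x\<^sup>-\<^sup>1)\<close>.\<close>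

lemma equalizer_subgroup:
  assumes G: "comm_monoid G" and "comm_monoid H"
    and h: "h \<in> unital_hom G H" and k: "k \<in> unital_hom G H"
  shows "subgroup {x \<in> Units G. h x = k x} (units_of G)"
proof -
  interpret G: comm_monoid G by fact
  interpret H: comm_monoid H by fact
  interpret U: group "units_of G" by (rule G.units_group)
  show ?thesis
  proof (rule U.subgroupI)
    show "{x \<in> Units G. h x = k x} \<noteq> {}"
      using unital_homD(3)[OF h] unital_homD(3)[OF k] by auto
  next
    fix x assume x: "x \<in> {x \<in> Units G. h x = k x}"
    then have xu: "x \<in> Units G" and eq: "h x = k x" by auto
    note cl = G.Units_closed[OF xu] G.Units_closed[OF G.Units_inv_Units[OF xu]]
    have "h (inv\<^bsub>G\<^esub> x) = h (inv\<^bsub>G\<^esub> x) \<otimes>\<^bsub>H\<^esub> (k x \<otimes>\<^bsub>H\<^esub> k (inv\<^bsub>G\<^esub> x))"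
      using cl xu by (simp add: unital_homD(2)[OF k, symmetric] unital_homD[OF k] unital_homD[OF h])
    also have "\<dots> = h (inv\<^bsub>G\<^esub> x \<otimes>\<^bsub>G\<^esub> x) \<otimes>\<^bsub>H\<^esub> k (inv\<^bsub>G\<^esub> x)"
      unfolding unital_homD(2)[OF h cl(2,1)] eq using cl
      by (simp add: H.m_assoc unital_homD(1)[OF h] unital_homD(1)[OF k])
    also have "\<dots> = k (inv\<^bsub>G\<^esub> x)"
      using cl xu by (simp add: unital_homD(3)[OF h] unital_homD(1)[OF k])
    finally show "inv\<^bsub>units_of G\<^esub> x \<in> {x \<in> Units G. h x = k x}"
      using xu by (simp add: G.units_of_inv)
  next
    fix x y assume "x \<in> {x \<in> Units G. h x = k x}" "y \<in> {x \<in> Units G. h x = k x}"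
    then show "x \<otimes>\<^bsub>units_of G\<^esub> y \<in> {x \<in> Units G. h x = k x}"
      by (auto simp: units_of_mult unital_homD(2)[OF h] unital_homD(2)[OF k] G.Units_closed)
  qed (auto simp: units_of_carrier)
qed

text \<open>The group of units has the operations of the monoid, so a subgroup of it is a group with the
  operations of the monoid restricted to a smaller carrier.\<close>

lemma comm_group_of_units:
  fixes G :: "'a monoid"
  assumes G: "comm_monoid G" and S: "subgroup S (units_of G)"
  shows "comm_group (G\<lparr>carrier := S\<rparr>)"
proof -
  interpret G: comm_monoid G by fact
  interpret U: comm_group "units_of G" by (rule G.units_comm_group)
  have "comm_group ((units_of G)\<lparr>carrier := S\<rparr>)"
    by (rule group.group_comm_groupI[OF U.subgroup_imp_group[OF S]])
      (use subgroup.subset[OF S] in \<open>auto intro: U.m_comm\<close>)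
  also have "(units_of G)\<lparr>carrier := S\<rparr> = G\<lparr>carrier := S\<rparr>"
    by (simp add: units_of_def)
  finally show ?thesis .
qed

section \<open>Pulling back along coalgebra maps\<close>

lemma (in convolution) unital_hom_const: "convolution_const C A \<in> unital_hom A conv"
proof (rule unital_homI)
  fix a b assume a: "a \<in> carrier A" and b: "b \<in> carrier A"
  show "convolution_const C A (a \<otimes>\<^bsub>A\<^esub> b)
      = convolution_const C A a \<otimes>\<^bsub>conv\<^esub> convolution_const C A b"
    by (rule conv_eqI)
      (simp_all add: conv_const_closed conv_closures(4) conv_mult_const a b,
       simp add: convolution_const_def A.smult_assoc2 a b)
qed (simp_all add: conv_const_closed conv_restrict(5))

lemma (in double_convolution) unital_hom_curried: "curried \<in> unital_hom M CDA.conv"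
  by (rule unital_homI) (simp_all add: curried_closed curried_mult curried_one)

text \<open>Precomposition with a coalgebra map respects convolution. Here the coalgebra map is
  \<open>X \<otimes> Y \<otimes> Z \<rightarrow> C \<otimes> D\<close>, given by a trilinear map \<open>U\<close>; compatibility with the comultiplications is
  stated for \<open>A\<close>-valued Sweedler sums.\<close>

lemma (in double_convolution) unital_hom_pullback:
  fixes U :: "'x \<Rightarrow> 'y \<Rightarrow> 'z \<Rightarrow> _"
  assumes tc: "triple_convolution K X Y Z A"
    and U1: "\<And>y z. y \<in> carrier Y \<Longrightarrow> z \<in> carrier Z \<Longrightarrow> linear_map K X (tensor K C D) (\<lambda>x. U x y z)"
    and U2: "\<And>x z. x \<in> carrier X \<Longrightarrow> z \<in> carrier Z \<Longrightarrow> linear_map K Y (tensor K C D) (\<lambda>y. U x y z)"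
    and U3: "\<And>x y. x \<in> carrier X \<Longrightarrow> y \<in> carrier Y \<Longrightarrow> linear_map K Z (tensor K C D) (\<lambda>z. U x y z)"
    and comult: "\<And>F x y z. bilinear_map K (tensor K C D) (tensor K C D) A F \<Longrightarrow>
        x \<in> carrier X \<Longrightarrow> y \<in> carrier Y \<Longrightarrow> z \<in> carrier Z \<Longrightarrow>
        sweedler K (tensor_coalg K C D) A F (U x y z)
        = sweedler K X A (\<lambda>x\<^sub>1 x\<^sub>2. sweedler K Y A (\<lambda>y\<^sub>1 y\<^sub>2. sweedler K Z A (\<lambda>z\<^sub>1 z\<^sub>2.
            F (U x\<^sub>1 y\<^sub>1 z\<^sub>1) (U x\<^sub>2 y\<^sub>2 z\<^sub>2)) z) y) x"
    and counit: "\<And>x y z. x \<in> carrier X \<Longrightarrow> y \<in> carrier Y \<Longrightarrow> z \<in> carrier Z \<Longrightarrow>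
        counit (tensor_coalg K C D) (U x y z) = counit X x \<otimes>\<^bsub>K\<^esub> counit Y y \<otimes>\<^bsub>K\<^esub> counit Z z"
  shows "(\<lambda>f. \<lambda>x \<in> carrier X. \<lambda>y \<in> carrier Y. \<lambda>z \<in> carrier Z. f (U x y z))
    \<in> unital_hom M (convolution_algebra K X (convolution_algebra K Y (convolution_algebra K Z A)))"
    (is "?h \<in> unital_hom M ?R")
proof -
  interpret XYZ: triple_convolution K X Y Z A by fact
  have cl: "?h f \<in> carrier ?R" if f: "f \<in> carrier M" for f
    by (intro XYZ.conv3_restrict_closed linear_map_compose[OF M_linear[OF f]] U1 U2 U3)
  have U_cl: "U x y z \<in> carrier (tensor K C D)"
    if "x \<in> carrier X" "y \<in> carrier Y" "z \<in> carrier Z" for x y z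
    using linear_map_closed[OF U1] that by auto
  show ?thesis
  proof (rule unital_homI[OF cl])
    fix f g assume f: "f \<in> carrier M" and g: "g \<in> carrier M"
    show "?h (f \<otimes>\<^bsub>M\<^esub> g) = ?h f \<otimes>\<^bsub>?R\<^esub> ?h g"
    proof (rule XYZ.conv3_eqI[OF cl[OF M_mult_closed[OF f g]] XYZ.BCDA.conv_closures(4)[OF cl[OF f]
        cl[OF g]]])
      fix x y z assume xyz: "x \<in> carrier X" "y \<in> carrier Y" "z \<in> carrier Z"
      show "?h (f \<otimes>\<^bsub>M\<^esub> g) x y z = (?h f \<otimes>\<^bsub>?R\<^esub> ?h g) x y z"
        unfolding XYZ.conv3_mult_apply[OF cl[OF f] cl[OF g] xyz]
        using xyz by (simp add: M_mult U_cl comult[OF M_bilinear[OF f g]] cong: sweedler_cong)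
    qed
  next
    show "?h \<one>\<^bsub>M\<^esub> = \<one>\<^bsub>?R\<^esub>"
      by (rule XYZ.conv3_eqI[OF cl[OF M_one_closed] XYZ.BCDA.conv_closures(5)])
        (simp add: XYZ.conv3_one_apply M_one U_cl counit)
  qed
qed

section \<open>Sweedler calculus for products and actions\<close>

context bialgebra begin

lemma sweedler_one:
  assumes P: "module K P" and F: "bilinear_map K H H P F"
  shows "sweedler K H P F \<one>\<^bsub>H\<^esub> = F \<one>\<^bsub>H\<^esub> \<one>\<^bsub>H\<^esub>"
proof -
  interpret HH: two_modules K H H ..
  show ?thesis by (simp add: sweedler_def comult_one HH.tensor_lift(2)[OF P F])
qed

lemma bilinear_product: "bilinear_map K H H H (\<lambda>x y. x \<otimes>\<^bsub>H\<^esub> y)"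
  by (rule bilinear_map_mult) unfold_locales

lemma linear_product:
  "x \<in> carrier H \<Longrightarrow> linear_map K H H (\<lambda>y. x \<otimes>\<^bsub>H\<^esub> y)"
  "y \<in> carrier H \<Longrightarrow> linear_map K H H (\<lambda>x. x \<otimes>\<^bsub>H\<^esub> y)"
  by (rule bilinear_map_linear[OF bilinear_product]; assumption)+

lemma bilinear_products:
  assumes F: "bilinear_map K H H P F"
  shows "x \<in> carrier H \<Longrightarrow> x' \<in> carrier H \<Longrightarrow>
      bilinear_map K H H P (\<lambda>y y'. F (x \<otimes>\<^bsub>H\<^esub> y) (x' \<otimes>\<^bsub>H\<^esub> y'))"
    and "y \<in> carrier H \<Longrightarrow> y' \<in> carrier H \<Longrightarrow>
      bilinear_map K H H P (\<lambda>x x'. F (x \<otimes>\<^bsub>H\<^esub> y) (x' \<otimes>\<^bsub>H\<^esub> y'))"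
  by (intro bilinear_map_pullback[OF F] linear_product; assumption)+

lemma sweedler_mult:
  assumes P: "module K P" and F: "bilinear_map K H H P F"
    and x: "x \<in> carrier H" and y: "y \<in> carrier H"
  shows "sweedler K H P F (x \<otimes>\<^bsub>H\<^esub> y) = sweedler K H P (\<lambda>x\<^sub>1 x\<^sub>2. sweedler K H P (\<lambda>y\<^sub>1 y\<^sub>2.
      F (x\<^sub>1 \<otimes>\<^bsub>H\<^esub> y\<^sub>1) (x\<^sub>2 \<otimes>\<^bsub>H\<^esub> y\<^sub>2)) y) x"
proof -
  interpret HH: two_coalgebras K H H ..
  let ?l = "tensor_lift K H H P F"
  have "sweedler K H P F (x \<otimes>\<^bsub>H\<^esub> y) = ?l (sweedler K H (tensor K H H) (\<lambda>x\<^sub>1 x\<^sub>2. sweedler K H (tensor K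
      H H)
        (\<lambda>y\<^sub>1 y\<^sub>2. pure_tensor K H H (x\<^sub>1 \<otimes>\<^bsub>H\<^esub> y\<^sub>1) (x\<^sub>2 \<otimes>\<^bsub>H\<^esub> y\<^sub>2)) y) x)"
    by (simp add: sweedler_def[of K H P F] comult_mult x y)
  also have "\<dots> = sweedler K H P (\<lambda>x\<^sub>1 x\<^sub>2. sweedler K H P (\<lambda>y\<^sub>1 y\<^sub>2.
      ?l (pure_tensor K H H (x\<^sub>1 \<otimes>\<^bsub>H\<^esub> y\<^sub>1) (x\<^sub>2 \<otimes>\<^bsub>H\<^esub> y\<^sub>2))) y) x"
    by (rule HH.linear_map_sweedler_nested[OF HH.module_tensor P HH.linear_map_tensor_lift[OF P F]
      bilinear_products(1)[OF HH.bilinear_pure] bilinear_products(2)[OF HH.bilinear_pure] x y])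
  also have "\<dots> = sweedler K H P (\<lambda>x\<^sub>1 x\<^sub>2. sweedler K H P (\<lambda>y\<^sub>1 y\<^sub>2.
      F (x\<^sub>1 \<otimes>\<^bsub>H\<^esub> y\<^sub>1) (x\<^sub>2 \<otimes>\<^bsub>H\<^esub> y\<^sub>2)) y) x"
    by (intro sweedler_cong) (simp add: HH.tensor_lift(2)[OF P F])
  finally show ?thesis .
qed

end

context two_coalgebras begin

text \<open>Since \<open>\<phi>\<close> preserves the comultiplication, a sum over \<open>\<Delta>(\<phi>(c \<otimes> d))\<close> can be replaced by sums
  over \<open>\<Delta>(c)\<close> and \<open>\<Delta>(d)\<close>.\<close>

lemma sweedler_coalgebra_map:
  assumes "coalgebra K E" and \<phi>: "coalgebra_map K (tensor_coalg K C D) E \<phi>"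
    and P: "module K P" and F: "bilinear_map K E E P F"
    and c: "c \<in> carrier C" and d: "d \<in> carrier D"
  shows "sweedler K E P F (\<phi> (pure_tensor K C D c d))
    = sweedler K C P (\<lambda>c\<^sub>1 c\<^sub>2. sweedler K D P (\<lambda>d\<^sub>1 d\<^sub>2.
        F (\<phi> (pure_tensor K C D c\<^sub>1 d\<^sub>1)) (\<phi> (pure_tensor K C D c\<^sub>2 d\<^sub>2))) d) c"
proof -
  interpret E: coalgebra K E by fact
  interpret EE: two_modules K E E ..
  let ?l = "tensor_lift K E E P F"
  have lin: "linear_map K (tensor K C D) E \<phi>"
    using \<phi> by (simp add: coalgebra_map_def linear_map_tensor_coalg)
  have bil: "bilinear_map K (tensor K C D) (tensor K C D) (tensor K E E) (\<lambda>x y. pure_tensor K E E (\<phi>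
      x) (\<phi> y))"
    by (rule bilinear_map_pullback[OF EE.bilinear_pure lin lin])
  have cl: "\<phi> (pure_tensor K C D c d) \<in> carrier E" if "c \<in> carrier C" "d \<in> carrier D" for c d
    using that by (intro linear_map_closed[OF lin] pure_closed)
  have "comult E (\<phi> (pure_tensor K C D c d))
      = sweedler K (tensor_coalg K C D) (tensor K E E) (\<lambda>x y. pure_tensor K E E (\<phi> x) (\<phi> y))
          (pure_tensor K C D c d)"
    using \<phi> c d by (simp add: coalgebra_map_def)
  also have "\<dots> = sweedler K C (tensor K E E) (\<lambda>c\<^sub>1 c\<^sub>2. sweedler K D (tensor K E E) (\<lambda>d\<^sub>1 d\<^sub>2.
        pure_tensor K E E (\<phi> (pure_tensor K C D c\<^sub>1 d\<^sub>1)) (\<phi> (pure_tensor K C D c\<^sub>2 d\<^sub>2))) d) c"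
    by (rule sweedler_tensor_pure[OF EE.module_tensor bil c d])
  finally have "sweedler K E P F (\<phi> (pure_tensor K C D c d))
      = ?l (sweedler K C (tensor K E E) (\<lambda>c\<^sub>1 c\<^sub>2. sweedler K D (tensor K E E) (\<lambda>d\<^sub>1 d\<^sub>2.
        pure_tensor K E E (\<phi> (pure_tensor K C D c\<^sub>1 d\<^sub>1)) (\<phi> (pure_tensor K C D c\<^sub>2 d\<^sub>2))) d) c)"
    by (simp add: sweedler_def[of K E])
  also have "\<dots> = sweedler K C P (\<lambda>c\<^sub>1 c\<^sub>2. sweedler K D P (\<lambda>d\<^sub>1 d\<^sub>2.
        ?l (pure_tensor K E E (\<phi> (pure_tensor K C D c\<^sub>1 d\<^sub>1)) (\<phi> (pure_tensor K C D c\<^sub>2 d\<^sub>2)))) d) c"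
    by (rule linear_map_sweedler_nested[OF EE.module_tensor P EE.linear_map_tensor_lift[OF P F]
        bilinear_pull_pure(1)[OF bil] bilinear_pull_pure(2)[OF bil] c d])
  also have "\<dots> = sweedler K C P (\<lambda>c\<^sub>1 c\<^sub>2. sweedler K D P (\<lambda>d\<^sub>1 d\<^sub>2.
        F (\<phi> (pure_tensor K C D c\<^sub>1 d\<^sub>1)) (\<phi> (pure_tensor K C D c\<^sub>2 d\<^sub>2))) d) c"
    by (intro sweedler_cong) (simp add: EE.tensor_lift(2)[OF P F] cl)
  finally show ?thesis .
qed

lemma counit_coalgebra_map:
  "coalgebra_map K (tensor_coalg K C D) E \<phi> \<Longrightarrow> c \<in> carrier C \<Longrightarrow> d \<in> carrier D \<Longrightarrow>
    counit E (\<phi> (pure_tensor K C D c d)) = counit C c \<otimes>\<^bsub>K\<^esub> counit D d"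
  by (simp add: coalgebra_map_def counit_tensor_pure)

text \<open>Both conditions on a coalgebra map compare linear maps on \<open>C \<otimes> D\<close>, so pure tensors suffice.\<close>

lemma coalgebra_mapI:
  assumes "coalgebra K E" and lin: "linear_map K (tensor K C D) E \<phi>"
    and comult: "\<And>c d. c \<in> carrier C \<Longrightarrow> d \<in> carrier D \<Longrightarrow> comult E (\<phi> (pure_tensor K C D c d))
      = sweedler K C (tensor K E E) (\<lambda>c\<^sub>1 c\<^sub>2. sweedler K D (tensor K E E) (\<lambda>d\<^sub>1 d\<^sub>2.
        pure_tensor K E E (\<phi> (pure_tensor K C D c\<^sub>1 d\<^sub>1)) (\<phi> (pure_tensor K C D c\<^sub>2 d\<^sub>2))) d) c"
    and counit: "\<And>c d. c \<in> carrier C \<Longrightarrow> d \<in> carrier D \<Longrightarrow>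
      counit E (\<phi> (pure_tensor K C D c d)) = counit C c \<otimes>\<^bsub>K\<^esub> counit D d"
  shows "coalgebra_map K (tensor_coalg K C D) E \<phi>"
proof -
  interpret E: coalgebra K E by fact
  interpret EE: two_modules K E E ..
  have bil: "bilinear_map K (tensor K C D) (tensor K C D) (tensor K E E) (\<lambda>x y. pure_tensor K E E (\<phi>
      x) (\<phi> y))"
    by (rule bilinear_map_pullback[OF EE.bilinear_pure lin lin])
  have "comult E (\<phi> X) = sweedler K (tensor_coalg K C D) (tensor K E E)
      (\<lambda>x y. pure_tensor K E E (\<phi> x) (\<phi> y)) X" if X: "X \<in> carrier (tensor K C D)" for X
    by (rule linear_map_tensor_eqI[OF EE.module_tensor linear_map_compose[OF E.comult_linear lin]
        sweedler_tensor_linear[OF EE.module_tensor bil] _ X])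
      (simp add: comult sweedler_tensor_pure[OF EE.module_tensor bil])
  moreover have "counit E (\<phi> X) = counit (tensor_coalg K C D) X" if X: "X \<in> carrier (tensor K C D)"
      for X
    by (rule linear_map_tensor_eqI[OF module_scalars[OF C.R.is_cring]
        linear_map_compose[OF E.counit_linear lin] counit_tensor_linear _ X])
      (simp add: counit counit_tensor_pure)
  ultimately show ?thesis
    using lin by (simp add: coalgebra_map_def linear_map_tensor_coalg)
qed

end

section \<open>Skew bimeasurings are the one-cocycles\<close>

text \<open>Because \<open>\<mu>\<close> and \<open>\<nu>\<close> are coalgebra maps, composition with \<open>n \<otimes> m(t)\<close> and with \<open>n\<^sup>t \<otimes> s\<close>
  respects convolution.\<close>

locale coalgebra_actions =
  N: cocommutative_hopf_algebra K N + T: cocommutative_hopf_algebra K T + A: algebra K A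
  for K (structure) and N and T and A +
  fixes \<mu> :: "_ \<Rightarrow> _" and \<nu> :: "_ \<Rightarrow> _"
  assumes \<mu>_map: "coalgebra_map K (tensor_coalg K N T) N \<mu>"
    and \<nu>_map: "coalgebra_map K (tensor_coalg K N T) T \<nu>"
begin

sublocale NT: double_convolution K N T A
  by (intro double_convolution.intro convolution.intro) unfold_locales

sublocale NNT: triple_convolution K N N T A
  by (intro triple_convolution.intro) unfold_locales

sublocale NTT: triple_convolution K N T T A
  by (intro triple_convolution.intro double_convolution.intro) unfold_locales

abbreviation tens where "tens \<equiv> pure_tensor K N T"
abbreviation M where "M \<equiv> convolution_monoid K (tensor_coalg K N T) A"
abbreviation act_N (infixl \<open>\<triangleleft>\<close> 75) where "n \<triangleleft> t \<equiv> \<mu> (tens n t)"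
abbreviation act_T (infixl \<open>\<triangleright>\<close> 75) where "n \<triangleright> t \<equiv> \<nu> (tens n t)"

lemma linear_actions:
  "linear_map K (tensor K N T) N \<mu>" "linear_map K (tensor K N T) T \<nu>"
  using \<mu>_map \<nu>_map by (simp_all add: coalgebra_map_def linear_map_tensor_coalg)

lemma bilinear_actions:
  "bilinear_map K N T N (\<lambda>n t. n \<triangleleft> t)" "bilinear_map K N T T (\<lambda>n t. n \<triangleright> t)"
  by (rule linear_map_comp_bilinear[OF _ NT.CD.bilinear_pure], rule linear_actions)+

lemmas act_N_linear = bilinear_map_linear[OF bilinear_actions(1)]
lemmas act_T_linear = bilinear_map_linear[OF bilinear_actions(2)]
lemmas act_N_closed = bilinear_map_closed[OF bilinear_actions(1)]
lemmas act_T_closed = bilinear_map_closed[OF bilinear_actions(2)]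
lemmas tens_linear = NT.CD.linear_map_pure

lemmas bilinear_tens = NT.CD.bilinear_pull_pure

text \<open>The faces of the double complex in bidegree \<open>(1, 1)\<close>: those in the direction of \<open>N\<close> take
  values in \<open>Hom(N, Hom(N, Hom(T, A)))\<close>, those in the direction of \<open>T\<close> in
  \<open>Hom(N, Hom(T, Hom(T, A)))\<close>. The last face of each kind ignores one variable up to its counit,
  hence is built from \<open>convolution_const\<close>.\<close>

definition face_N0 where "face_N0 f = (\<lambda>n \<in> carrier N. \<lambda>m \<in> carrier N. \<lambda>t \<in> carrier T. f (tens n (m
    \<triangleright> t)))"
definition face_N1 where "face_N1 f = (\<lambda>n \<in> carrier N. \<lambda>m \<in> carrier N. \<lambda>t \<in> carrier T. f (tens (n \<otimes>\<^bsub>N\<^esub>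
    m) t))"
definition face_N2 where "face_N2 f = convolution_const N NT.CDA.conv (NT.curried f)"
definition face_T0 where "face_T0 f = (\<lambda>n \<in> carrier N. \<lambda>t \<in> carrier T. \<lambda>s \<in> carrier T. f (tens (n \<triangleleft>
    t) s))"
definition face_T1 where "face_T1 f = (\<lambda>n \<in> carrier N. \<lambda>t \<in> carrier T. \<lambda>s \<in> carrier T. f (tens n (t
    \<otimes>\<^bsub>T\<^esub> s)))"
definition face_T2 where "face_T2 f = (\<lambda>n \<in> carrier N. \<lambda>t \<in> carrier T. convolution_const T A (f
    (tens n t)))"

lemma face_N0_hom: "face_N0 \<in> unital_hom M NNT.BCDA.conv"
  unfolding face_N0_def
proof (rule NT.unital_hom_pullback)
  fix F n m t assume F: "bilinear_map K (tensor K N T) (tensor K N T) A F"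
    and n: "n \<in> carrier N" and m: "m \<in> carrier N" and t: "t \<in> carrier T"
  show "sweedler K (tensor_coalg K N T) A F (tens n (m \<triangleright> t))
    = sweedler K N A (\<lambda>n\<^sub>1 n\<^sub>2. sweedler K N A (\<lambda>m\<^sub>1 m\<^sub>2. sweedler K T A (\<lambda>t\<^sub>1 t\<^sub>2.
        F (tens n\<^sub>1 (m\<^sub>1 \<triangleright> t\<^sub>1)) (tens n\<^sub>2 (m\<^sub>2 \<triangleright> t\<^sub>2))) t) m) n"
    unfolding NT.CD.sweedler_tensor_pure[OF A.module F n act_T_closed[OF m t]]
    by (intro sweedler_cong NT.CD.sweedler_coalgebra_map[OF T.coalgebra_axioms \<nu>_map A.module _ m t]
        bilinear_tens(1)[OF F])
next
  show "triple_convolution K N N T A" by unfold_locales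
qed (auto intro!: linear_map_compose[OF tens_linear(2)] tens_linear act_T_linear act_T_closed
    simp: NT.CD.counit_tensor_pure NT.CD.counit_coalgebra_map[OF \<nu>_map] act_T_closed N.R.m_assoc)

lemma face_T0_hom: "face_T0 \<in> unital_hom M NTT.BCDA.conv"
  unfolding face_T0_def
proof (rule NT.unital_hom_pullback)
  fix F n t s assume F: "bilinear_map K (tensor K N T) (tensor K N T) A F"
    and n: "n \<in> carrier N" and t: "t \<in> carrier T" and s: "s \<in> carrier T"
  show "sweedler K (tensor_coalg K N T) A F (tens (n \<triangleleft> t) s)
    = sweedler K N A (\<lambda>n\<^sub>1 n\<^sub>2. sweedler K T A (\<lambda>t\<^sub>1 t\<^sub>2. sweedler K T A (\<lambda>s\<^sub>1 s\<^sub>2.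
        F (tens (n\<^sub>1 \<triangleleft> t\<^sub>1) s\<^sub>1) (tens (n\<^sub>2 \<triangleleft> t\<^sub>2) s\<^sub>2)) s) t) n"
    unfolding NT.CD.sweedler_tensor_pure[OF A.module F act_N_closed[OF n t] s]
    by (intro NT.CD.sweedler_coalgebra_map[OF N.coalgebra_axioms \<mu>_map A.module _ n t]
        NT.CD.bilinear_sweedler_inner A.module bilinear_tens[OF F] s)
next
  show "triple_convolution K N T T A" by unfold_locales
qed (auto intro!: linear_map_compose[OF tens_linear(1)] tens_linear act_N_linear act_N_closed
    simp: NT.CD.counit_tensor_pure NT.CD.counit_coalgebra_map[OF \<mu>_map] act_N_closed N.R.m_assoc)

lemma face_N1_hom: "face_N1 \<in> unital_hom M NNT.BCDA.conv"
  unfolding face_N1_def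
proof (rule NT.unital_hom_pullback)
  fix F n m t assume F: "bilinear_map K (tensor K N T) (tensor K N T) A F"
    and n: "n \<in> carrier N" and m: "m \<in> carrier N" and t: "t \<in> carrier T"
  show "sweedler K (tensor_coalg K N T) A F (tens (n \<otimes>\<^bsub>N\<^esub> m) t)
    = sweedler K N A (\<lambda>n\<^sub>1 n\<^sub>2. sweedler K N A (\<lambda>m\<^sub>1 m\<^sub>2. sweedler K T A (\<lambda>t\<^sub>1 t\<^sub>2.
        F (tens (n\<^sub>1 \<otimes>\<^bsub>N\<^esub> m\<^sub>1) t\<^sub>1) (tens (n\<^sub>2 \<otimes>\<^bsub>N\<^esub> m\<^sub>2) t\<^sub>2)) t) m) n"
    unfolding NT.CD.sweedler_tensor_pure[OF A.module F N.m_closed[OF n m] t]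
    by (intro N.sweedler_mult[OF A.module _ n m]
        NT.CD.bilinear_sweedler_inner A.module bilinear_tens[OF F] t)
next
  show "triple_convolution K N N T A" by unfold_locales
qed (auto intro!: linear_map_compose[OF tens_linear(1)] tens_linear N.linear_product
    simp: NT.CD.counit_tensor_pure N.counit_mult)

lemma face_T1_hom: "face_T1 \<in> unital_hom M NTT.BCDA.conv"
  unfolding face_T1_def
proof (rule NT.unital_hom_pullback)
  fix F n t s assume F: "bilinear_map K (tensor K N T) (tensor K N T) A F"
    and n: "n \<in> carrier N" and t: "t \<in> carrier T" and s: "s \<in> carrier T"
  show "sweedler K (tensor_coalg K N T) A F (tens n (t \<otimes>\<^bsub>T\<^esub> s))
    = sweedler K N A (\<lambda>n\<^sub>1 n\<^sub>2. sweedler K T A (\<lambda>t\<^sub>1 t\<^sub>2. sweedler K T A (\<lambda>s\<^sub>1 s\<^sub>2.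
        F (tens n\<^sub>1 (t\<^sub>1 \<otimes>\<^bsub>T\<^esub> s\<^sub>1)) (tens n\<^sub>2 (t\<^sub>2 \<otimes>\<^bsub>T\<^esub> s\<^sub>2))) s) t) n"
    unfolding NT.CD.sweedler_tensor_pure[OF A.module F n T.m_closed[OF t s]]
    by (intro sweedler_cong T.sweedler_mult[OF A.module _ t s] bilinear_tens(1)[OF F])
next
  show "triple_convolution K N T T A" by unfold_locales
qed (auto intro!: linear_map_compose[OF tens_linear(2)] tens_linear T.linear_product
    simp: NT.CD.counit_tensor_pure T.counit_mult N.R.m_assoc)

lemma face_N2_hom: "face_N2 \<in> unital_hom M NNT.BCDA.conv"
  unfolding face_N2_def by (rule unital_hom_compose[OF NT.unital_hom_curried
      NNT.BCDA.unital_hom_const])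

end

context coalgebra_actions begin

text \<open>Composition with the algebra homomorphism \<open>convolution_const\<close> in the values respects
  convolution.\<close>

lemma face_T2_hom: "face_T2 \<in> unital_hom M NTT.BCDA.conv"
proof -
  interpret NTc: double_convolution K N T "convolution_algebra K T A"
    by (intro double_convolution.intro convolution.intro NT.DA.algebra_conv) unfold_locales
  have cl: "face_T2 f \<in> carrier NTT.BCDA.conv" if f: "f \<in> carrier M" for f
    unfolding face_T2_def
    by (intro NTc.conv2_restrict_closed linear_map_comp_bilinear[OF NT.DA.linear_map_const]
        linear_map_comp_bilinear[OF NT.M_linear[OF f]] NT.CD.bilinear_pure)
  show ?thesis
  proof (rule unital_homI[OF cl])
    fix f g assume f: "f \<in> carrier M" and g: "g \<in> carrier M"
    show "face_T2 (f \<otimes>\<^bsub>M\<^esub> g) = face_T2 f \<otimes>\<^bsub>NTT.BCDA.conv\<^esub> face_T2 g"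
    proof (rule NTc.conv2_eqI[OF cl[OF NT.M_mult_closed[OF f g]] NTT.BCDA.conv_closures(4)[OF cl[OF
        f] cl[OF g]]])
      fix n t assume n: "n \<in> carrier N" and t: "t \<in> carrier T"
      have "face_T2 (f \<otimes>\<^bsub>M\<^esub> g) n t = sweedler K N NT.DA.conv (\<lambda>n\<^sub>1 n\<^sub>2. sweedler K T NT.DA.conv (\<lambda>t\<^sub>1 t\<^sub>2.
          convolution_const T A (f (tens n\<^sub>1 t\<^sub>1) \<otimes>\<^bsub>A\<^esub> g (tens n\<^sub>2 t\<^sub>2))) t) n"
        using n t unfolding face_T2_def
        by (simp add: NT.M_mult_pure[OF f g] NT.CD.linear_map_sweedler_nested[OF A.module
          NT.DA.module_conv NT.DA.linear_map_const bilinear_tens(1)[OF NT.M_bilinear[OF f g]]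
          bilinear_tens(2)[OF NT.M_bilinear[OF f g]]])
      also have "\<dots> = (face_T2 f \<otimes>\<^bsub>NTT.BCDA.conv\<^esub> face_T2 g) n t"
        unfolding NTc.conv2_mult_apply[OF cl[OF f] cl[OF g] n t]
        by (intro sweedler_cong)
          (simp add: face_T2_def unital_homD(2)[OF NT.DA.unital_hom_const] NT.M_closed f g)
      finally show "face_T2 (f \<otimes>\<^bsub>M\<^esub> g) n t = (face_T2 f \<otimes>\<^bsub>NTT.BCDA.conv\<^esub> face_T2 g) n t" .
    qed
  next
    show "face_T2 \<one>\<^bsub>M\<^esub> = \<one>\<^bsub>NTT.BCDA.conv\<^esub>"
      by (rule NTc.conv2_eqI[OF cl[OF NT.M_one_closed] NTT.BCDA.conv_closures(5)])
        (simp add: face_T2_def NT.M_one_pure NTc.conv2_one_apply linear_map_smult[OF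
            NT.DA.linear_map_const]
          unital_homD(3)[OF NT.DA.unital_hom_const])
  qed
qed

text \<open>The factor \<open>\<epsilon>(n\<^sub>2)\<close> in the last face removes the sum over \<open>\<Delta>(n)\<close>, which leaves the right-hand
  side of the first equation of a skew bimeasuring.\<close>

lemma face_N_mult_apply:
  assumes f: "f \<in> carrier M" and n: "n \<in> carrier N" and m: "m \<in> carrier N" and t: "t \<in> carrier T"
  shows "(face_N0 f \<otimes>\<^bsub>NNT.BCDA.conv\<^esub> face_N2 f) n m t = sweedler K N A (\<lambda>m\<^sub>1 m\<^sub>2. sweedler K T A
      (\<lambda>t\<^sub>1 t\<^sub>2. f (tens n (m\<^sub>1 \<triangleright> t\<^sub>1)) \<otimes>\<^bsub>A\<^esub> f (tens m\<^sub>2 t\<^sub>2)) t) m"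
proof -
  have face_N0_cl: "face_N0 f \<in> carrier NNT.BCDA.conv" by (rule unital_homD(1)[OF face_N0_hom f])
  have "(face_N0 f \<otimes>\<^bsub>NNT.BCDA.conv\<^esub> face_N2 f) n m t = (face_N0 f n \<otimes>\<^bsub>NT.CDA.conv\<^esub> NT.curried f) m t"
    unfolding face_N2_def NNT.BCDA.conv_mult_const[OF face_N0_cl NT.curried_closed[OF f] n] ..
  also have "\<dots> = sweedler K N A (\<lambda>m\<^sub>1 m\<^sub>2. sweedler K T A
      (\<lambda>t\<^sub>1 t\<^sub>2. f (tens n (m\<^sub>1 \<triangleright> t\<^sub>1)) \<otimes>\<^bsub>A\<^esub> f (tens m\<^sub>2 t\<^sub>2)) t) m"
    unfolding NT.conv2_mult_apply[OF NNT.BCDA.conv_closed[OF face_N0_cl n] NT.curried_closed[OF f] m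
        t]
    by (intro sweedler_cong) (simp add: face_N0_def n NT.curried_apply)
  finally show ?thesis .
qed

text \<open>Here the factor \<open>\<epsilon>(s\<^sub>2)\<close> in the last face removes the sum over \<open>\<Delta>(s)\<close>.\<close>

lemma face_T_mult_apply:
  assumes f: "f \<in> carrier M" and n: "n \<in> carrier N" and t: "t \<in> carrier T" and s: "s \<in> carrier T"
  shows "(face_T0 f \<otimes>\<^bsub>NTT.BCDA.conv\<^esub> face_T2 f) n t s = sweedler K N A (\<lambda>n\<^sub>1 n\<^sub>2. sweedler K T A
      (\<lambda>t\<^sub>1 t\<^sub>2. f (tens (n\<^sub>1 \<triangleleft> t\<^sub>1) s) \<otimes>\<^bsub>A\<^esub> f (tens n\<^sub>2 t\<^sub>2)) t) n"
proof -
  have face_T0_cl: "face_T0 f \<in> carrier NTT.BCDA.conv" by (rule unital_homD(1)[OF face_T0_hom f])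
  have face_T2_cl: "face_T2 f \<in> carrier NTT.BCDA.conv" by (rule unital_homD(1)[OF face_T2_hom f])
  show ?thesis
    unfolding NTT.conv3_mult_apply[OF face_T0_cl face_T2_cl n t s]
  proof (intro sweedler_cong)
    fix n\<^sub>1 n\<^sub>2 t\<^sub>1 t\<^sub>2 assume nt: "n\<^sub>1 \<in> carrier N" "n\<^sub>2 \<in> carrier N" "t\<^sub>1 \<in> carrier T" "t\<^sub>2 \<in> carrier T"
    have "sweedler K T A (\<lambda>s\<^sub>1 s\<^sub>2. face_T0 f n\<^sub>1 t\<^sub>1 s\<^sub>1 \<otimes>\<^bsub>A\<^esub> face_T2 f n\<^sub>2 t\<^sub>2 s\<^sub>2) s
        = (face_T0 f n\<^sub>1 t\<^sub>1 \<otimes>\<^bsub>NT.DA.conv\<^esub> convolution_const T A (f (tens n\<^sub>2 t\<^sub>2))) s"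
      using nt by (simp add: NT.DA.conv_apply(4)[OF s] face_T2_def)
    also have "\<dots> = face_T0 f n\<^sub>1 t\<^sub>1 s \<otimes>\<^bsub>A\<^esub> f (tens n\<^sub>2 t\<^sub>2)"
      using nt s by (intro NT.DA.conv_mult_const NTT.CDA.CDA.conv_closed NTT.BCDA.conv_closed[OF
          face_T0_cl]
        NT.M_closed[OF f]) auto
    finally show "sweedler K T A (\<lambda>s\<^sub>1 s\<^sub>2. face_T0 f n\<^sub>1 t\<^sub>1 s\<^sub>1 \<otimes>\<^bsub>A\<^esub> face_T2 f n\<^sub>2 t\<^sub>2 s\<^sub>2) s
        = f (tens (n\<^sub>1 \<triangleleft> t\<^sub>1) s) \<otimes>\<^bsub>A\<^esub> f (tens n\<^sub>2 t\<^sub>2)"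
      using nt s by (simp add: face_T0_def)
  qed
qed

text \<open>In a product of three functions, \<open>n\<close> would be split into three parts; the third one appears
  as \<open>\<epsilon>(n\<^sub>3)\<close> only, so that two parts remain, as in the cocycle condition.\<close>

lemma face_N_cocycle_apply:
  assumes f: "f \<in> carrier M" and g: "g \<in> carrier M"
    and n: "n \<in> carrier N" and m: "m \<in> carrier N" and t: "t \<in> carrier T"
  shows "(face_N0 f \<otimes>\<^bsub>NNT.BCDA.conv\<^esub> face_N1 g \<otimes>\<^bsub>NNT.BCDA.conv\<^esub> face_N2 f) n m t
    = sweedler K N A (\<lambda>n\<^sub>1 n\<^sub>2. sweedler3 K N A (\<lambda>m\<^sub>1 m\<^sub>2 m\<^sub>3. sweedler3 K T A (\<lambda>t\<^sub>1 t\<^sub>2 t\<^sub>3.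
        f (tens n\<^sub>1 (m\<^sub>1 \<triangleright> t\<^sub>1)) \<otimes>\<^bsub>A\<^esub> g (tens (n\<^sub>2 \<otimes>\<^bsub>N\<^esub> m\<^sub>2) t\<^sub>2) \<otimes>\<^bsub>A\<^esub> f (tens m\<^sub>3 t\<^sub>3)) t) m) n"
proof -
  have face_N0_cl: "face_N0 f \<in> carrier NNT.BCDA.conv" by (rule unital_homD(1)[OF face_N0_hom f])
  have face_N1_cl: "face_N1 g \<in> carrier NNT.BCDA.conv" by (rule unital_homD(1)[OF face_N1_hom g])
  note F = NT.curried_closed[OF f]
  let ?R = NT.CDA.conv
  have lin: "linear_map K ?R A (\<lambda>H. (H \<otimes>\<^bsub>?R\<^esub> NT.curried f) m t)"
    by (rule linear_map_compose[OF NT.linear_eval2[OF t m] NNT.BCDA.linear_mult_left[OF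
        linear_map_id F]])
  have "(face_N0 f \<otimes>\<^bsub>NNT.BCDA.conv\<^esub> face_N1 g \<otimes>\<^bsub>NNT.BCDA.conv\<^esub> face_N2 f) n m t
      = ((face_N0 f \<otimes>\<^bsub>NNT.BCDA.conv\<^esub> face_N1 g) n \<otimes>\<^bsub>?R\<^esub> NT.curried f) m t"
    unfolding face_N2_def NNT.BCDA.conv_mult_const[OF NNT.BCDA.conv_closures(4)[OF face_N0_cl
        face_N1_cl] F n] ..
  also have "\<dots> = sweedler K N A (\<lambda>n\<^sub>1 n\<^sub>2. (face_N0 f n\<^sub>1 \<otimes>\<^bsub>?R\<^esub> face_N1 g n\<^sub>2 \<otimes>\<^bsub>?R\<^esub> NT.curried f) m t) n"
    unfolding NNT.BCDA.conv_apply(4)[OF n]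
    by (rule N.linear_map_sweedler[OF NT.CDA.module_conv A.module lin _ n])
      (intro NNT.BCDA.bilinear_mult_maps NNT.BCDA.conv_linear face_N0_cl face_N1_cl)
  also have "\<dots> = sweedler K N A (\<lambda>n\<^sub>1 n\<^sub>2. sweedler3 K N A (\<lambda>m\<^sub>1 m\<^sub>2 m\<^sub>3. sweedler3 K T A (\<lambda>t\<^sub>1 t\<^sub>2 t\<^sub>3.
        face_N0 f n\<^sub>1 m\<^sub>1 t\<^sub>1 \<otimes>\<^bsub>A\<^esub> face_N1 g n\<^sub>2 m\<^sub>2 t\<^sub>2 \<otimes>\<^bsub>A\<^esub> NT.curried f m\<^sub>3 t\<^sub>3) t) m) n"
    by (intro sweedler_cong NT.conv2_mult3_apply NNT.BCDA.conv_closed face_N0_cl face_N1_cl F m t)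
  also have "\<dots> = sweedler K N A (\<lambda>n\<^sub>1 n\<^sub>2. sweedler3 K N A (\<lambda>m\<^sub>1 m\<^sub>2 m\<^sub>3. sweedler3 K T A (\<lambda>t\<^sub>1 t\<^sub>2 t\<^sub>3.
        f (tens n\<^sub>1 (m\<^sub>1 \<triangleright> t\<^sub>1)) \<otimes>\<^bsub>A\<^esub> g (tens (n\<^sub>2 \<otimes>\<^bsub>N\<^esub> m\<^sub>2) t\<^sub>2) \<otimes>\<^bsub>A\<^esub> f (tens m\<^sub>3 t\<^sub>3)) t) m) n"
    unfolding sweedler3_def by (intro sweedler_cong) (simp add: face_N0_def face_N1_def
        NT.curried_apply)
  finally show ?thesis .
qed

lemma face_T_cocycle_apply:
  assumes f: "f \<in> carrier M" and g: "g \<in> carrier M"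
    and n: "n \<in> carrier N" and t: "t \<in> carrier T" and s: "s \<in> carrier T"
  shows "(face_T0 f \<otimes>\<^bsub>NTT.BCDA.conv\<^esub> face_T1 g \<otimes>\<^bsub>NTT.BCDA.conv\<^esub> face_T2 f) n t s
    = sweedler3 K N A (\<lambda>n\<^sub>1 n\<^sub>2 n\<^sub>3. sweedler3 K T A (\<lambda>t\<^sub>1 t\<^sub>2 t\<^sub>3. sweedler K T A (\<lambda>s\<^sub>1 s\<^sub>2.
        f (tens (n\<^sub>1 \<triangleleft> t\<^sub>1) s\<^sub>1) \<otimes>\<^bsub>A\<^esub> g (tens n\<^sub>2 (t\<^sub>2 \<otimes>\<^bsub>T\<^esub> s\<^sub>2)) \<otimes>\<^bsub>A\<^esub> f (tens n\<^sub>3 t\<^sub>3)) s) t) n"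
proof -
  have face_T0_cl: "face_T0 f \<in> carrier NTT.BCDA.conv" by (rule unital_homD(1)[OF face_T0_hom f])
  have face_T1_cl: "face_T1 g \<in> carrier NTT.BCDA.conv" by (rule unital_homD(1)[OF face_T1_hom g])
  have face_T2_cl: "face_T2 f \<in> carrier NTT.BCDA.conv" by (rule unital_homD(1)[OF face_T2_hom f])
  show ?thesis
    unfolding NTT.conv3_mult3_apply[OF face_T0_cl face_T1_cl face_T2_cl n t s] sweedler3_def[of K N]
        sweedler3_def[of K T A _ t]
      sweedler3_def[of K T _ _ t]
  proof (intro sweedler_cong)
    fix n\<^sub>1 n\<^sub>2 n\<^sub>3 t\<^sub>1 t\<^sub>2 t\<^sub>3 assume nt: "n\<^sub>1 \<in> carrier N" "n\<^sub>2 \<in> carrier N" "n\<^sub>3 \<in> carrier N"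
      "t\<^sub>1 \<in> carrier T" "t\<^sub>2 \<in> carrier T" "t\<^sub>3 \<in> carrier T"
    have F: "face_T0 f n\<^sub>1 t\<^sub>1 \<in> carrier NT.DA.conv" and G: "face_T1 g n\<^sub>2 t\<^sub>2 \<in> carrier NT.DA.conv"
      and a: "f (tens n\<^sub>3 t\<^sub>3) \<in> carrier A"
      using nt by (auto intro!: NTT.CDA.CDA.conv_closed NTT.BCDA.conv_closed face_T0_cl face_T1_cl
          NT.M_closed[OF f])
    have "sweedler3 K T A (\<lambda>s\<^sub>1 s\<^sub>2 s\<^sub>3. face_T0 f n\<^sub>1 t\<^sub>1 s\<^sub>1 \<otimes>\<^bsub>A\<^esub> face_T1 g n\<^sub>2 t\<^sub>2 s\<^sub>2 \<otimes>\<^bsub>A\<^esub> face_T2 f n\<^sub>3 t\<^sub>3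
        s\<^sub>3) s
        = (face_T0 f n\<^sub>1 t\<^sub>1 \<otimes>\<^bsub>NT.DA.conv\<^esub> face_T1 g n\<^sub>2 t\<^sub>2 \<otimes>\<^bsub>NT.DA.conv\<^esub> convolution_const T A (f (tens n\<^sub>3
            t\<^sub>3))) s"
      using nt by (simp add: NT.DA.conv_mult3_apply[OF F G NT.DA.conv_const_closed[OF a] s]
          face_T2_def)
    also have "\<dots> = (face_T0 f n\<^sub>1 t\<^sub>1 \<otimes>\<^bsub>NT.DA.conv\<^esub> face_T1 g n\<^sub>2 t\<^sub>2) s \<otimes>\<^bsub>A\<^esub> f (tens n\<^sub>3 t\<^sub>3)"
      by (intro NT.DA.conv_mult_const NT.DA.conv_closures(4) F G a s)
    also have "\<dots> = sweedler K T A (\<lambda>s\<^sub>1 s\<^sub>2. face_T0 f n\<^sub>1 t\<^sub>1 s\<^sub>1 \<otimes>\<^bsub>A\<^esub> face_T1 g n\<^sub>2 t\<^sub>2 s\<^sub>2 \<otimes>\<^bsub>A\<^esub> f (tens n\<^sub>3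
        t\<^sub>3)) s"
      unfolding NT.DA.conv_apply(4)[OF s]
      by (rule T.linear_map_sweedler[OF A.module A.module NT.DA.linear_mult_left[OF linear_map_id a]
          _ s])
        (intro NT.DA.bilinear_mult_maps NT.DA.conv_linear F G)
    also have "\<dots> = sweedler K T A (\<lambda>s\<^sub>1 s\<^sub>2.
        f (tens (n\<^sub>1 \<triangleleft> t\<^sub>1) s\<^sub>1) \<otimes>\<^bsub>A\<^esub> g (tens n\<^sub>2 (t\<^sub>2 \<otimes>\<^bsub>T\<^esub> s\<^sub>2)) \<otimes>\<^bsub>A\<^esub> f (tens n\<^sub>3 t\<^sub>3)) s"
      using nt by (intro sweedler_cong) (simp add: face_T0_def face_T1_def)
    finally show "sweedler3 K T A (\<lambda>s\<^sub>1 s\<^sub>2 s\<^sub>3. face_T0 f n\<^sub>1 t\<^sub>1 s\<^sub>1 \<otimes>\<^bsub>A\<^esub> face_T1 g n\<^sub>2 t\<^sub>2 s\<^sub>2 \<otimes>\<^bsub>A\<^esub> face_T2 f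
        n\<^sub>3 t\<^sub>3 s\<^sub>3) s
      = sweedler K T A (\<lambda>s\<^sub>1 s\<^sub>2.
        f (tens (n\<^sub>1 \<triangleleft> t\<^sub>1) s\<^sub>1) \<otimes>\<^bsub>A\<^esub> g (tens n\<^sub>2 (t\<^sub>2 \<otimes>\<^bsub>T\<^esub> s\<^sub>2)) \<otimes>\<^bsub>A\<^esub> f (tens n\<^sub>3 t\<^sub>3)) s" .
  qed
qed

lemma comm_monoids: "comm_monoid NNT.BCDA.conv" "comm_monoid NTT.BCDA.conv"
  using NNT.BCDA.algebra_conv NTT.BCDA.algebra_conv
  by (auto simp: algebra_def cring_def)

lemma skew_bimeasurings_eq:
  "skew_bimeasurings K N T \<mu> \<nu> A = {f \<in> carrier M. normalized K N T A f \<and>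
     face_N0 f \<otimes>\<^bsub>NNT.BCDA.conv\<^esub> face_N2 f = face_N1 f \<and> face_T0 f \<otimes>\<^bsub>NTT.BCDA.conv\<^esub> face_T2 f = face_T1
         f}"
proof -
  have p: "face_N0 f \<otimes>\<^bsub>NNT.BCDA.conv\<^esub> face_N2 f = face_N1 f \<longleftrightarrow>
      (\<forall>n \<in> carrier N. \<forall>m \<in> carrier N. \<forall>t \<in> carrier T. f (tens (n \<otimes>\<^bsub>N\<^esub> m) t) =
         sweedler K N A (\<lambda>m\<^sub>1 m\<^sub>2. sweedler K T A
           (\<lambda>t\<^sub>1 t\<^sub>2. f (tens n (m\<^sub>1 \<triangleright> t\<^sub>1)) \<otimes>\<^bsub>A\<^esub> f (tens m\<^sub>2 t\<^sub>2)) t) m)" (is "?l \<longleftrightarrow> ?r") if f: "f \<in> carrier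
               M" for f
  proof -
    have "?l \<longleftrightarrow> (\<forall>n \<in> carrier N. \<forall>m \<in> carrier N. \<forall>t \<in> carrier T.
        (face_N0 f \<otimes>\<^bsub>NNT.BCDA.conv\<^esub> face_N2 f) n m t = face_N1 f n m t)"
      using NNT.conv3_eqI[OF NNT.BCDA.conv_closures(4)[OF unital_homD(1)[OF face_N0_hom f]
          unital_homD(1)[OF face_N2_hom f]] unital_homD(1)[OF face_N1_hom f]] by auto
    also have "\<dots> \<longleftrightarrow> ?r"
      by (intro ball_cong HOL.refl) (auto simp: face_N_mult_apply[OF f] face_N1_def)
    finally show ?thesis .
  qed
  have q: "face_T0 f \<otimes>\<^bsub>NTT.BCDA.conv\<^esub> face_T2 f = face_T1 f \<longleftrightarrow>
      (\<forall>n \<in> carrier N. \<forall>t \<in> carrier T. \<forall>s \<in> carrier T. f (tens n (t \<otimes>\<^bsub>T\<^esub> s)) =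
         sweedler K N A (\<lambda>n\<^sub>1 n\<^sub>2. sweedler K T A
           (\<lambda>t\<^sub>1 t\<^sub>2. f (tens (n\<^sub>1 \<triangleleft> t\<^sub>1) s) \<otimes>\<^bsub>A\<^esub> f (tens n\<^sub>2 t\<^sub>2)) t) n)" (is "?l \<longleftrightarrow> ?r") if f: "f \<in> carrier
               M" for f
  proof -
    have "?l \<longleftrightarrow> (\<forall>n \<in> carrier N. \<forall>t \<in> carrier T. \<forall>s \<in> carrier T.
        (face_T0 f \<otimes>\<^bsub>NTT.BCDA.conv\<^esub> face_T2 f) n t s = face_T1 f n t s)"
      using NTT.conv3_eqI[OF NTT.BCDA.conv_closures(4)[OF unital_homD(1)[OF face_T0_hom f]
          unital_homD(1)[OF face_T2_hom f]] unital_homD(1)[OF face_T1_hom f]] by auto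
    also have "\<dots> \<longleftrightarrow> ?r"
      by (intro ball_cong HOL.refl) (auto simp: face_T_mult_apply[OF f] face_T1_def)
    finally show ?thesis .
  qed
  have M: "carrier M = Hom K (tensor K N T) A"
    by (simp add: convolution_monoid_def Hom_tensor_coalg)
  show ?thesis
    unfolding skew_bimeasurings_def Let_def M[symmetric] using p q by blast
qed

text \<open>The inverse of \<open>f\<close> is eliminated by means of \<open>face_N1(f\<^sup>-\<^sup>1) = face_N1(f)\<^sup>-\<^sup>1\<close>, and likewise for
  the faces in the direction of \<open>T\<close>.\<close>

lemma one_cocycles_eq:
  "one_cocycles K N T \<mu> \<nu> A = {f \<in> Units M. normalized K N T A f \<and>
     face_N0 f \<otimes>\<^bsub>NNT.BCDA.conv\<^esub> face_N2 f = face_N1 f \<and> face_T0 f \<otimes>\<^bsub>NTT.BCDA.conv\<^esub> face_T2 f = face_T1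
         f}"
proof -
  interpret M: comm_monoid M by (rule NT.comm_monoid_M)
  have p: "face_N0 f \<otimes>\<^bsub>NNT.BCDA.conv\<^esub> face_N2 f = face_N1 f \<longleftrightarrow>
      (\<forall>n \<in> carrier N. \<forall>m \<in> carrier N. \<forall>t \<in> carrier T.
        sweedler K N A (\<lambda>n\<^sub>1 n\<^sub>2. sweedler3 K N A (\<lambda>m\<^sub>1 m\<^sub>2 m\<^sub>3. sweedler3 K T A (\<lambda>t\<^sub>1 t\<^sub>2 t\<^sub>3.
          f (tens n\<^sub>1 (m\<^sub>1 \<triangleright> t\<^sub>1)) \<otimes>\<^bsub>A\<^esub> (inv\<^bsub>M\<^esub> f) (tens (n\<^sub>2 \<otimes>\<^bsub>N\<^esub> m\<^sub>2) t\<^sub>2) \<otimes>\<^bsub>A\<^esub> f (tens m\<^sub>3 t\<^sub>3)) t) m) n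
        = (counit N n \<otimes>\<^bsub>K\<^esub> counit N m \<otimes>\<^bsub>K\<^esub> counit T t) \<odot>\<^bsub>A\<^esub> \<one>\<^bsub>A\<^esub>)"
    (is "?l \<longleftrightarrow> ?r") if f: "f \<in> Units M" for f
  proof -
    let ?g = "inv\<^bsub>M\<^esub> f"
    have fg: "f \<in> carrier M" "?g \<in> carrier M" using f by auto
    note cl = unital_homD(1)[OF face_N0_hom fg(1)] unital_homD(1)[OF face_N1_hom fg(1)]
      unital_homD(1)[OF face_N1_hom fg(2)] unital_homD(1)[OF face_N2_hom fg(1)]
    have inv: "face_N1 f \<otimes>\<^bsub>NNT.BCDA.conv\<^esub> face_N1 ?g = \<one>\<^bsub>NNT.BCDA.conv\<^esub>"
      using f by (simp add: unital_homD(2)[OF face_N1_hom fg, symmetric] unital_homD(3)[OF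
          face_N1_hom])
    have "?l \<longleftrightarrow> face_N0 f \<otimes>\<^bsub>NNT.BCDA.conv\<^esub> face_N1 ?g \<otimes>\<^bsub>NNT.BCDA.conv\<^esub> face_N2 f = \<one>\<^bsub>NNT.BCDA.conv\<^esub>"
      by (rule comm_monoid.mult_inverse_middle_eq_one_iff[OF comm_monoids(1) cl inv, symmetric])
    also have "\<dots> \<longleftrightarrow> (\<forall>n \<in> carrier N. \<forall>m \<in> carrier N. \<forall>t \<in> carrier T.
        (face_N0 f \<otimes>\<^bsub>NNT.BCDA.conv\<^esub> face_N1 ?g \<otimes>\<^bsub>NNT.BCDA.conv\<^esub> face_N2 f) n m t = \<one>\<^bsub>NNT.BCDA.conv\<^esub> n m
            t)"
      using NNT.conv3_eqI[OF NNT.BCDA.conv_closures(4)[OF NNT.BCDA.conv_closures(4)[OF cl(1,3)]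
          cl(4)]
          NNT.BCDA.conv_closures(5)] by auto
    also have "\<dots> \<longleftrightarrow> ?r"
      by (intro ball_cong HOL.refl) (simp add: face_N_cocycle_apply[OF fg] NNT.conv3_one_apply)
    finally show ?thesis .
  qed
  have q: "face_T0 f \<otimes>\<^bsub>NTT.BCDA.conv\<^esub> face_T2 f = face_T1 f \<longleftrightarrow>
      (\<forall>n \<in> carrier N. \<forall>t \<in> carrier T. \<forall>s \<in> carrier T.
        sweedler3 K N A (\<lambda>n\<^sub>1 n\<^sub>2 n\<^sub>3. sweedler3 K T A (\<lambda>t\<^sub>1 t\<^sub>2 t\<^sub>3. sweedler K T A (\<lambda>s\<^sub>1 s\<^sub>2.
          f (tens (n\<^sub>1 \<triangleleft> t\<^sub>1) s\<^sub>1) \<otimes>\<^bsub>A\<^esub> (inv\<^bsub>M\<^esub> f) (tens n\<^sub>2 (t\<^sub>2 \<otimes>\<^bsub>T\<^esub> s\<^sub>2)) \<otimes>\<^bsub>A\<^esub> f (tens n\<^sub>3 t\<^sub>3)) s) t) n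
        = (counit N n \<otimes>\<^bsub>K\<^esub> counit T t \<otimes>\<^bsub>K\<^esub> counit T s) \<odot>\<^bsub>A\<^esub> \<one>\<^bsub>A\<^esub>)"
    (is "?l \<longleftrightarrow> ?r") if f: "f \<in> Units M" for f
  proof -
    let ?g = "inv\<^bsub>M\<^esub> f"
    have fg: "f \<in> carrier M" "?g \<in> carrier M" using f by auto
    note cl = unital_homD(1)[OF face_T0_hom fg(1)] unital_homD(1)[OF face_T1_hom fg(1)]
      unital_homD(1)[OF face_T1_hom fg(2)] unital_homD(1)[OF face_T2_hom fg(1)]
    have inv: "face_T1 f \<otimes>\<^bsub>NTT.BCDA.conv\<^esub> face_T1 ?g = \<one>\<^bsub>NTT.BCDA.conv\<^esub>"
      using f by (simp add: unital_homD(2)[OF face_T1_hom fg, symmetric] unital_homD(3)[OF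
          face_T1_hom])
    have "?l \<longleftrightarrow> face_T0 f \<otimes>\<^bsub>NTT.BCDA.conv\<^esub> face_T1 ?g \<otimes>\<^bsub>NTT.BCDA.conv\<^esub> face_T2 f = \<one>\<^bsub>NTT.BCDA.conv\<^esub>"
      by (rule comm_monoid.mult_inverse_middle_eq_one_iff[OF comm_monoids(2) cl inv, symmetric])
    also have "\<dots> \<longleftrightarrow> (\<forall>n \<in> carrier N. \<forall>t \<in> carrier T. \<forall>s \<in> carrier T.
        (face_T0 f \<otimes>\<^bsub>NTT.BCDA.conv\<^esub> face_T1 ?g \<otimes>\<^bsub>NTT.BCDA.conv\<^esub> face_T2 f) n t s = \<one>\<^bsub>NTT.BCDA.conv\<^esub> n t
            s)"
      using NTT.conv3_eqI[OF NTT.BCDA.conv_closures(4)[OF NTT.BCDA.conv_closures(4)[OF cl(1,3)]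
          cl(4)]
          NTT.BCDA.conv_closures(5)] by auto
    also have "\<dots> \<longleftrightarrow> ?r"
      by (intro ball_cong HOL.refl) (simp add: face_T_cocycle_apply[OF fg] NTT.conv3_one_apply)
    finally show ?thesis .
  qed
  show ?thesis
    unfolding one_cocycles_def Reg_plus_def Let_def using p q by blast
qed

text \<open>Normalization says that \<open>f\<close> restricts to \<open>\<epsilon>\<close> along the coalgebra maps \<open>t \<mapsto> 1 \<otimes> t\<close> and
  \<open>n \<mapsto> n \<otimes> 1\<close>; hence it is a condition of the same kind as the others, on values of
  homomorphisms.\<close>

lemma normalization_homs:
  shows "(\<lambda>f. \<lambda>t \<in> carrier T. f (tens \<one>\<^bsub>N\<^esub> t)) \<in> unital_hom M (convolution_algebra K T A)" (is "?e \<in>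
      _")
    and "(\<lambda>f. \<lambda>n \<in> carrier N. f (tens n \<one>\<^bsub>T\<^esub>)) \<in> unital_hom M (convolution_algebra K N A)" (is "?e' \<in>
        _")
proof -
  interpret NA: convolution K N A by unfold_locales
  show "?e \<in> unital_hom M NT.DA.conv"
  proof (rule unital_homI)
    fix f assume f: "f \<in> carrier M"
    show cl: "?e f \<in> carrier NT.DA.conv"
      unfolding NT.DA.restrict_conv_iff
      by (intro linear_map_compose[OF NT.M_linear[OF f]] tens_linear N.one_closed)
    fix g assume g: "g \<in> carrier M"
    note F = NT.M_bilinear[OF f g]
    show "?e (f \<otimes>\<^bsub>M\<^esub> g) = ?e f \<otimes>\<^bsub>NT.DA.conv\<^esub> ?e g"
      unfolding NT.DA.conv_restrict
    proof (rule restrict_ext)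
      fix t assume t: "t \<in> carrier T"
      have "(f \<otimes>\<^bsub>M\<^esub> g) (tens \<one>\<^bsub>N\<^esub> t)
          = sweedler K T A (\<lambda>t\<^sub>1 t\<^sub>2. f (tens \<one>\<^bsub>N\<^esub> t\<^sub>1) \<otimes>\<^bsub>A\<^esub> g (tens \<one>\<^bsub>N\<^esub> t\<^sub>2)) t"
        unfolding NT.M_mult_pure[OF f g N.one_closed t]
        by (rule N.sweedler_one[OF A.module
            NT.CD.bilinear_sweedler_inner[OF A.module bilinear_tens[OF F] t]])
      also have "\<dots> = sweedler K T A (\<lambda>t\<^sub>1 t\<^sub>2. ?e f t\<^sub>1 \<otimes>\<^bsub>A\<^esub> ?e g t\<^sub>2) t"
        by (rule sweedler_cong) simp
      finally show "(f \<otimes>\<^bsub>M\<^esub> g) (tens \<one>\<^bsub>N\<^esub> t)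
          = sweedler K T A (\<lambda>t\<^sub>1 t\<^sub>2. ?e f t\<^sub>1 \<otimes>\<^bsub>A\<^esub> ?e g t\<^sub>2) t" .
    qed
  qed (auto simp: NT.DA.conv_restrict convolution_const_def NT.M_one_pure N.counit_one intro!:
      restrict_ext)
  show "?e' \<in> unital_hom M NA.conv"
  proof (rule unital_homI)
    fix f assume f: "f \<in> carrier M"
    show cl: "?e' f \<in> carrier NA.conv"
      unfolding NA.restrict_conv_iff
      by (intro linear_map_compose[OF NT.M_linear[OF f]] tens_linear T.one_closed)
    fix g assume g: "g \<in> carrier M"
    note F = NT.M_bilinear[OF f g]
    show "?e' (f \<otimes>\<^bsub>M\<^esub> g) = ?e' f \<otimes>\<^bsub>NA.conv\<^esub> ?e' g"
      unfolding NA.conv_restrict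
    proof (rule restrict_ext)
      fix n assume n: "n \<in> carrier N"
      show "(f \<otimes>\<^bsub>M\<^esub> g) (tens n \<one>\<^bsub>T\<^esub>)
          = sweedler K N A (\<lambda>n\<^sub>1 n\<^sub>2. ?e' f n\<^sub>1 \<otimes>\<^bsub>A\<^esub> ?e' g n\<^sub>2) n"
        unfolding NT.M_mult_pure[OF f g n T.one_closed]
        by (rule sweedler_cong) (simp add: T.sweedler_one[OF A.module bilinear_tens(1)[OF F]])
    qed
  qed (auto simp: NA.conv_restrict convolution_const_def NT.M_one_pure T.counit_one intro!:
      restrict_ext)
qed

lemma restrict_eq_iff: "restrict f S = restrict g S \<longleftrightarrow> (\<forall>x \<in> S. f x = g x)"
  by (auto simp: restrict_def fun_eq_iff)

lemma normalized_iff: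
  "normalized K N T A f \<longleftrightarrow>
    (\<lambda>t \<in> carrier T. f (tens \<one>\<^bsub>N\<^esub> t)) = \<one>\<^bsub>convolution_algebra K T A\<^esub> \<and>
    (\<lambda>n \<in> carrier N. f (tens n \<one>\<^bsub>T\<^esub>)) = \<one>\<^bsub>convolution_algebra K N A\<^esub>"
  by (simp add: normalized_def convolution_algebra_def convolution_monoid_def restrict_eq_iff)

lemma subgroup_one_cocycles: "subgroup (one_cocycles K N T \<mu> \<nu> A) (units_of M)"
proof -
  interpret M: comm_monoid M by (rule NT.comm_monoid_M)
  interpret U: group "units_of M" by (rule M.units_group)
  interpret NA: convolution K N A by unfold_locales
  have cm: "comm_monoid NT.DA.conv" "comm_monoid NA.conv"
    using NT.DA.algebra_conv NA.algebra_conv by (auto simp: algebra_def cring_def)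
  note one = unital_hom_one[OF comm_monoid.axioms(1)]
  have eq: "one_cocycles K N T \<mu> \<nu> A =
     {f \<in> Units M. (\<lambda>t \<in> carrier T. f (tens \<one>\<^bsub>N\<^esub> t)) = \<one>\<^bsub>NT.DA.conv\<^esub>} \<inter>
     {f \<in> Units M. (\<lambda>n \<in> carrier N. f (tens n \<one>\<^bsub>T\<^esub>)) = \<one>\<^bsub>NA.conv\<^esub>} \<inter>
     {f \<in> Units M. face_N0 f \<otimes>\<^bsub>NNT.BCDA.conv\<^esub> face_N2 f = face_N1 f} \<inter>
     {f \<in> Units M. face_T0 f \<otimes>\<^bsub>NTT.BCDA.conv\<^esub> face_T2 f = face_T1 f}"
    unfolding one_cocycles_eq normalized_iff by blast
  show ?thesis
    unfolding eq
    by (intro U.subgroups_Inter_pair equalizer_subgroup[OF NT.comm_monoid_M cm(1)]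
        equalizer_subgroup[OF NT.comm_monoid_M cm(2)]
        equalizer_subgroup[OF NT.comm_monoid_M comm_monoids(1)]
        equalizer_subgroup[OF NT.comm_monoid_M comm_monoids(2)]
        unital_hom_mult comm_monoids face_N0_hom face_N1_hom face_N2_hom face_T0_hom face_T1_hom
            face_T2_hom
        normalization_homs one cm)
qed

text \<open>The inverse is \<open>n \<otimes> t \<mapsto> f(S(n\<^sub>1), n\<^sub>2(t))\<close>. By coassociativity and the first equation of a
  skew bimeasuring, \<open>f(S(n\<^sub>1), n\<^sub>2(t\<^sub>1)) f(n\<^sub>3, t\<^sub>2) = f(S(n\<^sub>1) n\<^sub>2, t) = \<epsilon>(n) f(1, t) = \<epsilon>(n) \<epsilon>(t) 1\<close>.
  The calculation takes place in \<open>Hom(N, Hom(T, A))\<close>, with \<open>t\<close> kept inside the values for as long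
  as possible: then coassociativity of \<open>N\<close> applies directly, without an interchange of sums.\<close>

lemma skew_bimeasuring_invertible:
  assumes f: "f \<in> skew_bimeasurings K N T \<mu> \<nu> A"
  shows "f \<in> Units M"
proof -
  interpret M: comm_monoid M by (rule NT.comm_monoid_M)
  let ?R = NT.CDA.conv
  let ?F = "NT.curried f"
  have fM: "f \<in> carrier M" and f_one: "\<And>t. t \<in> carrier T \<Longrightarrow> f (tens \<one>\<^bsub>N\<^esub> t) = counit T t \<odot>\<^bsub>A\<^esub> \<one>\<^bsub>A\<^esub>"
    using f by (auto simp: skew_bimeasurings_eq normalized_def)
  have f_mult: "f (tens (n \<otimes>\<^bsub>N\<^esub> m) t) = sweedler K N A (\<lambda>m\<^sub>1 m\<^sub>2. sweedler K T A
      (\<lambda>t\<^sub>1 t\<^sub>2. f (tens n (m\<^sub>1 \<triangleright> t\<^sub>1)) \<otimes>\<^bsub>A\<^esub> f (tens m\<^sub>2 t\<^sub>2)) t) m"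
    if "n \<in> carrier N" "m \<in> carrier N" "t \<in> carrier T" for n m t
    using f that by (simp add: skew_bimeasurings_def Let_def)
  note F = NT.curried_closed[OF fM]
  obtain S where S: "linear_map K N N S"
    and S_left: "\<And>n. n \<in> carrier N \<Longrightarrow>
      sweedler K N N (\<lambda>n\<^sub>1 n\<^sub>2. S n\<^sub>1 \<otimes>\<^bsub>N\<^esub> n\<^sub>2) n = counit N n \<odot>\<^bsub>N\<^esub> \<one>\<^bsub>N\<^esub>"
    using N.antipode by blast
  note S_cl = linear_map_closed[OF S]
  \<comment> \<open>The summand of the candidate for the inverse, as a function of the two tensor factors of
      \<open>\<Delta>(n)\<close>.\<close>
  define G where "G = (\<lambda>a b. \<lambda>t \<in> carrier T. f (tens (S a) (b \<triangleright> t)))"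
  have G: "bilinear_map K N N NT.DA.conv G"
    unfolding G_def
  proof (rule bilinear_mapI; rule NT.DA.linear_map_into_conv)
    fix a assume a: "a \<in> carrier N"
    show "bilinear_map K N T A (\<lambda>b t. f (tens (S a) (b \<triangleright> t)))"
      by (intro linear_map_comp_bilinear[OF NT.M_linear[OF fM]]
          linear_map_comp_bilinear[OF tens_linear(2)] bilinear_actions S_cl a)
  next
    fix b assume b: "b \<in> carrier N"
    show "bilinear_map K N T A (\<lambda>a t. f (tens (S a) (b \<triangleright> t)))"
      by (intro linear_map_comp_bilinear[OF NT.M_linear[OF fM]]
          bilinear_map_pullback[OF NT.CD.bilinear_pure S] act_T_linear b)
  qed
  note G_cl = bilinear_map_closed[OF G]
  define F' where "F' = (\<lambda>n \<in> carrier N. sweedler K N NT.DA.conv G n)"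
  have F': "F' \<in> carrier ?R"
    unfolding F'_def NT.CDA.restrict_conv_iff by (rule N.sweedler_linear[OF NT.DA.module_conv G])
  have inner: "sweedler K N NT.DA.conv (\<lambda>b c. G a b \<otimes>\<^bsub>NT.DA.conv\<^esub> ?F c) w = ?F (S a \<otimes>\<^bsub>N\<^esub> w)"
    if a: "a \<in> carrier N" and w: "w \<in> carrier N" for a w
  proof (rule NT.DA.conv_eqI)
    have bil: "bilinear_map K N N NT.DA.conv (\<lambda>b c. G a b \<otimes>\<^bsub>NT.DA.conv\<^esub> ?F c)"
      by (intro NT.CDA.bilinear_mult_maps bilinear_map_linear(1)[OF G] a NT.CDA.conv_linear F)
    show "sweedler K N NT.DA.conv (\<lambda>b c. G a b \<otimes>\<^bsub>NT.DA.conv\<^esub> ?F c) w \<in> carrier NT.DA.conv"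
      by (rule N.sweedler_closed[OF NT.DA.module_conv bil w])
    show "?F (S a \<otimes>\<^bsub>N\<^esub> w) \<in> carrier NT.DA.conv"
      by (intro NT.CDA.conv_closed[OF F] N.m_closed S_cl a w)
    fix t assume t: "t \<in> carrier T"
    have "sweedler K N NT.DA.conv (\<lambda>b c. G a b \<otimes>\<^bsub>NT.DA.conv\<^esub> ?F c) w t
        = sweedler K N A (\<lambda>b c. (G a b \<otimes>\<^bsub>NT.DA.conv\<^esub> ?F c) t) w"
      by (rule N.linear_map_sweedler[OF NT.DA.module_conv A.module NT.DA.linear_map_eval[OF t] bil
          w])
    also have "\<dots> = sweedler K N A (\<lambda>b c. sweedler K T A
        (\<lambda>t\<^sub>1 t\<^sub>2. f (tens (S a) (b \<triangleright> t\<^sub>1)) \<otimes>\<^bsub>A\<^esub> f (tens c t\<^sub>2)) t) w"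
      unfolding NT.DA.conv_apply(4)[OF t]
      by (intro sweedler_cong) (simp add: G_def NT.curried_apply)
    also have "\<dots> = ?F (S a \<otimes>\<^bsub>N\<^esub> w) t"
      using a w t by (simp add: f_mult S_cl NT.curried_apply)
    finally show "sweedler K N NT.DA.conv (\<lambda>b c. G a b \<otimes>\<^bsub>NT.DA.conv\<^esub> ?F c) w t
        = ?F (S a \<otimes>\<^bsub>N\<^esub> w) t" .
  qed
  have "F' \<otimes>\<^bsub>?R\<^esub> ?F = \<one>\<^bsub>?R\<^esub>"
  proof (rule NT.CDA.conv_eqI[OF NT.CDA.conv_closures(4)[OF F' F] NT.CDA.conv_closures(5)])
    fix n assume n: "n \<in> carrier N"
    have "(F' \<otimes>\<^bsub>?R\<^esub> ?F) n
        = sweedler3 K N NT.DA.conv (\<lambda>a b c. G a b \<otimes>\<^bsub>NT.DA.conv\<^esub> ?F c) n"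
      unfolding NT.CDA.conv_apply(4)[OF n] sweedler3_def
    proof (rule sweedler_cong)
      fix x c assume x: "x \<in> carrier N" and c: "c \<in> carrier N"
      show "F' x \<otimes>\<^bsub>NT.DA.conv\<^esub> ?F c
          = sweedler K N NT.DA.conv (\<lambda>a b. G a b \<otimes>\<^bsub>NT.DA.conv\<^esub> ?F c) x"
        using x N.linear_map_sweedler[OF NT.DA.module_conv NT.DA.module_conv
          NT.CDA.linear_mult_left[OF linear_map_id NT.CDA.conv_closed[OF F c]] G x]
        by (simp add: F'_def)
    qed
    also have "\<dots> = sweedler K N NT.DA.conv (\<lambda>a w. sweedler K N NT.DA.conv
        (\<lambda>b c. G a b \<otimes>\<^bsub>NT.DA.conv\<^esub> ?F c) w) n"
      by (rule N.sweedler3_coassoc[where B = "\<lambda>a b c. G a b \<otimes>\<^bsub>NT.DA.conv\<^esub> ?F c",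
          OF NT.DA.module_conv NT.CDA.linear_mult_left[OF bilinear_map_linear(2)[OF G]
              NT.CDA.conv_closed[OF F]]
          NT.CDA.linear_mult_left[OF bilinear_map_linear(1)[OF G] NT.CDA.conv_closed[OF F]]
          NT.CDA.linear_mult_right[OF NT.CDA.conv_linear[OF F] G_cl] n])
    also have "\<dots> = sweedler K N NT.DA.conv (\<lambda>a w. ?F (S a \<otimes>\<^bsub>N\<^esub> w)) n"
      by (rule sweedler_cong) (rule inner)
    also have "\<dots> = ?F (sweedler K N N (\<lambda>a w. S a \<otimes>\<^bsub>N\<^esub> w) n)"
      by (rule N.linear_map_sweedler[OF N.module_C NT.DA.module_conv NT.CDA.conv_linear[OF F]
          bilinear_map_pullback[OF N.bilinear_product S linear_map_id] n, symmetric])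
    also have "\<dots> = counit N n \<odot>\<^bsub>NT.DA.conv\<^esub> ?F \<one>\<^bsub>N\<^esub>"
      using n by (simp add: S_left linear_map_smult[OF NT.CDA.conv_linear[OF F]])
    finally have "(F' \<otimes>\<^bsub>?R\<^esub> ?F) n = counit N n \<odot>\<^bsub>NT.DA.conv\<^esub> ?F \<one>\<^bsub>N\<^esub>" .
    moreover have "?F \<one>\<^bsub>N\<^esub> = \<one>\<^bsub>NT.DA.conv\<^esub>"
      by (rule NT.DA.conv_eqI[OF NT.CDA.conv_closed[OF F N.one_closed] NT.DA.conv_closures(5)])
        (simp add: NT.curried_apply f_one NT.DA.conv_apply)
    ultimately show "(F' \<otimes>\<^bsub>?R\<^esub> ?F) n = \<one>\<^bsub>?R\<^esub> n"
      by (simp add: NT.CDA.conv_apply(5)[OF n])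
  qed
  moreover obtain g where g: "g \<in> carrier M" "NT.curried g = F'"
    using NT.curried_surj[OF F'] .
  ultimately have "g \<otimes>\<^bsub>M\<^esub> f = \<one>\<^bsub>M\<^esub>"
    by (intro NT.curried_eqD) (simp_all add: NT.curried_mult NT.curried_one fM)
  then show ?thesis
    using g fM M.m_comm[OF fM g(1)] by (auto simp: Units_def)
qed

theorem skew_bimeasurings_eq_one_cocycles:
  "skew_bimeasurings K N T \<mu> \<nu> A = one_cocycles K N T \<mu> \<nu> A"
  using skew_bimeasuring_invertible
  unfolding skew_bimeasurings_eq one_cocycles_eq by (auto simp: Units_def)

end

section \<open>The trivial matched pair\<close>

lemma (in module) smult_commute:
  "a \<in> carrier R \<Longrightarrow> b \<in> carrier R \<Longrightarrow> x \<in> carrier M \<Longrightarrow> a \<odot>\<^bsub>M\<^esub> (b \<odot>\<^bsub>M\<^esub> x) = b \<odot>\<^bsub>M\<^esub> (a \<odot>\<^bsub>M\<^esub> x)"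
  by (metis smult_assoc1 R.m_comm)

lemma (in coalgebra) counit_counit:
  assumes P: "module K P" and p: "p \<in> carrier P" and c: "c \<in> carrier C"
  shows "sweedler K C P (\<lambda>x y. counit C x \<odot>\<^bsub>P\<^esub> (counit C y \<odot>\<^bsub>P\<^esub> p)) c = counit C c \<odot>\<^bsub>P\<^esub> p"
  by (rule counit_left_linear[OF P linear_map_compose[OF linear_map_smult_left[OF P p]
      counit_linear] c])

lemma (in coalgebra) counit_smult:
  "a \<in> carrier K \<Longrightarrow> c \<in> carrier C \<Longrightarrow> counit C (a \<odot>\<^bsub>C\<^esub> c) = a \<otimes>\<^bsub>K\<^esub> counit C c"
  using linear_map_smult[OF counit_linear] by simp

locale hopf_pair =
  N: cocommutative_hopf_algebra K N + T: cocommutative_hopf_algebra K T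
  for K (structure) and N and T
begin

sublocale NT: two_coalgebras K N T ..

abbreviation tens where "tens \<equiv> pure_tensor K N T"
abbreviation \<epsilon>\<^sub>N where "\<epsilon>\<^sub>N \<equiv> counit N"
abbreviation \<epsilon>\<^sub>T where "\<epsilon>\<^sub>T \<equiv> counit T"

lemma bilinear_trivial:
  "bilinear_map K N T N (\<lambda>n t. \<epsilon>\<^sub>T t \<odot>\<^bsub>N\<^esub> n)" "bilinear_map K N T T (\<lambda>n t. \<epsilon>\<^sub>N n \<odot>\<^bsub>T\<^esub> t)"
  by (rule bilinear_map_flip[OF bilinear_functional_smult[OF N.module_C T.counit_linear
      linear_map_id]]
      bilinear_functional_smult[OF T.module_C N.counit_linear linear_map_id])+

lemma trivial_pure:
  assumes "n \<in> carrier N" "t \<in> carrier T"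
  shows "trivial_\<mu> K N T (tens n t) = \<epsilon>\<^sub>T t \<odot>\<^bsub>N\<^esub> n" "trivial_\<nu> K N T (tens n t) = \<epsilon>\<^sub>N n \<odot>\<^bsub>T\<^esub> t"
  using NT.tensor_lift(2)[OF N.module_C bilinear_trivial(1) assms]
    NT.tensor_lift(2)[OF T.module_C bilinear_trivial(2) assms]
  by (simp_all add: trivial_\<mu>_def trivial_\<nu>_def)

lemma linear_trivial:
  "linear_map K (tensor K N T) N (trivial_\<mu> K N T)" "linear_map K (tensor K N T) T (trivial_\<nu> K N
      T)"
  unfolding trivial_\<mu>_def trivial_\<nu>_def
  by (rule NT.linear_map_tensor_lift[OF _ bilinear_trivial(1)] NT.linear_map_tensor_lift[OF _
      bilinear_trivial(2)],
      rule N.module_C T.module_C)+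

lemma trivial_\<mu>_coalgebra_map: "coalgebra_map K (tensor_coalg K N T) N (trivial_\<mu> K N T)"
proof (rule NT.coalgebra_mapI[OF N.coalgebra_axioms linear_trivial(1)])
  interpret NN: two_modules K N N ..
  interpret P: module K "tensor K N N" by (rule NN.module_tensor)
  fix n t assume n: "n \<in> carrier N" and t: "t \<in> carrier T"
  let ?\<mu> = "trivial_\<mu> K N T" and ?P = "tensor K N N" and ?pure = "pure_tensor K N N"
  have inner: "sweedler K T ?P (\<lambda>t\<^sub>1 t\<^sub>2. ?pure (?\<mu> (tens n\<^sub>1 t\<^sub>1)) (?\<mu> (tens n\<^sub>2 t\<^sub>2))) t
      = \<epsilon>\<^sub>T t \<odot>\<^bsub>?P\<^esub> ?pure n\<^sub>1 n\<^sub>2" if n12: "n\<^sub>1 \<in> carrier N" "n\<^sub>2 \<in> carrier N" for n\<^sub>1 n\<^sub>2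
  proof -
    have "sweedler K T ?P (\<lambda>t\<^sub>1 t\<^sub>2. ?pure (?\<mu> (tens n\<^sub>1 t\<^sub>1)) (?\<mu> (tens n\<^sub>2 t\<^sub>2))) t
        = sweedler K T ?P (\<lambda>t\<^sub>1 t\<^sub>2. \<epsilon>\<^sub>T t\<^sub>1 \<odot>\<^bsub>?P\<^esub> (\<epsilon>\<^sub>T t\<^sub>2 \<odot>\<^bsub>?P\<^esub> ?pure n\<^sub>1 n\<^sub>2)) t"
      using n12 by (intro sweedler_cong)
        (simp add: trivial_pure linear_map_smult[OF NN.linear_map_pure(1)] linear_map_smult[OF
            NN.linear_map_pure(2)]
          P.smult_commute)
    also have "\<dots> = \<epsilon>\<^sub>T t \<odot>\<^bsub>?P\<^esub> ?pure n\<^sub>1 n\<^sub>2"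
      using n12 by (intro T.counit_counit[OF NN.module_tensor _ t]) simp
    finally show ?thesis .
  qed
  have "comult N (?\<mu> (tens n t)) = \<epsilon>\<^sub>T t \<odot>\<^bsub>?P\<^esub> comult N n"
    using n t by (simp add: trivial_pure linear_map_smult[OF N.comult_linear])
  also have "\<dots> = sweedler K N ?P (\<lambda>n\<^sub>1 n\<^sub>2. \<epsilon>\<^sub>T t \<odot>\<^bsub>?P\<^esub> ?pure n\<^sub>1 n\<^sub>2) n"
    using t by (intro N.linear_map_comult[OF NN.module_tensor _ n] linear_map_scale[OF
        NN.module_tensor linear_map_id]) simp
  also have "\<dots> = sweedler K N ?P (\<lambda>n\<^sub>1 n\<^sub>2. sweedler K T ?P
      (\<lambda>t\<^sub>1 t\<^sub>2. ?pure (?\<mu> (tens n\<^sub>1 t\<^sub>1)) (?\<mu> (tens n\<^sub>2 t\<^sub>2))) t) n"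
    by (rule sweedler_cong) (rule inner[symmetric])
  finally show "comult N (?\<mu> (tens n t)) = sweedler K N ?P (\<lambda>n\<^sub>1 n\<^sub>2. sweedler K T ?P
      (\<lambda>t\<^sub>1 t\<^sub>2. ?pure (?\<mu> (tens n\<^sub>1 t\<^sub>1)) (?\<mu> (tens n\<^sub>2 t\<^sub>2))) t) n" .
  show "counit N (?\<mu> (tens n t)) = counit N n \<otimes>\<^bsub>K\<^esub> counit T t"
    using n t by (simp add: trivial_pure N.counit_smult N.R.m_comm)
qed

lemma trivial_\<nu>_coalgebra_map: "coalgebra_map K (tensor_coalg K N T) T (trivial_\<nu> K N T)"
proof (rule NT.coalgebra_mapI[OF T.coalgebra_axioms linear_trivial(2)])
  interpret TT: two_modules K T T ..
  interpret P: module K "tensor K T T" by (rule TT.module_tensor)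
  fix n t assume n: "n \<in> carrier N" and t: "t \<in> carrier T"
  let ?\<nu> = "trivial_\<nu> K N T" and ?P = "tensor K T T" and ?pure = "pure_tensor K T T"
  have inner: "sweedler K T ?P (\<lambda>t\<^sub>1 t\<^sub>2. ?pure (?\<nu> (tens n\<^sub>1 t\<^sub>1)) (?\<nu> (tens n\<^sub>2 t\<^sub>2))) t
      = \<epsilon>\<^sub>N n\<^sub>1 \<odot>\<^bsub>?P\<^esub> (\<epsilon>\<^sub>N n\<^sub>2 \<odot>\<^bsub>?P\<^esub> comult T t)" if n12: "n\<^sub>1 \<in> carrier N" "n\<^sub>2 \<in> carrier N" for n\<^sub>1 n\<^sub>2
  proof -
    have "\<epsilon>\<^sub>N n\<^sub>1 \<odot>\<^bsub>?P\<^esub> (\<epsilon>\<^sub>N n\<^sub>2 \<odot>\<^bsub>?P\<^esub> comult T t)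
        = sweedler K T ?P (\<lambda>t\<^sub>1 t\<^sub>2. \<epsilon>\<^sub>N n\<^sub>1 \<odot>\<^bsub>?P\<^esub> (\<epsilon>\<^sub>N n\<^sub>2 \<odot>\<^bsub>?P\<^esub> ?pure t\<^sub>1 t\<^sub>2)) t"
      using n12 by (intro T.linear_map_comult[OF TT.module_tensor _ t] linear_map_scale
          TT.module_tensor
          linear_map_id) simp_all
    also have "\<dots> = sweedler K T ?P (\<lambda>t\<^sub>1 t\<^sub>2. ?pure (?\<nu> (tens n\<^sub>1 t\<^sub>1)) (?\<nu> (tens n\<^sub>2 t\<^sub>2))) t"
      using n12 by (intro sweedler_cong)
        (simp add: trivial_pure linear_map_smult[OF TT.linear_map_pure(1)] linear_map_smult[OF
            TT.linear_map_pure(2)]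
          P.smult_commute)
    finally show ?thesis by simp
  qed
  have "comult T (?\<nu> (tens n t)) = \<epsilon>\<^sub>N n \<odot>\<^bsub>?P\<^esub> comult T t"
    using n t by (simp add: trivial_pure linear_map_smult[OF T.comult_linear])
  also have "\<dots> = sweedler K N ?P (\<lambda>n\<^sub>1 n\<^sub>2. \<epsilon>\<^sub>N n\<^sub>1 \<odot>\<^bsub>?P\<^esub> (\<epsilon>\<^sub>N n\<^sub>2 \<odot>\<^bsub>?P\<^esub> comult T t)) n"
    by (rule N.counit_counit[OF TT.module_tensor T.comult_closed[OF t] n, symmetric])
  also have "\<dots> = sweedler K N ?P (\<lambda>n\<^sub>1 n\<^sub>2. sweedler K T ?P
      (\<lambda>t\<^sub>1 t\<^sub>2. ?pure (?\<nu> (tens n\<^sub>1 t\<^sub>1)) (?\<nu> (tens n\<^sub>2 t\<^sub>2))) t) n"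
    by (rule sweedler_cong) (rule inner[symmetric])
  finally show "comult T (?\<nu> (tens n t)) = sweedler K N ?P (\<lambda>n\<^sub>1 n\<^sub>2. sweedler K T ?P
      (\<lambda>t\<^sub>1 t\<^sub>2. ?pure (?\<nu> (tens n\<^sub>1 t\<^sub>1)) (?\<nu> (tens n\<^sub>2 t\<^sub>2))) t) n" .
  show "counit T (?\<nu> (tens n t)) = counit N n \<otimes>\<^bsub>K\<^esub> counit T t"
    using n t by (simp add: trivial_pure T.counit_smult)
qed

lemma trivial_\<nu>_mult:
  assumes n: "n \<in> carrier N" and t: "t \<in> carrier T" and s: "s \<in> carrier T"
  shows "trivial_\<nu> K N T (tens n (t \<otimes>\<^bsub>T\<^esub> s)) =
      sweedler K N T (\<lambda>n\<^sub>1 n\<^sub>2. sweedler K T T (\<lambda>t\<^sub>1 t\<^sub>2. trivial_\<nu> K N T (tens n\<^sub>1 t\<^sub>1) \<otimes>\<^bsub>T\<^esub>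
        trivial_\<nu> K N T (tens (trivial_\<mu> K N T (tens n\<^sub>2 t\<^sub>2)) s)) t) n"
proof -
  have inner: "sweedler K T T (\<lambda>t\<^sub>1 t\<^sub>2. trivial_\<nu> K N T (tens n\<^sub>1 t\<^sub>1) \<otimes>\<^bsub>T\<^esub>
        trivial_\<nu> K N T (tens (trivial_\<mu> K N T (tens n\<^sub>2 t\<^sub>2)) s)) t
      = \<epsilon>\<^sub>N n\<^sub>1 \<odot>\<^bsub>T\<^esub> (\<epsilon>\<^sub>N n\<^sub>2 \<odot>\<^bsub>T\<^esub> (t \<otimes>\<^bsub>T\<^esub> s))"
    if n12: "n\<^sub>1 \<in> carrier N" "n\<^sub>2 \<in> carrier N" for n\<^sub>1 n\<^sub>2
  proof -
    have "sweedler K T T (\<lambda>t\<^sub>1 t\<^sub>2. trivial_\<nu> K N T (tens n\<^sub>1 t\<^sub>1) \<otimes>\<^bsub>T\<^esub>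
          trivial_\<nu> K N T (tens (trivial_\<mu> K N T (tens n\<^sub>2 t\<^sub>2)) s)) t
        = sweedler K T T (\<lambda>t\<^sub>1 t\<^sub>2. \<epsilon>\<^sub>T t\<^sub>2 \<odot>\<^bsub>T\<^esub> (\<epsilon>\<^sub>N n\<^sub>1 \<odot>\<^bsub>T\<^esub> (\<epsilon>\<^sub>N n\<^sub>2 \<odot>\<^bsub>T\<^esub> (t\<^sub>1 \<otimes>\<^bsub>T\<^esub> s)))) t"
      using n12 s by (intro sweedler_cong)
        (simp add: trivial_pure N.counit_smult T.smult_mult_left T.smult_mult_right
          T.smult_assoc1 T.smult_commute)
    also have "\<dots> = \<epsilon>\<^sub>N n\<^sub>1 \<odot>\<^bsub>T\<^esub> (\<epsilon>\<^sub>N n\<^sub>2 \<odot>\<^bsub>T\<^esub> (t \<otimes>\<^bsub>T\<^esub> s))"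
      using n12 s by (intro T.counit_right_linear[OF T.module_C _ t] linear_map_scale T.module_C
          T.linear_product) simp_all
    finally show ?thesis .
  qed
  have "trivial_\<nu> K N T (tens n (t \<otimes>\<^bsub>T\<^esub> s)) = \<epsilon>\<^sub>N n \<odot>\<^bsub>T\<^esub> (t \<otimes>\<^bsub>T\<^esub> s)"
    using n t s by (simp add: trivial_pure)
  also have "\<dots> = sweedler K N T (\<lambda>n\<^sub>1 n\<^sub>2. \<epsilon>\<^sub>N n\<^sub>1 \<odot>\<^bsub>T\<^esub> (\<epsilon>\<^sub>N n\<^sub>2 \<odot>\<^bsub>T\<^esub> (t \<otimes>\<^bsub>T\<^esub> s))) n"
    by (rule N.counit_counit[OF T.module_C T.m_closed[OF t s] n, symmetric])
  also have "\<dots> = sweedler K N T (\<lambda>n\<^sub>1 n\<^sub>2. sweedler K T T (\<lambda>t\<^sub>1 t\<^sub>2. trivial_\<nu> K N T (tens n\<^sub>1 t\<^sub>1) \<otimes>\<^bsub>T\<^esub>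
        trivial_\<nu> K N T (tens (trivial_\<mu> K N T (tens n\<^sub>2 t\<^sub>2)) s)) t) n"
    by (rule sweedler_cong) (rule inner[symmetric])
  finally show ?thesis .
qed

lemma trivial_\<mu>_mult:
  assumes n: "n \<in> carrier N" and m: "m \<in> carrier N" and t: "t \<in> carrier T"
  shows "trivial_\<mu> K N T (tens (n \<otimes>\<^bsub>N\<^esub> m) t) =
      sweedler K N N (\<lambda>m\<^sub>1 m\<^sub>2. sweedler K T N (\<lambda>t\<^sub>1 t\<^sub>2.
        trivial_\<mu> K N T (tens n (trivial_\<nu> K N T (tens m\<^sub>1 t\<^sub>1))) \<otimes>\<^bsub>N\<^esub>
        trivial_\<mu> K N T (tens m\<^sub>2 t\<^sub>2)) t) m"
proof -
  have inner: "sweedler K T N (\<lambda>t\<^sub>1 t\<^sub>2.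
        trivial_\<mu> K N T (tens n (trivial_\<nu> K N T (tens m\<^sub>1 t\<^sub>1))) \<otimes>\<^bsub>N\<^esub> trivial_\<mu> K N T (tens m\<^sub>2 t\<^sub>2)) t
      = \<epsilon>\<^sub>N m\<^sub>1 \<odot>\<^bsub>N\<^esub> (\<epsilon>\<^sub>T t \<odot>\<^bsub>N\<^esub> (n \<otimes>\<^bsub>N\<^esub> m\<^sub>2))"
    if m12: "m\<^sub>1 \<in> carrier N" "m\<^sub>2 \<in> carrier N" for m\<^sub>1 m\<^sub>2
  proof -
    have "sweedler K T N (\<lambda>t\<^sub>1 t\<^sub>2.
        trivial_\<mu> K N T (tens n (trivial_\<nu> K N T (tens m\<^sub>1 t\<^sub>1))) \<otimes>\<^bsub>N\<^esub> trivial_\<mu> K N T (tens m\<^sub>2 t\<^sub>2)) t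
        = sweedler K T N (\<lambda>t\<^sub>1 t\<^sub>2. \<epsilon>\<^sub>T t\<^sub>1 \<odot>\<^bsub>N\<^esub> (\<epsilon>\<^sub>T t\<^sub>2 \<odot>\<^bsub>N\<^esub> (\<epsilon>\<^sub>N m\<^sub>1 \<odot>\<^bsub>N\<^esub> (n \<otimes>\<^bsub>N\<^esub> m\<^sub>2)))) t"
      using n m12 by (intro sweedler_cong)
        (simp add: trivial_pure T.counit_smult N.smult_mult_left N.smult_mult_right
          N.smult_assoc1 N.smult_commute)
    also have "\<dots> = \<epsilon>\<^sub>T t \<odot>\<^bsub>N\<^esub> (\<epsilon>\<^sub>N m\<^sub>1 \<odot>\<^bsub>N\<^esub> (n \<otimes>\<^bsub>N\<^esub> m\<^sub>2))"
      using n m12 by (intro T.counit_counit[OF N.module_C _ t]) simp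
    also have "\<dots> = \<epsilon>\<^sub>N m\<^sub>1 \<odot>\<^bsub>N\<^esub> (\<epsilon>\<^sub>T t \<odot>\<^bsub>N\<^esub> (n \<otimes>\<^bsub>N\<^esub> m\<^sub>2))"
      using n m12 t by (intro N.smult_commute) simp_all
    finally show ?thesis .
  qed
  have "trivial_\<mu> K N T (tens (n \<otimes>\<^bsub>N\<^esub> m) t) = \<epsilon>\<^sub>T t \<odot>\<^bsub>N\<^esub> (n \<otimes>\<^bsub>N\<^esub> m)"
    using n m t by (simp add: trivial_pure)
  also have "\<dots> = sweedler K N N (\<lambda>m\<^sub>1 m\<^sub>2. \<epsilon>\<^sub>N m\<^sub>1 \<odot>\<^bsub>N\<^esub> (\<epsilon>\<^sub>T t \<odot>\<^bsub>N\<^esub> (n \<otimes>\<^bsub>N\<^esub> m\<^sub>2))) m"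
    using n t by (intro N.counit_left_linear[OF N.module_C _ m, symmetric] linear_map_scale
        N.module_C
        N.linear_product) simp_all
  also have "\<dots> = sweedler K N N (\<lambda>m\<^sub>1 m\<^sub>2. sweedler K T N (\<lambda>t\<^sub>1 t\<^sub>2.
        trivial_\<mu> K N T (tens n (trivial_\<nu> K N T (tens m\<^sub>1 t\<^sub>1))) \<otimes>\<^bsub>N\<^esub>
        trivial_\<mu> K N T (tens m\<^sub>2 t\<^sub>2)) t) m"
    by (rule sweedler_cong) (rule inner[symmetric])
  finally show ?thesis .
qed

lemma trivial_matched_pair: "abelian_matched_pair K N T (trivial_\<mu> K N T) (trivial_\<nu> K N T)"
proof (rule abelian_matched_pair.intro)
  show "abelian_matched_pair_axioms K N T (trivial_\<mu> K N T) (trivial_\<nu> K N T)"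
    by (rule abelian_matched_pair_axioms.intro[OF trivial_\<mu>_coalgebra_map trivial_\<nu>_coalgebra_map])
      (simp_all add: trivial_\<nu>_mult trivial_\<mu>_mult,
       simp_all add: trivial_pure T.counit_mult N.counit_mult T.counit_one N.counit_one
        N.smult_assoc1 T.smult_assoc1 N.smult_commute)
qed unfold_locales

text \<open>In the first equation \<open>n(t)\<close> becomes \<open>\<epsilon>(n) t\<close>, so the sum over \<open>\<Delta>(m)\<close> collapses. In the
  second one the sum over \<open>\<Delta>(t)\<close> collapses to \<open>f(n\<^sub>1, s) f(n\<^sub>2, t)\<close>, which is \<open>f(n\<^sub>1, t) f(n\<^sub>2, s)\<close> by
  cocommutativity of \<open>N\<close> and commutativity of \<open>A\<close>.\<close>

lemma bimeasurings_eq_trivial_skew: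
  assumes "algebra K A"
  shows "bimeasurings K N T A = skew_bimeasurings K N T (trivial_\<mu> K N T) (trivial_\<nu> K N T) A"
proof -
  interpret NTA: double_convolution K N T A
    by (intro double_convolution.intro convolution.intro assms) unfold_locales
  let ?\<mu> = "trivial_\<mu> K N T" and ?\<nu> = "trivial_\<nu> K N T"
  have 1: "sweedler K N A (\<lambda>m\<^sub>1 m\<^sub>2. sweedler K T A
      (\<lambda>t\<^sub>1 t\<^sub>2. f (tens n (?\<nu> (tens m\<^sub>1 t\<^sub>1))) \<otimes>\<^bsub>A\<^esub> f (tens m\<^sub>2 t\<^sub>2)) t) m
    = sweedler K T A (\<lambda>t\<^sub>1 t\<^sub>2. f (tens n t\<^sub>1) \<otimes>\<^bsub>A\<^esub> f (tens m t\<^sub>2)) t"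
    if f: "linear_map K (tensor K N T) A f" and n: "n \<in> carrier N" and m: "m \<in> carrier N" and t: "t
        \<in> carrier T"
    for f n m t
  proof -
    have fc: "f (tens n t) \<in> carrier A" if "n \<in> carrier N" "t \<in> carrier T" for n t
      using that by (intro linear_map_closed[OF f] NT.pure_closed)
    have bil: "bilinear_map K T T A (\<lambda>t\<^sub>1 t\<^sub>2. f (tens n t\<^sub>1) \<otimes>\<^bsub>A\<^esub> f (tens m\<^sub>2 t\<^sub>2))"
      if "m\<^sub>2 \<in> carrier N" for m\<^sub>2
      using that by (intro NTA.DA.bilinear_mult_maps linear_map_compose[OF f] NT.linear_map_pure n)
    have "sweedler K N A (\<lambda>m\<^sub>1 m\<^sub>2. sweedler K T A
        (\<lambda>t\<^sub>1 t\<^sub>2. f (tens n (?\<nu> (tens m\<^sub>1 t\<^sub>1))) \<otimes>\<^bsub>A\<^esub> f (tens m\<^sub>2 t\<^sub>2)) t) m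
      = sweedler K N A (\<lambda>m\<^sub>1 m\<^sub>2. \<epsilon>\<^sub>N m\<^sub>1 \<odot>\<^bsub>A\<^esub> sweedler K T A
        (\<lambda>t\<^sub>1 t\<^sub>2. f (tens n t\<^sub>1) \<otimes>\<^bsub>A\<^esub> f (tens m\<^sub>2 t\<^sub>2)) t) m"
    proof (rule sweedler_cong)
      fix m\<^sub>1 m\<^sub>2 assume m12: "m\<^sub>1 \<in> carrier N" "m\<^sub>2 \<in> carrier N"
      have "\<epsilon>\<^sub>N m\<^sub>1 \<odot>\<^bsub>A\<^esub> sweedler K T A (\<lambda>t\<^sub>1 t\<^sub>2. f (tens n t\<^sub>1) \<otimes>\<^bsub>A\<^esub> f (tens m\<^sub>2 t\<^sub>2)) t
          = sweedler K T A (\<lambda>t\<^sub>1 t\<^sub>2. \<epsilon>\<^sub>N m\<^sub>1 \<odot>\<^bsub>A\<^esub> (f (tens n t\<^sub>1) \<otimes>\<^bsub>A\<^esub> f (tens m\<^sub>2 t\<^sub>2))) t"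
        using m12 by (intro T.linear_map_sweedler[OF NTA.DA.A.module NTA.DA.A.module _ bil t]
            linear_map_scale[OF NTA.DA.A.module linear_map_id]) simp_all
      also have "\<dots> = sweedler K T A
          (\<lambda>t\<^sub>1 t\<^sub>2. f (tens n (?\<nu> (tens m\<^sub>1 t\<^sub>1))) \<otimes>\<^bsub>A\<^esub> f (tens m\<^sub>2 t\<^sub>2)) t"
        using n m12 by (intro sweedler_cong)
          (simp add: trivial_pure linear_map_smult[OF NT.linear_map_pure(2)] linear_map_smult[OF f]
            NTA.DA.A.smult_assoc2 fc)
      finally show "sweedler K T A
          (\<lambda>t\<^sub>1 t\<^sub>2. f (tens n (?\<nu> (tens m\<^sub>1 t\<^sub>1))) \<otimes>\<^bsub>A\<^esub> f (tens m\<^sub>2 t\<^sub>2)) t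
          = \<epsilon>\<^sub>N m\<^sub>1 \<odot>\<^bsub>A\<^esub> sweedler K T A (\<lambda>t\<^sub>1 t\<^sub>2. f (tens n t\<^sub>1) \<otimes>\<^bsub>A\<^esub> f (tens m\<^sub>2 t\<^sub>2)) t"
        by simp
    qed
    also have "\<dots> = sweedler K T A (\<lambda>t\<^sub>1 t\<^sub>2. f (tens n t\<^sub>1) \<otimes>\<^bsub>A\<^esub> f (tens m t\<^sub>2)) t"
      by (intro N.counit_left_linear[OF NTA.DA.A.module _ m] T.sweedler_linear_param NTA.DA.A.module
          N.module_C bil t
          NTA.DA.linear_mult_right linear_map_compose[OF f] NT.linear_map_pure fc n)
    finally show ?thesis .
  qed
  have 2: "sweedler K N A (\<lambda>n\<^sub>1 n\<^sub>2. sweedler K T A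
      (\<lambda>t\<^sub>1 t\<^sub>2. f (tens (?\<mu> (tens n\<^sub>1 t\<^sub>1)) s) \<otimes>\<^bsub>A\<^esub> f (tens n\<^sub>2 t\<^sub>2)) t) n
    = sweedler K N A (\<lambda>n\<^sub>1 n\<^sub>2. f (tens n\<^sub>1 t) \<otimes>\<^bsub>A\<^esub> f (tens n\<^sub>2 s)) n"
    if f: "linear_map K (tensor K N T) A f" and n: "n \<in> carrier N" and t: "t \<in> carrier T" and s: "s
        \<in> carrier T"
    for f n t s
  proof -
    have fc: "f (tens n t) \<in> carrier A" if "n \<in> carrier N" "t \<in> carrier T" for n t
      using that by (intro linear_map_closed[OF f] NT.pure_closed)
    have "sweedler K N A (\<lambda>n\<^sub>1 n\<^sub>2. sweedler K T A
        (\<lambda>t\<^sub>1 t\<^sub>2. f (tens (?\<mu> (tens n\<^sub>1 t\<^sub>1)) s) \<otimes>\<^bsub>A\<^esub> f (tens n\<^sub>2 t\<^sub>2)) t) n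
      = sweedler K N A (\<lambda>n\<^sub>1 n\<^sub>2. f (tens n\<^sub>2 t) \<otimes>\<^bsub>A\<^esub> f (tens n\<^sub>1 s)) n"
    proof (rule sweedler_cong)
      fix n\<^sub>1 n\<^sub>2 assume n12: "n\<^sub>1 \<in> carrier N" "n\<^sub>2 \<in> carrier N"
      have "sweedler K T A (\<lambda>t\<^sub>1 t\<^sub>2. f (tens (?\<mu> (tens n\<^sub>1 t\<^sub>1)) s) \<otimes>\<^bsub>A\<^esub> f (tens n\<^sub>2 t\<^sub>2)) t
          = sweedler K T A (\<lambda>t\<^sub>1 t\<^sub>2. \<epsilon>\<^sub>T t\<^sub>1 \<odot>\<^bsub>A\<^esub> (f (tens n\<^sub>2 t\<^sub>2) \<otimes>\<^bsub>A\<^esub> f (tens n\<^sub>1 s))) t"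
        using n12 s by (intro sweedler_cong)
          (simp add: trivial_pure linear_map_smult[OF NT.linear_map_pure(1)] linear_map_smult[OF f]
            assoc_algebra.smult_mult_right[OF NTA.DA.assoc_algebra_A] fc NTA.DA.A.m_comm)
      also have "\<dots> = f (tens n\<^sub>2 t) \<otimes>\<^bsub>A\<^esub> f (tens n\<^sub>1 s)"
        using n12 s by (intro T.counit_left_linear[OF NTA.DA.A.module _ t] NTA.DA.linear_mult_left
            linear_map_compose[OF f] NT.linear_map_pure fc)
      finally show "sweedler K T A
          (\<lambda>t\<^sub>1 t\<^sub>2. f (tens (?\<mu> (tens n\<^sub>1 t\<^sub>1)) s) \<otimes>\<^bsub>A\<^esub> f (tens n\<^sub>2 t\<^sub>2)) t
          = f (tens n\<^sub>2 t) \<otimes>\<^bsub>A\<^esub> f (tens n\<^sub>1 s)" .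
    qed
    also have "\<dots> = sweedler K N A (\<lambda>n\<^sub>1 n\<^sub>2. f (tens n\<^sub>1 t) \<otimes>\<^bsub>A\<^esub> f (tens n\<^sub>2 s)) n"
      by (intro N.sweedler_flip[OF NTA.DA.A.module _ n] NTA.DA.bilinear_mult_maps
          linear_map_compose[OF f] NT.linear_map_pure t s)
    finally show ?thesis .
  qed
  show ?thesis
    unfolding bimeasurings_def skew_bimeasurings_def Let_def
    by (rule Collect_cong) (auto simp: 1 2 Hom_def)
qed

end

section \<open>The isomorphisms\<close>

lemma (in coalgebra_actions) skew_bimeasuring_group_iso_H1:
  "comm_group (skew_bimeasuring_group K N T \<mu> \<nu> A)"
  "comm_group (H1 K N T \<mu> \<nu> A)"
  "skew_bimeasuring_group K N T \<mu> \<nu> A \<cong> H1 K N T \<mu> \<nu> A"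
  unfolding skew_bimeasurings_eq_one_cocycles
  using comm_group_of_units[OF NT.comm_monoid_M subgroup_one_cocycles] by (simp_all add: iso_refl)

theorem proposition5p1:
  fixes K :: "'k ring"
    and N :: "('k, 'n) coalg"
    and T :: "('k, 't) coalg"
    and A :: "('k, 'a) module"
    and \<mu> :: "('n \<times> 't) multiset set \<Rightarrow> 'n"
    and \<nu> :: "('n \<times> 't) multiset set \<Rightarrow> 't"
  assumes "field K"
    and "cocommutative_hopf_algebra K N"
    and "cocommutative_hopf_algebra K T"
    and "abelian_matched_pair K N T \<mu> \<nu>"
    and "algebra K A"
  shows "(comm_group (skew_bimeasuring_group K N T \<mu> \<nu> A) \<and>
      comm_group (H1 K N T \<mu> \<nu> A) \<and>
      skew_bimeasuring_group K N T \<mu> \<nu> A \<cong> H1 K N T \<mu> \<nu> A)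
    \<and> (abelian_matched_pair K N T (trivial_\<mu> K N T) (trivial_\<nu> K N T) \<and>
      comm_group (bimeasuring_group K N T A) \<and>
      comm_group (H1 K N T (trivial_\<mu> K N T) (trivial_\<nu> K N T) A) \<and>
      bimeasuring_group K N T A \<cong> H1 K N T (trivial_\<mu> K N T) (trivial_\<nu> K N T) A)"
proof -
  interpret pair: hopf_pair K N T by (intro hopf_pair.intro assms)
  have actions: "coalgebra_actions K N T A \<mu>' \<nu>'"
    if "abelian_matched_pair K N T \<mu>' \<nu>'" for \<mu>' \<nu>'
    using that assms
    by (auto intro!: coalgebra_actions.intro coalgebra_actions_axioms.intro
      simp: abelian_matched_pair_def abelian_matched_pair_axioms_def)
  note skew = coalgebra_actions.skew_bimeasuring_group_iso_H1[OF actions]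
  show ?thesis
    unfolding pair.bimeasurings_eq_trivial_skew[OF assms(5)]
    using skew[OF assms(4)] skew[OF pair.trivial_matched_pair] pair.trivial_matched_pair by blast
qed

end
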